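(* Let $E\subset\mathbb{C}$ be a regular compact set with connected complement $\overline{\mathbb{C}}\setminus E$, let $\mu\in\mathcal{B}(\partial E)$, and let $\beta=\{\{\beta_{n,k}\}_{k=1}^n\}_{n=1}^\infty$ be a triangular table of points with all $\beta_{n,k}\in\partial E$. Put $\omega_n(z)=\prod_{k=1}^n(z-\beta_{n,k})$. Let $m\in\mathbb{N}$ be fixed and let $f\in\mathcal{A}(E)$ be such that $\varrho_{\max}<R_{m,\mu}<\infty$, where $R_{m,\mu}=R_{m,\mu}(f)$. Suppose that $D_{m,\mu}=E_\mu(R_{m,\mu})$ is connected. Let $Q$ be the monic polynomial whose zeros are the poles of $f$ in $D_{m,\mu}$ (counted with multiplicity), and let $\pi_{n,m}^{\beta,f}=P_{n,m}^{\beta,f}/Q_{n,m}^{\beta,f}$ be the $\beta$-multipoint Padé approximant of $f$ of order $(n,m)$, with $P_{n,m}^{\beta,f}$ and $Q_{n,m}^{\beta,f}$ coprime and $Q_{n,m}^{\beta,f}$ normalized with respect to $D_{m,\mu}$. Suppose that $\Lambda\subset\mathbb{N}$ is an infinite set such that for every nonempty compact set $K\subset D_{m,\mu}\setminus E$ $$\lim_{n\to\infty,\,n\in\Lambda}\big\|QfQ_{n,m}^{\beta,f}-QP_{n,m}^{\beta,f}\big\|_K^{1/n}=\frac{\|e^{-U^\mu}\|_K}{R_{m,\mu}}.$$ Then the normalized zero counting measures satisfy $\mu_{\omega_n}\longrightarrow\mu$ weakly as $n\to\infty$, $n\in\Lambda$.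
   Context: Notation. $\Pi_n$ is the set of complex polynomials of degree $\le n$. For a nonempty compact set $K$, $\|g\|_K$ denotes the maximum norm (supremum of $|g|$) on $K$. A compact set $E$ with connected complement is regular if $\overline{\mathbb{C}}\setminus E$ is regular for the Dirichlet problem. Measures and potentials. $\mathcal{B}(E)$ (resp. $\mathcal{B}(\partial E)$) is the set of positive Borel measures of total mass $1$ supported on $E$ (resp. $\partial E$). Weak convergence $\mu_n\longrightarrow\mu$ of measures in $\mathcal{B}(E)$ means $\int g\,d\mu_n\to\int g\,d\mu$ for every continuous function $g$ on $E$. $U^\mu(z)=\int\log\frac{1}{|z-t|}\,d\mu(t)$ is the logarithmic potential. For a polynomial $p$ of positive degree, $\mu_p$ is its normalized zero counting measure: $\mu_p(F)$ is the number of zeros of $p$ in $F$ (with multiplicity) divided by $\deg p$. Functions. $f\in\mathcal{A}(E)$ means that $f$ is holomorphic in some open neighborhood of $E$. For an open set $B$, $f\in\mathcal{M}_m(B)$ means that $f$ is (continues to be) meromorphic in $B$ with at most $m$ poles there, counted with multiplicity. Level sets. For $\mu\in\mathcal{B}(E)$ put $\rho_{\min}=\inf_{z\in E}e^{-U^\mu(z)}$, $\varrho_{\max}=\max_{z\in E}e^{-U^\mu(z)}$, and, for $r>\rho_{\min}$, $E_\mu(r)=\{z\in\mathbb{C}: e^{-U^\mu(z)}<r\}$, which is an open set, containing $E$ when $r>\varrho_{\max}$. Put $R_{m,\mu}(f)=\sup\{r: f\in\mathcal{M}_m(E_\mu(r))\}$ and $D_{m,\mu}(f)=E_\mu(R_{m,\mu}(f))$.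 The function $f$ is identified with its meromorphic continuation to $D_{m,\mu}$. Multipoint Padé approximants. For nonnegative integers $n,m$, $\pi_{n,m}^{\beta,f}$ is the rational function $p/q$, where $p\in\Pi_n$, $q\in\Pi_m$, $q\not\equiv0$, are such that $(fq-p)/\omega_{n+m+1}\in\mathcal{A}(E)$. Such $p,q$ exist and the rational function $p/q$ is unique. Write $\pi_{n,m}^{\beta,f}=P_{n,m}^{\beta,f}/Q_{n,m}^{\beta,f}$ with $P_{n,m}^{\beta,f}$, $Q_{n,m}^{\beta,f}$ without common divisors. The normalization of $Q_{n,m}^{\beta,f}$ with respect to $D_{m,\mu}$ is $$Q_{n,m}^{\beta,f}(z)=\prod_k(z-\alpha'_{n,k})\prod_k\big(1-z/\alpha''_{n,k}\big),$$ where $\alpha'_{n,k}$ and $\alpha''_{n,k}$ are the zeros of $Q_{n,m}^{\beta,f}$ lying in $D_{m,\mu}$ and outside $D_{m,\mu}$, respectively; this determines $P_{n,m}^{\beta,f}$ as well.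
   Formalization: The conclusion is proved for the zero counting measures of ω_{n+m+1} (not ω_n), n∈Λ: these are the nodes the approximants use. As printed it fails for general Λ, since rows of β are unrelated; for Λ=ℕ both versions agree. *)

theory Defs
  imports "HOL-Probability.Probability" "HOL-Complex_Analysis.Complex_Analysis"
    "HOL-Computational_Algebra.Fundamental_Theorem_Algebra"
begin

section \<open>Regular compact sets\<close>

text \<open>The Riemann sphere is the one-point compactification of the plane; \<open>None\<close> is the point at
  infinity.\<close>

abbreviation riemann_sphere :: "complex option topology" where
  "riemann_sphere \<equiv> Alexandroff_compactification euclidean"

definition sphere_complement :: "complex set \<Rightarrow> complex option set" where
  "sphere_complement E = topspace riemann_sphere - Some ` E"

text \<open>Twice continuously differentiable with vanishing Laplacian; \<open>u1\<close> and \<open>u2\<close> are the first and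
  second Frechet derivatives.\<close>

definition harmonic_on :: "(complex \<Rightarrow> real) \<Rightarrow> complex set \<Rightarrow> bool" where
  "harmonic_on u S \<longleftrightarrow> open S \<and>
    (\<exists>(u1 :: complex \<Rightarrow> complex \<Rightarrow>\<^sub>L real) (u2 :: complex \<Rightarrow> complex \<Rightarrow>\<^sub>L complex \<Rightarrow>\<^sub>L real).
      (\<forall>z\<in>S. (u has_derivative blinfun_apply (u1 z)) (at z)) \<and>
      (\<forall>z\<in>S. (u1 has_derivative blinfun_apply (u2 z)) (at z)) \<and>
      continuous_on S u2 \<and>
      (\<forall>z\<in>S. blinfun_apply (blinfun_apply (u2 z) 1) 1
              + blinfun_apply (blinfun_apply (u2 z) \<i>) \<i> = 0))"

definition chart_at_infinity :: "complex \<Rightarrow> complex option" where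
  "chart_at_infinity w = (if w = 0 then None else Some (1 / w))"

definition sphere_harmonic_on :: "(complex option \<Rightarrow> real) \<Rightarrow> complex option set \<Rightarrow> bool" where
  "sphere_harmonic_on u W \<longleftrightarrow>
    harmonic_on (u \<circ> Some) (Some -` W) \<and>
    harmonic_on (u \<circ> chart_at_infinity) (chart_at_infinity -` W)"

definition dirichlet_regular :: "complex option set \<Rightarrow> bool" where
  "dirichlet_regular W \<longleftrightarrow>
    (\<forall>\<phi>. continuous_map (subtopology riemann_sphere (riemann_sphere frontier_of W)) euclideanreal \<phi> \<longrightarrow>
      (\<exists>u. continuous_map (subtopology riemann_sphere (riemann_sphere closure_of W)) euclideanreal u \<and>
           sphere_harmonic_on u W \<and>
           (\<forall>x \<in> riemann_sphere frontier_of W. u x = \<phi> x)))"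

definition regular_compact :: "complex set \<Rightarrow> bool" where
  "regular_compact E \<longleftrightarrow>
    compact E \<and> connectedin riemann_sphere (sphere_complement E) \<and>
    dirichlet_regular (sphere_complement E)"


section \<open>Measures and potentials\<close>

text \<open>Positive Borel measures of total mass one supported on the closed set \<open>F\<close>.\<close>

definition prob_measures_on :: "complex set \<Rightarrow> complex measure set" where
  "prob_measures_on F = {\<mu>. sets \<mu> = sets borel \<and> prob_space \<mu> \<and> emeasure \<mu> (- F) = 0}"

text \<open>The test functions are only continuous on \<open>E\<close>, hence the integrals over \<open>E\<close>.\<close>

definition weakly_converges ::
    "complex set \<Rightarrow> ('i \<Rightarrow> complex measure) \<Rightarrow> complex measure \<Rightarrow> 'i filter \<Rightarrow> bool" where
  "weakly_converges E \<nu> \<mu> \<FF> \<longleftrightarrow>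
    (\<forall>g :: complex \<Rightarrow> real. continuous_on E g \<longrightarrow>
      ((\<lambda>n. LINT z:E|\<nu> n. g z) \<longlongrightarrow> (LINT z:E|\<mu>. g z)) \<FF>)"

text \<open>The integral is split into its positive and negative part, since the potential may take the
  value \<open>\<infinity>\<close>. For a finite measure with compact support the second part is finite.\<close>

definition log_kernel :: "complex \<Rightarrow> complex \<Rightarrow> ereal" where
  "log_kernel z t = (if t = z then \<infinity> else ereal (ln (1 / cmod (z - t))))"

definition log_potential :: "complex measure \<Rightarrow> complex \<Rightarrow> ereal" where
  "log_potential \<mu> z =
    enn2ereal (\<integral>\<^sup>+ t. e2ennreal (log_kernel z t) \<partial>\<mu>)
    - enn2ereal (\<integral>\<^sup>+ t. e2ennreal (- log_kernel z t) \<partial>\<mu>)"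

definition exp_potential :: "complex measure \<Rightarrow> complex \<Rightarrow> real" where
  "exp_potential \<mu> z =
    (if log_potential \<mu> z = \<infinity> then 0 else exp (- real_of_ereal (log_potential \<mu> z)))"

definition zero_counting_measure :: "complex poly \<Rightarrow> complex measure" where
  "zero_counting_measure p = distr (measure_pmf (pmf_of_multiset (proots p))) borel (\<lambda>z. z)"

lemma measure_zero_counting_measure:
  assumes "degree p > 0" and "F \<in> sets borel"
  shows "measure (zero_counting_measure p) F
           = real (size (filter_mset (\<lambda>z. z \<in> F) (proots p))) / real (degree p)"
proof -
  let ?M = "proots p"
  have ne: "?M \<noteq> {#}"
    using assms(1) size_proots_complex[of p] by force
  have sz: "size (filter_mset (\<lambda>z. z \<in> F) ?M) = (\<Sum>x \<in> F \<inter> set_mset ?M. count ?M x)"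
    by (auto simp: size_multiset_overloaded_eq intro!: sum.cong)
  have "measure (zero_counting_measure p) F = measure (measure_pmf (pmf_of_multiset ?M)) F"
    unfolding zero_counting_measure_def by (subst measure_distr) (use assms in auto)
  also have "\<dots> = measure (measure_pmf (pmf_of_multiset ?M)) (F \<inter> set_mset ?M)"
    using measure_Int_set_pmf[of "pmf_of_multiset ?M" F] ne by simp
  also have "\<dots> = (\<Sum>x \<in> F \<inter> set_mset ?M. real (count ?M x) / real (size ?M))"
    using ne by (subst measure_measure_pmf_finite) auto
  also have "\<dots> = real (size (filter_mset (\<lambda>z. z \<in> F) ?M)) / real (size ?M)"
    by (simp add: sz sum_divide_distrib)
  finally show ?thesis
    by (simp add: size_proots_complex)
qed

definition sup_norm_on :: "complex set \<Rightarrow> (complex \<Rightarrow> 'a :: real_normed_vector) \<Rightarrow> real" where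
  "sup_norm_on K g = (SUP z\<in>K. norm (g z))"


section \<open>Level sets and meromorphic continuation\<close>

definition rho_min :: "complex set \<Rightarrow> complex measure \<Rightarrow> real" where
  "rho_min E \<mu> = (INF z\<in>E. exp_potential \<mu> z)"

definition rho_max :: "complex set \<Rightarrow> complex measure \<Rightarrow> real" where
  "rho_max E \<mu> = (SUP z\<in>E. exp_potential \<mu> z)"

definition level_set :: "complex measure \<Rightarrow> real \<Rightarrow> complex set" where
  "level_set \<mu> r = {z. exp_potential \<mu> z < r}"

text \<open>\<open>g\<close> is a continuation to \<open>B\<close> of the function \<open>f\<close>, given near \<open>E\<close>, which is meromorphic with
  at most \<open>m\<close> poles in \<open>B\<close>. Only the values of \<open>f\<close> near \<open>E\<close> matter.\<close>

definition meromorphic_continuation ::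
    "nat \<Rightarrow> complex set \<Rightarrow> (complex \<Rightarrow> complex) \<Rightarrow> complex set \<Rightarrow> (complex \<Rightarrow> complex) \<Rightarrow> bool" where
  "meromorphic_continuation m E f B g \<longleftrightarrow>
    g nicely_meromorphic_on B \<and>
    finite {z\<in>B. is_pole g z} \<and>
    (\<Sum>z | z \<in> B \<and> is_pole g z. nat (- zorder g z)) \<le> m \<and>
    (\<exists>U. open U \<and> E \<subseteq> U \<and> (\<forall>z \<in> U \<inter> B. g z = f z))"

definition radius_meromorphy :: "nat \<Rightarrow> complex set \<Rightarrow> complex measure \<Rightarrow> (complex \<Rightarrow> complex) \<Rightarrow> ereal" where
  "radius_meromorphy m E \<mu> f =
    Sup {ereal r | r. rho_min E \<mu> < r \<and> (\<exists>g. meromorphic_continuation m E f (level_set \<mu> r) g)}"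

text \<open>The function \<open>f\<close>, identified with its continuation to \<open>B\<close>.\<close>

definition continued ::
    "nat \<Rightarrow> complex set \<Rightarrow> (complex \<Rightarrow> complex) \<Rightarrow> complex set \<Rightarrow> complex \<Rightarrow> complex" where
  "continued m E f B = (SOME g. meromorphic_continuation m E f B g)"

definition pole_poly :: "complex set \<Rightarrow> (complex \<Rightarrow> complex) \<Rightarrow> complex poly" where
  "pole_poly B g = (\<Prod>z | z \<in> B \<and> is_pole g z. [:- z, 1:] ^ nat (- zorder g z))"


section \<open>Multipoint Pade approximants\<close>

text \<open>Different rows of the table are unrelated, and the approximant of order \<open>(n, m)\<close> depends only
  on row \<open>n + m + 1\<close>.\<close>

definition node_poly :: "(nat \<Rightarrow> nat \<Rightarrow> complex) \<Rightarrow> nat \<Rightarrow> complex poly" where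
  "node_poly \<beta> n = (\<Prod>k=1..n. [:- \<beta> n k, 1:])"

text \<open>\<open>(f q - p) / \<omega>\<close> has an analytic extension \<open>h\<close> to a neighbourhood of \<open>E\<close>.\<close>

definition pade_pair ::
    "complex set \<Rightarrow> (nat \<Rightarrow> nat \<Rightarrow> complex) \<Rightarrow> (complex \<Rightarrow> complex) \<Rightarrow> nat \<Rightarrow> nat
      \<Rightarrow> complex poly \<Rightarrow> complex poly \<Rightarrow> bool" where
  "pade_pair E \<beta> f n m p q \<longleftrightarrow>
    degree p \<le> n \<and> degree q \<le> m \<and> q \<noteq> 0 \<and>
    (\<exists>h U. h analytic_on E \<and> open U \<and> E \<subseteq> U \<and>
      (\<forall>z\<in>U. f z * poly q z - poly p z = poly (node_poly \<beta> (n + m + 1)) z * h z))"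

text \<open>The factor \<open>1 - z / \<alpha>\<close> makes no sense for \<open>\<alpha> = 0\<close>. If \<open>0\<close> is a zero outside \<open>D\<close>, the factor
  \<open>z\<close> is used.\<close>

definition normalized_wrt :: "complex set \<Rightarrow> complex poly \<Rightarrow> bool" where
  "normalized_wrt D q \<longleftrightarrow>
    q = (\<Prod>\<alpha>\<in>#proots q. if \<alpha> \<in> D \<or> \<alpha> = 0 then [:- \<alpha>, 1:] else [:1, - 1 / \<alpha>:])"

text \<open>\<open>P / Q\<close> is the reduced form of the approximant of order \<open>(n, m)\<close>, normalized with respect to
  \<open>D\<close>; cross-multiplication expresses \<open>P / Q = p / q\<close>.\<close>

definition pade_approximant ::
    "complex set \<Rightarrow> (nat \<Rightarrow> nat \<Rightarrow> complex) \<Rightarrow> (complex \<Rightarrow> complex) \<Rightarrow> nat \<Rightarrow> nat \<Rightarrow> complex set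
      \<Rightarrow> complex poly \<Rightarrow> complex poly \<Rightarrow> bool" where
  "pade_approximant E \<beta> f n m D P Q \<longleftrightarrow>
    (\<exists>p q. pade_pair E \<beta> f n m p q \<and> P * q = p * Q) \<and>
    Q \<noteq> 0 \<and> coprime P Q \<and> normalized_wrt D Q"

end

theory Submission
  imports Defs "HOL-Real_Asymp.Real_Asymp"
begin

text \<open>
  Let \<open>L\<close> be a cluster point of the zero counting measures and write \<open>pot \<nu> z\<close> for the integral of
  \<open>ln |z - t|\<close> with respect to \<open>\<nu>\<close>, that is, \<open>pot \<nu> = - U\<^sup>\<nu>\<close>. Dividing the error
  \<open>Q f Q\<^sub>n - Q P\<^sub>n\<close> by its zeros at the nodes gives functions \<open>G\<^sub>n\<close> holomorphic in \<open>D\<close>, and the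
  hypothesis says that \<open>|G\<^sub>n|\<close> behaves like \<open>exp (n (v - ln R))\<close> on \<open>D - E\<close>, where
  \<open>v = pot \<mu> - pot L\<close>. By the maximum modulus principle for \<open>G\<^sub>n\<close> the values of \<open>v\<close> near \<open>E\<close> do not
  exceed those at a fixed small distance from \<open>E\<close>. So \<open>v\<close>, which is harmonic outside \<open>E\<close> and vanishes
  at infinity, attains its maximum over the exterior of \<open>E\<close> and hence is zero there.

  It remains to see that a measure on the boundary of \<open>E\<close> is determined by its potential outside
  \<open>E\<close> (the dual form of the Walsh-Lebesgue theorem). Connectedness of the complement suffices for
  this. Near the boundary, \<open>ln |z - t|\<close> is approximated by averages of functions
  \<open>ln |z - \<zeta>|\<close> with \<open>\<zeta>\<close> outside \<open>E\<close>. The maximum principle then gives equality of the potentials in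
  the interior of \<open>E\<close>. Averaging over circles gives equality of the integrals of all radial functions
  about arbitrary centres, in particular of all Gaussians, and these span a dense algebra.

  Measures enter only as positive normalized linear functionals on continuous functions, which makes
  cluster points available from Tychonoff's theorem. Harmonicity is used in the form of discrete
  circle means over roots of unity, which are explicit for logarithms.
\<close>

subsection \<open>Positive normalized functionals\<close>

text \<open>The limit hypothesis speaks only about \<open>D - E\<close>, but there it is an equality
  for every compact set. On a single point it bounds the error from below, on small pieces of the
  set at distance \<open>d\<close> from \<open>E\<close> it bounds it from above, and the maximum
  modulus principle for a function holomorphic across \<open>E\<close> joins the two bounds. The
  potentials of \<mu> and of a cluster point may be infinite or discontinuous on the boundary of
  \<open>E\<close>, so their equality outside cannot be passed inwards by continuity. The
  approximations of ln |z - t| by logarithms with poles outside \<open>E\<close> are off by a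
  constant amount when z is near t, so no uniform smallness can be used either. Their error has the
  form 20 sqrt (\<delta> / |z - t|), and this is below \<epsilon> (1 + ln (C / |z - t|)) for small
  \<delta>. Integrated in z, the latter is \<epsilon> times a positive harmonic function of t, to
  which a maximum principle applies. The mean of ln |z - t| over the circle of radius r about a is
  ln max (|z - a|, r). Differences of these functions for two radii are the radial ramps from which
  all radial functions are built.\<close>

definition pos_mean :: "'a::topological_space set \<Rightarrow> (('a \<Rightarrow> real) \<Rightarrow> real) \<Rightarrow> bool" where
  "pos_mean S I \<longleftrightarrow>
    (\<forall>f g. continuous_on S f \<longrightarrow> continuous_on S g \<longrightarrow> I (\<lambda>x. f x + g x) = I f + I g) \<and>
    (\<forall>c f. continuous_on S f \<longrightarrow> I (\<lambda>x. c * f x) = c * I f) \<and>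
    (\<forall>f g. continuous_on S f \<longrightarrow> continuous_on S g \<longrightarrow> (\<forall>x\<in>S. f x \<le> g x) \<longrightarrow> I f \<le> I g) \<and>
    I (\<lambda>_. 1) = 1"

lemma pos_mean_add:
  "\<lbrakk>pos_mean S I; continuous_on S f; continuous_on S g\<rbrakk> \<Longrightarrow> I (\<lambda>x. f x + g x) = I f + I g"
  unfolding pos_mean_def by blast

lemma pos_mean_cmult:
  "\<lbrakk>pos_mean S I; continuous_on S f\<rbrakk> \<Longrightarrow> I (\<lambda>x. c * f x) = c * I f"
  unfolding pos_mean_def by blast

lemma pos_mean_mono:
  "\<lbrakk>pos_mean S I; continuous_on S f; continuous_on S g; \<And>x. x \<in> S \<Longrightarrow> f x \<le> g x\<rbrakk> \<Longrightarrow> I f \<le> I g"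
  unfolding pos_mean_def by blast

lemma pos_mean_const: "pos_mean S I \<Longrightarrow> I (\<lambda>_. c) = c"
  using pos_mean_cmult[of S I "\<lambda>_. 1" c] unfolding pos_mean_def by auto

lemma pos_mean_diff:
  assumes "pos_mean S I" "continuous_on S f" "continuous_on S g"
  shows "I (\<lambda>x. f x - g x) = I f - I g"
  using pos_mean_add[OF assms(1,2), of "\<lambda>x. - 1 * g x"] pos_mean_cmult[OF assms(1,3), of "-1"] assms
  by (auto intro!: continuous_intros)

lemma pos_mean_sum:
  assumes "pos_mean S I" "\<And>k. k \<in> A \<Longrightarrow> continuous_on S (f k)"
  shows "I (\<lambda>x. \<Sum>k\<in>A. f k x) = (\<Sum>k\<in>A. I (f k))"
  using assms(2)
proof (induction A rule: infinite_finite_induct)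
  case (insert k A)
  then show ?case
    by (simp add: pos_mean_add[OF assms(1)] continuous_intros)
qed (use pos_mean_const[OF assms(1), of 0] in auto)

lemma pos_mean_dist:
  assumes "pos_mean S I" "continuous_on S f" "continuous_on S g" "continuous_on S h"
    and "\<And>x. x \<in> S \<Longrightarrow> \<bar>f x - g x\<bar> \<le> h x"
  shows "\<bar>I f - I g\<bar> \<le> I h"
proof -
  have "I (\<lambda>x. f x - g x) \<le> I h"
    using assms by (intro pos_mean_mono[of S I]) (auto intro!: continuous_intros simp: abs_le_iff)
  moreover have "I (\<lambda>x. g x - f x) \<le> I h"
    using assms by (intro pos_mean_mono[of S I])
      (auto intro!: continuous_intros simp: abs_le_iff algebra_simps)
  ultimately show ?thesis
    using pos_mean_diff[OF assms(1,2,3)] pos_mean_diff[OF assms(1,3,2)] by linarith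
qed

lemma pos_mean_dist_const:
  assumes "pos_mean S I" "continuous_on S f" "continuous_on S g" "\<And>x. x \<in> S \<Longrightarrow> \<bar>f x - g x\<bar> \<le> c"
  shows "\<bar>I f - I g\<bar> \<le> c"
  using pos_mean_dist[OF assms(1-3), of "\<lambda>_. c"] assms(4) pos_mean_const[OF assms(1)] by auto

text \<open>Functionals take functions on the whole type as arguments. Monotonicity on
  \<open>S\<close> in both directions makes them blind to values off \<open>S\<close>.\<close>

lemma pos_mean_cong:
  assumes "pos_mean S I" "continuous_on S f" "\<And>x. x \<in> S \<Longrightarrow> f x = g x"
  shows "I f = I g"
proof -
  have "continuous_on S g"
    using assms continuous_on_cong by force
  then show ?thesis
    using pos_mean_dist_const[OF assms(1,2), of g 0] assms(3) by auto
qed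

text \<open>By Tychonoff's theorem the functionals have a cluster point in the pointwise topology.\<close>

lemma pos_mean_tendsto_if_cluster_unique:
  fixes I :: "'i \<Rightarrow> ('a::topological_space \<Rightarrow> real) \<Rightarrow> real"
  assumes S: "compact S" and I: "\<And>i. pos_mean S (I i)" and \<phi>: "continuous_on S \<phi>"
    and uniq: "\<And>G L. \<lbrakk>G \<le> FF; G \<noteq> bot; pos_mean S L;
        \<And>f. continuous_on S f \<Longrightarrow> ((\<lambda>i. I i f) \<longlongrightarrow> L f) G\<rbrakk> \<Longrightarrow> L \<phi> = c"
  shows "((\<lambda>i. I i \<phi>) \<longlongrightarrow> c) FF"
proof (rule ccontr)
  assume "\<not> ?thesis"
  then obtain e where e: "e > 0" "\<not> eventually (\<lambda>i. dist (I i \<phi>) c < e) FF"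
    unfolding tendsto_iff by blast
  \<comment> \<open>Suppose convergence fails: \<open>H\<close> retains the indices with values at
    least \<open>e\<close> away from \<open>c\<close>. A limit along any finer filter then
    contradicts \<open>uniq\<close>.\<close>
  define H where "H = inf FF (principal {i. \<not> dist (I i \<phi>) c < e})"
  have Hbot: "H \<noteq> bot"
    using e(2) unfolding H_def trivial_limit_def eventually_inf_principal by (auto elim: eventually_mono)
  \<comment> \<open>With a bound \<open>b f\<close> for each continuous \<open>f\<close> and the
    value 0 for every other \<open>f\<close>, all \<open>J i\<close> are points of one compact
    product of intervals.\<close>
  define b where "b f = (if continuous_on S f then SOME B. \<forall>x\<in>S. \<bar>f x\<bar> \<le> B else 0)" for f :: "'a \<Rightarrow> real"
  have b: "\<bar>f x\<bar> \<le> b f" if "continuous_on S f" "x \<in> S" for f x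
  proof -
    have "bounded (f ` S)"
      using that S by (intro compact_imp_bounded compact_continuous_image)
    then have "\<exists>B. \<forall>x\<in>S. \<bar>f x\<bar> \<le> B"
      by (auto simp: bounded_iff)
    from someI_ex[OF this] that show ?thesis
      by (auto simp: b_def)
  qed
  define J where "J i = (\<lambda>f. if continuous_on S f then I i f else 0)" for i
  have JI: "\<bar>J i f\<bar> \<le> b f" for i f
    using pos_mean_dist_const[OF I, of f "\<lambda>_. 0" "b f" i] b[of f] pos_mean_const[OF I, of i 0]
    by (auto simp: J_def) (auto simp: b_def)
  have "compactin (product_topology (\<lambda>_. euclidean) UNIV) (\<Pi>\<^sub>E f\<in>UNIV. {- b f..b f})"
    by (subst compactin_PiE) auto
  then have "compact (\<Pi>\<^sub>E f\<in>UNIV. {- b f..b f})"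
    by (simp add: euclidean_product_topology)
  moreover have "filtermap J H \<noteq> bot"
    using Hbot by (simp add: filtermap_bot_iff)
  moreover have "eventually (\<lambda>x. x \<in> (\<Pi>\<^sub>E f\<in>UNIV. {- b f..b f})) (filtermap J H)"
    using JI by (auto simp: eventually_filtermap PiE_def abs_le_iff intro!: always_eventually)
      (metis minus_le_iff)
  ultimately obtain L where L: "inf (nhds L) (filtermap J H) \<noteq> bot"
    unfolding compact_filter by blast
  \<comment> \<open>A cluster point of the image filter becomes a limit once the filter is refined
    by the preimages of its neighbourhoods.\<close>
  define G where "G = inf H (filtercomap J (nhds L))"
  have "G \<noteq> bot"
  proof
    assume "G = bot"
    then obtain P Q where PQ: "eventually P H" "eventually Q (nhds L)" "\<And>i. P i \<Longrightarrow> Q (J i) \<Longrightarrow> False"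
      unfolding G_def trivial_limit_def eventually_inf eventually_filtercomap by blast
    have "eventually (\<lambda>y. \<not> Q y) (filtermap J H)"
      unfolding eventually_filtermap using PQ(1) by (rule eventually_mono) (use PQ(3) in auto)
    with PQ(2) have "eventually (\<lambda>_. False) (inf (nhds L) (filtermap J H))"
      unfolding eventually_inf by blast
    with L show False
      by (simp add: trivial_limit_def)
  qed
  have "G \<le> H" by (simp add: G_def)
  have "G \<le> FF" by (simp add: G_def H_def le_infI1)
  have "filterlim J (nhds L) G"
    unfolding filterlim_def G_def filtermap_le_iff_le_filtercomap by simp
  then have lim: "((\<lambda>i. J i f) \<longlongrightarrow> L f) G" for f
  proof -
    have "continuous_on UNIV (\<lambda>x::('a \<Rightarrow> real) \<Rightarrow> real. x f)"
      by (rule continuous_on_product_coordinates)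
    then show ?thesis
      using \<open>filterlim J (nhds L) G\<close> by (rule continuous_on_tendsto_compose) auto
  qed
  have limI: "((\<lambda>i. I i f) \<longlongrightarrow> L f) G" if "continuous_on S f" for f
    using lim[of f] that by (simp add: J_def)
  have "pos_mean S L"
    unfolding pos_mean_def
  proof (intro conjI allI impI)
    fix f g :: "'a \<Rightarrow> real" assume fg: "continuous_on S f" "continuous_on S g"
    have "((\<lambda>i. I i (\<lambda>x. f x + g x)) \<longlongrightarrow> L (\<lambda>x. f x + g x)) G"
      using fg by (intro limI continuous_intros)
    moreover have "((\<lambda>i. I i (\<lambda>x. f x + g x)) \<longlongrightarrow> L f + L g) G"
      using tendsto_add[OF limI[OF fg(1)] limI[OF fg(2)]] pos_mean_add[OF I fg] by simp
    ultimately show "L (\<lambda>x. f x + g x) = L f + L g"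
      using \<open>G \<noteq> bot\<close> tendsto_unique by blast
  next
    fix c and f :: "'a \<Rightarrow> real" assume f: "continuous_on S f"
    have "((\<lambda>i. I i (\<lambda>x. c * f x)) \<longlongrightarrow> L (\<lambda>x. c * f x)) G"
      using f by (intro limI continuous_intros)
    moreover have "((\<lambda>i. I i (\<lambda>x. c * f x)) \<longlongrightarrow> c * L f) G"
      using tendsto_mult_left[OF limI[OF f], of c] pos_mean_cmult[OF I f] by simp
    ultimately show "L (\<lambda>x. c * f x) = c * L f"
      using \<open>G \<noteq> bot\<close> tendsto_unique by blast
  next
    fix f g :: "'a \<Rightarrow> real" assume fg: "continuous_on S f" "continuous_on S g" "\<forall>x\<in>S. f x \<le> g x"
    then show "L f \<le> L g"
      using pos_mean_mono[OF I fg(1,2)] by (intro tendsto_le[OF \<open>G \<noteq> bot\<close> limI limI]) auto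
  next
    have "((\<lambda>i. I i (\<lambda>_. 1)) \<longlongrightarrow> L (\<lambda>_. 1)) G"
      by (intro limI) auto
    then show "L (\<lambda>_. 1) = 1"
      using pos_mean_const[OF I] \<open>G \<noteq> bot\<close> by (simp add: tendsto_const_iff)
  qed
  then have "L \<phi> = c"
    using uniq \<open>G \<le> FF\<close> \<open>G \<noteq> bot\<close> limI by blast
  then have "eventually (\<lambda>i. dist (I i \<phi>) c < e) G"
    using limI[OF \<phi>] e(1) by (auto simp: tendsto_iff)
  moreover have "eventually (\<lambda>i. \<not> dist (I i \<phi>) c < e) G"
    by (rule filter_leD[OF \<open>G \<le> H\<close>]) (auto simp: H_def eventually_inf_principal)
  ultimately have "eventually (\<lambda>_. False) G"
    by eventually_elim auto
  with \<open>G \<noteq> bot\<close> show False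
    by (simp add: trivial_limit_def)
qed

subsection \<open>Potentials and maximum principles\<close>

lemma prod_roots_of_unity:
  fixes w c :: complex
  assumes "N > 0"
  shows "(\<Prod>k<N. w - c * cis (2 * pi * real k / real N)) = w ^ N - c ^ N"
proof (cases "c = 0")
  case True
  then show ?thesis using assms by (simp add: zero_power)
next
  case False
  have 1: "(\<Prod>k<N. x - cis (2 * pi * real k / real N)) = x ^ N - 1" for x
  proof -
    let ?p = "monom 1 N - 1 :: complex poly" and ?r = "\<lambda>k. cis (2 * pi * real k / real N)"
    have inj: "inj_on ?r {..<N}"
      using Complex.bij_betw_roots_unity[OF assms] unfolding bij_betw_def by simp
    have img: "?r ` {..<N} = {z. z ^ N = 1}"
      using Complex.bij_betw_roots_unity[OF assms] unfolding bij_betw_def by simp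
    let ?q = "\<Prod>k<N. [:- ?r k, 1:]"
    have dq: "degree ?q = N"
      by (simp add: degree_prod_sum_eq)
    have lq: "lead_coeff ?q = 1"
      by (simp only: lead_coeff_prod) simp
    have dp: "coeff ?p N = 1" "degree ?p \<le> N"
      using assms by (auto simp: coeff_eq_0 intro!: degree_diff_le degree_monom_le)
    \<comment> \<open>Both polynomials are monic of degree \<open>N\<close>, so a nonzero difference
      would have degree below \<open>N\<close>, yet it vanishes at \<open>N\<close> distinct roots
      of unity.\<close>
    have "?p - ?q = 0"
    proof (rule ccontr)
      assume ne: "?p - ?q \<noteq> 0"
      have "degree (?p - ?q) \<le> N"
        using degree_diff_le[OF dp(2), of ?q] dq by simp
      moreover have "coeff (?p - ?q) N = 0"
        using dp dq lq by simp
      ultimately have "degree (?p - ?q) < N"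
        using ne by (metis le_neq_implies_less leading_coeff_0_iff)
      moreover have "?r ` {..<N} \<subseteq> {x. poly (?p - ?q) x = 0}"
      proof (rule image_subsetI)
        fix k assume k: "k \<in> {..<N}"
        then have "?r k ^ N = 1" using img by blast
        moreover have "poly ?q (?r k) = 0"
          using k by (auto simp: poly_prod)
        ultimately show "?r k \<in> {x. poly (?p - ?q) x = 0}"
          by (simp add: poly_monom)
      qed
      then have "card (?r ` {..<N}) \<le> degree (?p - ?q)"
        using card_mono[OF poly_roots_finite[OF ne]] card_poly_roots_bound[OF ne] by (meson le_trans)
      ultimately show False
        using card_image[OF inj] by simp
    qed
    then have "poly ?p x = poly ?q x" by simp
    then show ?thesis by (simp add: poly_prod poly_monom)
  qed
  have "(\<Prod>k<N. w - c * cis (2 * pi * real k / real N)) =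
        (\<Prod>k<N. c * (w / c - cis (2 * pi * real k / real N)))"
    using False by (intro prod.cong) (auto simp: field_simps)
  also have "\<dots> = c ^ N * ((w / c) ^ N - 1)"
    by (simp add: prod.distrib 1)
  also have "\<dots> = w ^ N - c ^ N"
    using False by (simp add: field_simps)
  finally show ?thesis .
qed

text \<open>The hypothesis keeps \<open>w\<close> away from the circle of radius \<open>|c|\<close>, so no factor of the
  product vanishes.\<close>

lemma mean_ln_circle:
  fixes w c :: complex
  assumes N: "N > 0" and q: "min (cmod w) (cmod c) \<le> q * max (cmod w) (cmod c)" "q < 1" "0 \<le> q"
    and pos: "max (cmod w) (cmod c) > 0"
  shows "\<bar>(\<Sum>k<N. ln (cmod (w - c * cis (2 * pi * real k / real N)))) / N
           - ln (max (cmod w) (cmod c))\<bar> \<le> 1 / ((1 - q) * N)"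
proof -
  define M where "M = max (cmod w) (cmod c)"
  \<comment> \<open>The mean is ln |w^N - c^N| / N, and with the ratio \<open>x\<close> of the two
    radii the modulus lies between M^N (1 - x^N) and M^N (1 + x^N). The logarithms of both brackets
    are bounded in terms of \<open>q\<close>, so division by \<open>N\<close> makes them
    small.\<close>
  define x where "x = min (cmod w) (cmod c) / M"
  have M: "M > 0" using pos by (simp add: M_def)
  have x: "0 \<le> x" "x \<le> q"
    using q(1) M unfolding x_def M_def[symmetric] by (auto simp: field_simps)
  have x1: "x < 1" using x q by simp
  have xN: "0 \<le> x ^ N" "x ^ N \<le> q"
    using x x1 q power_decreasing[of 1 N x] N by (auto simp: le_trans)
  have ne: "cmod w \<noteq> cmod c"
    using x1 M unfolding x_def M_def by (auto simp: field_simps)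
  have nz: "w - c * cis (2 * pi * real k / real N) \<noteq> 0" for k
    using ne by (metis eq_iff_diff_eq_0 mult.right_neutral norm_cis norm_mult)
  have "(\<Sum>k<N. ln (cmod (w - c * cis (2 * pi * real k / real N)))) =
        ln (\<Prod>k<N. cmod (w - c * cis (2 * pi * real k / real N)))"
    using nz by (subst ln_prod) auto
  also have "\<dots> = ln (cmod (w ^ N - c ^ N))"
    by (simp add: prod_norm prod_roots_of_unity[OF N])
  finally have sum: "(\<Sum>k<N. ln (cmod (w - c * cis (2 * pi * real k / real N)))) = ln (cmod (w ^ N - c ^ N))" .
  have minM: "min (cmod w) (cmod c) ^ N = M ^ N * x ^ N"
    using M by (simp add: x_def power_divide)
  have up: "cmod (w ^ N - c ^ N) \<le> M ^ N * (1 + x ^ N)"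
  proof -
    have "cmod (w ^ N - c ^ N) \<le> cmod w ^ N + cmod c ^ N"
      by (metis norm_power norm_triangle_ineq4)
    also have "\<dots> = M ^ N + min (cmod w) (cmod c) ^ N"
      by (auto simp: M_def max_def min_def)
    finally show ?thesis using minM by (simp add: algebra_simps)
  qed
  have lo: "cmod (w ^ N - c ^ N) \<ge> M ^ N * (1 - x ^ N)"
  proof -
    have "cmod (w ^ N - c ^ N) \<ge> \<bar>cmod w ^ N - cmod c ^ N\<bar>"
      by (metis norm_power norm_triangle_ineq3)
    moreover have "\<bar>cmod w ^ N - cmod c ^ N\<bar> \<ge> M ^ N - min (cmod w) (cmod c) ^ N"
      by (auto simp: M_def max_def min_def)
    ultimately show ?thesis using minM by (simp add: algebra_simps)
  qed
  have lo0: "M ^ N * (1 - x ^ N) > 0" using M xN q by simp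
  then have p0: "cmod (w ^ N - c ^ N) > 0" using lo by linarith
  have lnM: "ln (M ^ N) = N * ln M" using M by (simp add: ln_realpow)
  have "ln (cmod (w ^ N - c ^ N)) \<le> ln (M ^ N * (1 + x ^ N))"
    using up p0 by (intro ln_mono) auto
  also have "\<dots> = N * ln M + ln (1 + x ^ N)"
    using M xN lnM by (subst ln_mult) auto
  also have "ln (1 + x ^ N) \<le> x ^ N"
    using xN by (intro ln_add_one_self_le_self) auto
  finally have 1: "ln (cmod (w ^ N - c ^ N)) \<le> N * ln M + x ^ N" by simp
  have "ln (cmod (w ^ N - c ^ N)) \<ge> ln (M ^ N * (1 - x ^ N))"
    using lo lo0 p0 by (subst ln_le_cancel_iff) auto
  also have "ln (M ^ N * (1 - x ^ N)) = N * ln M + ln (1 - x ^ N)"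
    using M xN q lnM by (subst ln_mult) auto
  finally have 2: "ln (cmod (w ^ N - c ^ N)) \<ge> N * ln M + ln (1 - x ^ N)" .
  have "- ln (1 - x ^ N) = ln (1 / (1 - x ^ N))"
    using xN q by (simp add: ln_div)
  also have "\<dots> \<le> 1 / (1 - x ^ N) - 1"
    using xN q by (intro ln_le_minus_one) auto
  also have "\<dots> \<le> 1 / (1 - q) - 1"
    using xN q by (simp add: frac_le)
  finally have 3: "- ln (1 - x ^ N) \<le> 1 / (1 - q)" by simp
  have "1 \<le> 1 / (1 - q)" using q by simp
  then have 4: "x ^ N \<le> 1 / (1 - q)" using xN q by linarith
  have "\<bar>ln (cmod (w ^ N - c ^ N)) - N * ln M\<bar> \<le> 1 / (1 - q)"
    using 1 2 3 4 by linarith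
  then have "\<bar>ln (cmod (w ^ N - c ^ N)) - N * ln M\<bar> / N \<le> 1 / (1 - q) / N"
    by (rule divide_right_mono) simp
  moreover have "\<bar>ln (cmod (w ^ N - c ^ N)) - N * ln M\<bar> / N = \<bar>ln (cmod (w ^ N - c ^ N)) / N - ln M\<bar>"
  proof -
    have "ln (cmod (w ^ N - c ^ N)) / N - ln M = (ln (cmod (w ^ N - c ^ N)) - N * ln M) / N"
      using N by (simp add: field_simps)
    then show ?thesis by simp
  qed
  ultimately show ?thesis
    unfolding sum M_def[symmetric] by simp
qed

text \<open>On the empty set 1 \<le> 0 holds vacuously, which monotonicity and normalization
  exclude.\<close>

lemma pos_mean_nonempty: "pos_mean S I \<Longrightarrow> S \<noteq> {}"
  using pos_mean_mono[of S I "\<lambda>_. 1" "\<lambda>_. 0"] pos_mean_const[of S I] by force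

text \<open>Evaluated only at points off the set that carries \<open>I\<close>. There the kernel is
  continuous on that set; on the set itself the convention ln 0 = 0 would make the value
  meaningless.\<close>

definition pot :: "((complex \<Rightarrow> real) \<Rightarrow> real) \<Rightarrow> complex \<Rightarrow> real" where
  "pot I z = I (\<lambda>t. ln (cmod (z - t)))"

lemma continuous_on_ln_dist:
  "z \<notin> S \<Longrightarrow> continuous_on S (\<lambda>t. ln (cmod (z - t)))"
  by (auto intro!: continuous_intros)

lemma abs_ln_diff_le:
  fixes x y d :: real
  assumes "d > 0" "d \<le> x" "d \<le> y"
  shows "\<bar>ln x - ln y\<bar> \<le> \<bar>x - y\<bar> / d"
proof -
  have *: "ln u - ln v \<le> (u - v) / d" if "u \<ge> v" "v \<ge> d" for u v
  proof -
    have "ln u - ln v = ln (u / v)"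
      using that assms by (simp add: ln_div)
    also have "\<dots> \<le> u / v - 1"
      using that assms by (intro ln_le_minus_one) auto
    also have "\<dots> = (u - v) / v"
      using that assms by (simp add: field_simps)
    also have "\<dots> \<le> (u - v) / d"
      using that assms by (intro divide_left_mono) auto
    finally show ?thesis .
  qed
  show ?thesis
    using *[of x y] *[of y x] assms by (cases "x \<ge> y") (auto simp: abs_real_def)
qed

text \<open>The constant depends on the distance to \<open>S\<close> but not on \<open>I\<close>, so
  it serves a whole sequence of measures at once.\<close>

lemma pot_lipschitz:
  assumes "pos_mean S I" "d > 0" "\<And>t. t \<in> S \<Longrightarrow> d \<le> cmod (z - t)" "\<And>t. t \<in> S \<Longrightarrow> d \<le> cmod (z' - t)"
  shows "\<bar>pot I z - pot I z'\<bar> \<le> cmod (z - z') / d"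
  unfolding pot_def
proof (rule pos_mean_dist_const[OF assms(1)])
  have "z \<notin> S" "z' \<notin> S"
    using assms by fastforce+
  then show "continuous_on S (\<lambda>t. ln (cmod (z - t)))" "continuous_on S (\<lambda>t. ln (cmod (z' - t)))"
    by (auto intro: continuous_on_ln_dist)
next
  fix t assume "t \<in> S"
  then have "\<bar>ln (cmod (z - t)) - ln (cmod (z' - t))\<bar> \<le> \<bar>cmod (z - t) - cmod (z' - t)\<bar> / d"
    using assms by (intro abs_ln_diff_le) auto
  also have "\<dots> \<le> cmod (z - z') / d"
    using assms(2) norm_triangle_ineq3[of "z - t" "z' - t"] by (intro divide_right_mono) auto
  finally show "\<bar>ln (cmod (z - t)) - ln (cmod (z' - t))\<bar> \<le> cmod (z - z') / d" .
qed

lemma dist_closed_pos: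
  assumes "closed S" "z \<notin> S"
  obtains d where "d > 0" "\<And>t. t \<in> S \<Longrightarrow> d \<le> cmod (z - t)"
  using assms separate_point_closed[OF assms] by (auto simp: dist_norm)

lemma continuous_on_pot:
  assumes "compact S" "pos_mean S I"
  shows "continuous_on (- S) (pot I)"
  unfolding continuous_on_iff
proof safe
  fix z and e :: real assume "z \<notin> S" "e > 0"
  then obtain d where d: "d > 0" "\<And>t. t \<in> S \<Longrightarrow> d \<le> cmod (z - t)"
    using dist_closed_pos assms compact_imp_closed by metis
  show "\<exists>d>0. \<forall>z'\<in>- S. dist z' z < d \<longrightarrow> dist (pot I z') (pot I z) < e"
  proof (intro exI[of _ "min (d / 2) (e * d / 4)"] conjI ballI impI)
    fix z' assume "dist z' z < min (d / 2) (e * d / 4)"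
    then have z': "cmod (z - z') < d / 2" "cmod (z - z') < e * d / 4"
      by (auto simp: dist_norm norm_minus_commute)
    have "d / 2 \<le> cmod (z' - t)" if "t \<in> S" for t
      using d(2)[OF that] z'(1) norm_triangle_ineq[of "z - z'" "z' - t"] by simp
    moreover have "d / 2 \<le> cmod (z - t)" if "t \<in> S" for t
      using d(2)[OF that] d(1) by linarith
    ultimately have "\<bar>pot I z - pot I z'\<bar> \<le> cmod (z - z') / (d / 2)"
      using d(1) by (intro pot_lipschitz[OF assms(2)]) auto
    also have "\<dots> \<le> (e * d / 4) / (d / 2)"
      using z' d(1) by (intro divide_right_mono) auto
    also have "\<dots> < e"
      using d(1) \<open>e > 0\<close> by simp
    finally show "dist (pot I z') (pot I z) < e"
      by (simp add: dist_real_def abs_minus_commute)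
  qed (use d \<open>e > 0\<close> in auto)
qed

text \<open>\<open>c\<close> is complex: its modulus is the radius and its argument fixes the first
  sample point, which the strong maximum principle places at a prescribed point of the
  circle.\<close>

definition circle_mean :: "(complex \<Rightarrow> real) \<Rightarrow> complex \<Rightarrow> complex \<Rightarrow> nat \<Rightarrow> real" where
  "circle_mean h z c N = (\<Sum>k<N. h (z + c * cis (2 * pi * real k / real N))) / N"

lemma circle_mean_le:
  assumes "N > 0" "\<And>w. cmod (w - z) = cmod c \<Longrightarrow> h w \<le> B"
  shows "circle_mean h z c N \<le> B"
proof -
  have "(\<Sum>k<N. h (z + c * cis (2 * pi * real k / real N))) \<le> (\<Sum>k<N. B)"
    using assms(2) by (intro sum_mono) (auto simp: norm_mult)
  then show ?thesis
    using assms(1) by (simp add: circle_mean_def divide_le_eq mult.commute)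
qed

lemma circle_mean_add: "circle_mean (\<lambda>w. f w + g w) z c N = circle_mean f z c N + circle_mean g z c N"
  by (simp add: circle_mean_def sum.distrib add_divide_distrib)

lemma circle_mean_diff: "circle_mean (\<lambda>w. f w - g w) z c N = circle_mean f z c N - circle_mean g z c N"
  by (simp add: circle_mean_def sum_subtractf diff_divide_distrib)

lemma circle_mean_cmult: "circle_mean (\<lambda>w. a * f w) z c N = a * circle_mean f z c N"
  by (simp add: circle_mean_def sum_distrib_left)

lemma circle_mean_const: "N > 0 \<Longrightarrow> circle_mean (\<lambda>w. a) z c N = a"
  by (simp add: circle_mean_def)

text \<open>The functional commutes with finite sums, so the estimate of
  \<open>mean_ln_circle\<close> can be integrated over t. The ratio \<open>q\<close> is uniform in
  t, hence so is the rate.\<close>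

lemma circle_mean_pot:
  assumes S: "compact S" and I: "pos_mean S I"
    and q: "0 \<le> q" "q < 1" "\<And>t. t \<in> S \<Longrightarrow> min (cmod (z - t)) (cmod c) \<le> q * max (cmod (z - t)) (cmod c)"
      "\<And>t. t \<in> S \<Longrightarrow> max (cmod (z - t)) (cmod c) > 0"
    and N: "N > 0"
  shows "\<bar>circle_mean (pot I) z c N - I (\<lambda>t. ln (max (cmod (z - t)) (cmod c)))\<bar> \<le> 1 / ((1 - q) * N)"
proof -
  have nS: "z + c * cis x \<notin> S" for x
  proof
    assume *: "z + c * cis x \<in> S"
    have "cmod (z - (z + c * cis x)) = cmod c"
      by (simp add: norm_mult)
    then have "cmod c \<le> q * cmod c" "cmod c > 0"
      using q(3,4)[OF *] by simp_all
    then show False using q(2) by (metis mult_less_cancel_right2 not_le)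
  qed
  let ?g = "\<lambda>t. (\<Sum>k<N. ln (cmod (z - t - (- c) * cis (2 * pi * real k / real N)))) / N"
  have cont: "continuous_on S (\<lambda>t. ln (cmod (z - t - (- c) * cis x)))" for x
    using continuous_on_ln_dist[OF nS[of x]] by (simp add: algebra_simps)
  have "circle_mean (pot I) z c N = (\<Sum>k<N. I (\<lambda>t. ln (cmod (z - t - (- c) * cis (2 * pi * real k / real N))))) / N"
    unfolding circle_mean_def pot_def by (simp add: algebra_simps)
  also have "\<dots> = I (\<lambda>t. 1 / N * (\<Sum>k<N. ln (cmod (z - t - (- c) * cis (2 * pi * real k / real N)))))"
  proof -
    have "I (\<lambda>t. 1 / N * (\<Sum>k<N. ln (cmod (z - t - (- c) * cis (2 * pi * real k / real N))))) =
        1 / N * I (\<lambda>t. \<Sum>k<N. ln (cmod (z - t - (- c) * cis (2 * pi * real k / real N))))"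
      by (rule pos_mean_cmult[OF I]) (intro continuous_on_sum cont)
    also have "\<dots> = 1 / N * (\<Sum>k<N. I (\<lambda>t. ln (cmod (z - t - (- c) * cis (2 * pi * real k / real N)))))"
      by (subst pos_mean_sum[OF I cont]) simp
    finally show ?thesis by simp
  qed
  also have "\<dots> = I ?g" by simp
  finally have eq: "circle_mean (pot I) z c N = I ?g" .
  show ?thesis
    unfolding eq
  proof (rule pos_mean_dist_const[OF I])
    show "continuous_on S ?g"
      using N by (intro continuous_on_divide continuous_on_sum cont continuous_on_const) simp
    show "continuous_on S (\<lambda>t. ln (max (cmod (z - t)) (cmod c)))"
      using q(4) by (intro continuous_intros) force
    fix t assume "t \<in> S"
    then show "\<bar>?g t - ln (max (cmod (z - t)) (cmod c))\<bar> \<le> 1 / ((1 - q) * N)"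
      using mean_ln_circle[OF N, of "z - t" "- c" q] q by simp
  qed
qed

lemma tendsto_if_dist_le_inverse:
  fixes f :: "nat \<Rightarrow> real"
  assumes "\<And>N. N > 0 \<Longrightarrow> \<bar>f N - l\<bar> \<le> 1 / (b * N)"
  shows "f \<longlonglongrightarrow> l"
proof -
  have "(\<lambda>N. 1 / b * (1 / real N)) \<longlonglongrightarrow> 1 / b * 0"
    by (intro tendsto_intros lim_1_over_n)
  then have *: "(\<lambda>N. 1 / (b * N)) \<longlonglongrightarrow> 0" by simp
  have "(\<lambda>N. f N - l) \<longlonglongrightarrow> 0"
    using assms by (intro Lim_null_comparison[OF _ *] eventually_sequentiallyI[of 1]) auto
  then show ?thesis by (simp add: LIM_zero_iff)
qed

text \<open>This is the mean value property. When the closed disc misses \<open>S\<close>, the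
  maximum in \<open>circle_mean_pot\<close> is |z - t| for every t, and the point of
  \<open>S\<close> nearest to z yields one \<open>q\<close> for all t.\<close>

lemma circle_mean_pot_tendsto:
  assumes S: "compact S" and I: "pos_mean S I" and c: "\<And>t. t \<in> S \<Longrightarrow> cmod c < cmod (z - t)"
  shows "circle_mean (pot I) z c \<longlonglongrightarrow> pot I z"
proof -
  have "\<exists>t0\<in>S. \<forall>t\<in>S. cmod (z - t0) \<le> cmod (z - t)"
    by (intro continuous_attains_inf[OF S pos_mean_nonempty[OF I]] continuous_intros)
  then obtain t0 where t0: "t0 \<in> S" "\<And>t. t \<in> S \<Longrightarrow> cmod (z - t0) \<le> cmod (z - t)"
    by blast
  define q where "q = cmod c / cmod (z - t0)"
  have p0: "cmod (z - t0) > 0"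
    using c[OF t0(1)] norm_ge_zero[of c] by linarith
  have q: "0 \<le> q" "q < 1"
    using c[OF t0(1)] p0 by (auto simp: q_def)
  have eq: "max (cmod (z - t)) (cmod c) = cmod (z - t)" "min (cmod (z - t)) (cmod c) = cmod c" if "t \<in> S" for t
    using c[OF that] by auto
  have pt: "cmod (z - t) > 0" if "t \<in> S" for t
    using t0(2)[OF that] p0 by linarith
  have "cmod c \<le> q * cmod (z - t)" if "t \<in> S" for t
    using p0 mult_left_mono[OF t0(2)[OF that] norm_ge_zero[of c]]
    by (simp add: q_def pos_le_divide_eq)
  moreover have "I (\<lambda>t. ln (max (cmod (z - t)) (cmod c))) = pot I z"
    unfolding pot_def
  proof (rule pos_mean_cong[OF I])
    show "continuous_on S (\<lambda>t. ln (max (cmod (z - t)) (cmod c)))"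
      using pt by (intro continuous_intros) (auto simp: max_def)
  qed (simp add: eq)
  ultimately have "\<bar>circle_mean (pot I) z c N - pot I z\<bar> \<le> 1 / ((1 - q) * N)" if "N > 0" for N
    using circle_mean_pot[OF S I q, of z c N] that pt by (simp add: eq)
  then show ?thesis by (rule tendsto_if_dist_le_inverse)
qed

text \<open>On a circle that encloses \<open>S\<close> the maximum is |c|. The limit does not depend
  on \<open>I\<close>, so the difference of two potentials has mean zero over such a circle.\<close>

lemma circle_mean_pot_tendsto_outside:
  assumes S: "compact S" and I: "pos_mean S I" and c: "\<And>t. t \<in> S \<Longrightarrow> cmod (z - t) < cmod c"
  shows "circle_mean (pot I) z c \<longlonglongrightarrow> ln (cmod c)"
proof -
  have "\<exists>t0\<in>S. \<forall>t\<in>S. cmod (z - t) \<le> cmod (z - t0)"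
    by (intro continuous_attains_sup[OF S pos_mean_nonempty[OF I]] continuous_intros)
  then obtain t0 where t0: "t0 \<in> S" "\<And>t. t \<in> S \<Longrightarrow> cmod (z - t) \<le> cmod (z - t0)"
    by blast
  define q where "q = cmod (z - t0) / cmod c"
  have p0: "cmod c > 0"
    using c[OF t0(1)] norm_ge_zero[of "z - t0"] by linarith
  have q: "0 \<le> q" "q < 1"
    using c[OF t0(1)] p0 by (auto simp: q_def)
  have eq: "max (cmod (z - t)) (cmod c) = cmod c" "min (cmod (z - t)) (cmod c) = cmod (z - t)" if "t \<in> S" for t
    using c[OF that] by auto
  have "cmod (z - t) \<le> q * cmod c" if "t \<in> S" for t
    using t0(2)[OF that] p0 by (simp add: q_def)
  moreover have "I (\<lambda>t. ln (max (cmod (z - t)) (cmod c))) = ln (cmod c)"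
  proof -
    have "continuous_on S (\<lambda>t. ln (max (cmod (z - t)) (cmod c)))"
      using p0 by (intro continuous_intros) (auto simp: max_def)
    then show ?thesis
      using pos_mean_cong[OF I, of "\<lambda>t. ln (max (cmod (z - t)) (cmod c))" "\<lambda>_. ln (cmod c)"]
        pos_mean_const[OF I] eq by simp
  qed
  ultimately have "\<bar>circle_mean (pot I) z c N - ln (cmod c)\<bar> \<le> 1 / ((1 - q) * N)" if "N > 0" for N
    using circle_mean_pot[OF S I q, of z c N] that p0 by (simp add: eq)
  then show ?thesis by (rule tendsto_if_dist_le_inverse)
qed

text \<open>The mixed terms cancel because the roots of unity sum to 0. The surplus |c|^2 is the
  strict subharmonicity used in the next proof.\<close>

lemma circle_mean_norm_square:
  assumes "N > 1"
  shows "circle_mean (\<lambda>w. (cmod w)\<^sup>2) z c N = (cmod z)\<^sup>2 + (cmod c)\<^sup>2"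
proof -
  let ?r = "\<lambda>k. cis (2 * pi * real k / real N)"
  have "(\<Sum>k<N. ?r k) = \<Sum>{z. z ^ N = 1}"
    using assms by (intro sum.reindex_bij_betw Complex.bij_betw_roots_unity) auto
  then have r0: "(\<Sum>k<N. ?r k) = 0"
    using sum_roots_unity[OF assms] by simp
  have "(cmod (z + c * ?r k))\<^sup>2 = (cmod z)\<^sup>2 + (cmod c)\<^sup>2 + 2 * Re (cnj z * c * ?r k)" for k
    using dot_norm[of z "c * ?r k"] by (simp add: norm_mult inner_complex_def field_simps)
  then have "(\<Sum>k<N. (cmod (z + c * ?r k))\<^sup>2) =
      (\<Sum>k<N. (cmod z)\<^sup>2 + (cmod c)\<^sup>2) + 2 * Re (cnj z * c * (\<Sum>k<N. ?r k))"
    by (simp only: sum.distrib sum_distrib_left Re_sum)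
  then show ?thesis
    using assms by (simp add: circle_mean_def r0)
qed

section \<open>Maximum principles for functions with the circle mean property\<close>

lemma weak_maximum_principle:
  fixes h :: "complex \<Rightarrow> real"
  assumes K: "compact K" and h: "continuous_on K h"
    and mv: "\<And>z e. z \<in> interior K \<Longrightarrow> e > 0 \<Longrightarrow> \<exists>c. c \<noteq> 0 \<and> cmod c < e \<and> circle_mean h z c \<longlonglongrightarrow> h z"
    and bd: "\<And>z. z \<in> frontier K \<Longrightarrow> h z \<le> B" and z: "z \<in> K"
  shows "h z \<le> B"
proof (rule ccontr)
  assume "\<not> h z \<le> B"
  obtain b where b: "\<And>w. w \<in> K \<Longrightarrow> cmod w \<le> b"
    using compact_imp_bounded[OF K] by (auto simp: bounded_iff)
  \<comment> \<open>The perturbation \<epsilon> |w|^2 is too small to move the maximum of the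
    perturbed function to the frontier. At an interior maximum its circle means exceed its central
    value by \<epsilon> |c|^2, which contradicts the mean value property of \<open>h\<close> for
    even one radius.\<close>
  define \<epsilon> where "\<epsilon> = (h z - B) / (2 * (b\<^sup>2 + 1))"
  have \<epsilon>: "\<epsilon> > 0"
    using \<open>\<not> h z \<le> B\<close> unfolding \<epsilon>_def by (intro divide_pos_pos) (auto simp: add_nonneg_pos)
  have \<epsilon>b: "\<epsilon> * b\<^sup>2 < h z - B"
  proof -
    have "\<epsilon> * b\<^sup>2 \<le> \<epsilon> * (b\<^sup>2 + 1)" using \<epsilon> by simp
    also have "b\<^sup>2 + 1 \<noteq> 0" by (metis add_nonneg_pos less_irrefl zero_le_power2 zero_less_one)
    then have "\<epsilon> * (b\<^sup>2 + 1) = (h z - B) / 2"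
      unfolding \<epsilon>_def by (simp add: divide_simps)
    also have "\<dots> < h z - B" using \<open>\<not> h z \<le> B\<close> by simp
    finally show ?thesis .
  qed
  have "\<exists>p\<in>K. \<forall>w\<in>K. h w + \<epsilon> * (cmod w)\<^sup>2 \<le> h p + \<epsilon> * (cmod p)\<^sup>2"
    using z h by (intro continuous_attains_sup[OF K] continuous_intros) auto
  then obtain p where p: "p \<in> K" "\<And>w. w \<in> K \<Longrightarrow> h w + \<epsilon> * (cmod w)\<^sup>2 \<le> h p + \<epsilon> * (cmod p)\<^sup>2"
    by blast
  have "\<epsilon> * (cmod p)\<^sup>2 \<le> \<epsilon> * b\<^sup>2"
    using b[OF p(1)] \<epsilon> by (intro mult_left_mono power_mono) auto
  moreover have "0 \<le> \<epsilon> * (cmod z)\<^sup>2" using \<epsilon> by simp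
  ultimately have "h p > B"
    using p(2)[OF z] \<epsilon>b by linarith
  then have "p \<in> interior K"
    using bd[of p] p(1) compact_imp_closed[OF K] by (auto simp: frontier_def)
  then obtain e where e: "e > 0" "ball p e \<subseteq> K"
    using mem_interior by blast
  then obtain c where c: "c \<noteq> 0" "cmod c < e" "circle_mean h p c \<longlonglongrightarrow> h p"
    using mv[OF \<open>p \<in> interior K\<close>] by blast
  have "circle_mean h p c N \<le> h p - \<epsilon> * (cmod c)\<^sup>2" if "N > 1" for N
  proof -
    have "circle_mean (\<lambda>w. h w + \<epsilon> * (cmod w)\<^sup>2) p c N \<le> h p + \<epsilon> * (cmod p)\<^sup>2"
      using that p(2) e c(2) by (intro circle_mean_le) (auto simp: subset_iff dist_norm norm_minus_commute)
    then show ?thesis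
      using circle_mean_norm_square[OF that, of p c]
      by (simp add: circle_mean_add circle_mean_cmult algebra_simps)
  qed
  then have "h p \<le> h p - \<epsilon> * (cmod c)\<^sup>2"
    by (intro LIMSEQ_le_const2[OF c(3)] exI[of _ 2]) auto
  then show False
    using \<epsilon> c(1) by (simp add: mult_le_0_iff)
qed

lemma strong_maximum_principle:
  fixes h :: "complex \<Rightarrow> real"
  assumes \<Omega>: "open \<Omega>" "connected \<Omega>" and h: "continuous_on \<Omega> h"
    and mv: "\<And>z. z \<in> \<Omega> \<Longrightarrow> \<exists>e>0. \<forall>c. cmod c < e \<longrightarrow> circle_mean h z c \<longlonglongrightarrow> h z"
    and p: "p \<in> \<Omega>" "\<And>z. z \<in> \<Omega> \<Longrightarrow> h z \<le> h p" and z: "z \<in> \<Omega>"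
  shows "h z = h p"
proof -
  define A where "A = {w \<in> \<Omega>. h w = h p}"
  have "closedin (top_of_set \<Omega>) A"
    unfolding A_def by (rule continuous_closedin_preimage_constant[OF h])
  moreover have "open A"
    unfolding open_contains_ball
  proof
    fix a assume "a \<in> A"
    then have a: "a \<in> \<Omega>" "h a = h p" by (auto simp: A_def)
    obtain e1 where e1: "e1 > 0" "\<And>c. cmod c < e1 \<Longrightarrow> circle_mean h a c \<longlonglongrightarrow> h a"
      using mv[OF a(1)] by blast
    obtain e2 where e2: "e2 > 0" "ball a e2 \<subseteq> \<Omega>"
      using \<Omega>(1) a(1) open_contains_ball by blast
    have "w \<in> A" if w: "w \<in> ball a (min e1 e2)" for w
    proof (rule ccontr)
      assume "w \<notin> A"
      have w\<Omega>: "w \<in> \<Omega>" using w e2 by auto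
      define c where "c = w - a"
      have c: "cmod c < e1" "cmod c < e2" "w = a + c"
        using w by (auto simp: c_def dist_norm norm_minus_commute)
      define \<eta> where "\<eta> = (h p - h w) / 2"
      have \<eta>: "\<eta> > 0" using p(2)[OF w\<Omega>] \<open>w \<notin> A\<close> w\<Omega> by (auto simp: \<eta>_def A_def)
      obtain \<delta> where \<delta>: "\<delta> > 0" "\<And>v. v \<in> \<Omega> \<Longrightarrow> dist v w < \<delta> \<Longrightarrow> dist (h v) (h w) < \<eta>"
        using h w\<Omega> \<eta> unfolding continuous_on_iff by blast
      \<comment> \<open>The arc of angle 2 pi / q starting at \<open>w\<close> stays within \<delta>
        of \<open>w\<close>. Sampling with q M points puts the first M on this arc, so for every M
        the proportion 1 / q of the samples lies at least \<eta> below the maximum, and the mean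
        cannot tend to the maximum.\<close>
      obtain q :: nat where q: "q > 0" "cmod c * (2 * pi) / q < \<delta>"
      proof -
        obtain q :: nat where "cmod c * (2 * pi) / \<delta> < q"
          using reals_Archimedean2 by blast
        then have "cmod c * (2 * pi) / Suc q < \<delta>"
          using \<delta>(1) by (simp add: field_simps)
        then show ?thesis using that[of "Suc q"] by simp
      qed
      have bound: "circle_mean h a c (q * M) \<le> h p - \<eta> / q" if M: "M > 0" for M
      proof -
        let ?r = "\<lambda>k. a + c * cis (2 * pi * real k / real (q * M))"
        have in\<Omega>: "?r k \<in> \<Omega>" for k
          using c(2) e2(2) by (auto simp: subset_iff dist_norm norm_mult)
        have near: "h (?r k) \<le> h p - \<eta>" if "k < M" for k
        proof -
          let ?\<theta> = "2 * pi * real k / real (q * M)"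
          have "?\<theta> \<le> 2 * pi / q"
            using that M q(1) by (simp add: field_simps)
          moreover have "cmod (cis ?\<theta> - 1) \<le> \<bar>?\<theta>\<bar>"
          proof -
            have "cmod (cis ?\<theta> - 1) = 2 * \<bar>sin (?\<theta> / 2)\<bar>"
              using dist_exp_i_1[of ?\<theta>] by (simp only: cis_conv_exp)
            also have "\<dots> \<le> 2 * \<bar>?\<theta> / 2\<bar>"
              using abs_sin_x_le_abs_x[of "?\<theta> / 2"] by linarith
            finally show ?thesis by simp
          qed
          moreover have "0 \<le> ?\<theta>" by simp
          ultimately have "cmod (cis ?\<theta> - 1) \<le> 2 * pi / q" by linarith
          then have "cmod c * cmod (cis ?\<theta> - 1) \<le> cmod c * (2 * pi / q)"
            by (intro mult_left_mono) auto
          then have "dist (?r k) w < \<delta>"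
            using q(2) unfolding dist_norm c(3)
            by (simp add: norm_mult[symmetric] algebra_simps)
          then have "dist (h (?r k)) (h w) < \<eta>"
            using \<delta>(2) in\<Omega> by blast
          then have "h (?r k) - h w < \<eta>"
            unfolding dist_real_def abs_less_iff by blast
          then show ?thesis
            by (simp add: \<eta>_def field_simps)
        qed
        have "(\<Sum>k<q * M. h (?r k)) \<le> (\<Sum>k<q * M. h p - (if k < M then \<eta> else 0))"
          using near p(2)[OF in\<Omega>] by (intro sum_mono) auto
        also have "\<dots> = q * M * h p - (\<Sum>k<q * M. if k < M then \<eta> else 0)"
          by (simp add: sum_subtractf)
        also have "(\<Sum>k<q * M. if k < M then \<eta> else 0) = (\<Sum>k<M. \<eta>)"
          using q(1) by (intro sum.mono_neutral_cong_right) (auto intro: order.strict_trans2)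
        finally have "(\<Sum>k<q * M. h (?r k)) \<le> q * M * h p - M * \<eta>" by simp
        then have "circle_mean h a c (q * M) \<le> (q * M * h p - M * \<eta>) / (q * M)"
          unfolding circle_mean_def by (simp add: divide_right_mono)
        also have "\<dots> = h p - \<eta> / q"
          using M q(1) by (simp add: field_simps)
        finally show ?thesis .
      qed
      have "strict_mono (\<lambda>M. q * M)"
        using q(1) by (auto simp: strict_mono_def)
      then have "(\<lambda>M. circle_mean h a c (q * M)) \<longlonglongrightarrow> h a"
        using LIMSEQ_subseq_LIMSEQ[OF e1(2)[OF c(1)]] by (simp add: o_def)
      then have "h a \<le> h p - \<eta> / q"
        using bound by (intro LIMSEQ_le_const2[of _ _ "h p - \<eta> / q"] exI[of _ 1]) auto
      then show False
        using a(2) \<eta> q(1) by (simp add: field_simps)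
    qed
    then show "\<exists>e>0. ball a e \<subseteq> A"
      using e1(1) e2(1) by (intro exI[of _ "min e1 e2"]) auto
  qed
  then have "openin (top_of_set \<Omega>) A"
    by (intro open_subset) (auto simp: A_def)
  ultimately have "A = {} \<or> A = \<Omega>"
    using \<Omega>(2) connected_clopen by blast
  then show ?thesis
    using p z by (auto simp: A_def)
qed

text \<open>Seen from far away every unit mass looks like a point mass at 0, so the difference of
  two potentials tends to 0 at infinity.\<close>

lemma pot_minus_ln_norm_le:
  assumes I: "pos_mean S I" and b: "\<And>t. t \<in> S \<Longrightarrow> cmod t \<le> b" "0 \<le> b" and z: "b < cmod z"
  shows "\<bar>pot I z - ln (cmod z)\<bar> \<le> b / (cmod z - b)"
proof -
  have far: "cmod z - b \<le> cmod (z - t)" if "t \<in> S" for t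
    using b(1)[OF that] norm_triangle_ineq2[of z t] by linarith
  have "z \<notin> S" using b z by fastforce
  have "\<bar>I (\<lambda>t. ln (cmod (z - t))) - I (\<lambda>_. ln (cmod z))\<bar> \<le> b / (cmod z - b)"
  proof (rule pos_mean_dist_const[OF I])
    fix t assume t: "t \<in> S"
    have "\<bar>ln (cmod (z - t)) - ln (cmod z)\<bar> \<le> \<bar>cmod (z - t) - cmod z\<bar> / (cmod z - b)"
      using far[OF t] z b by (intro abs_ln_diff_le) auto
    also have "\<bar>cmod (z - t) - cmod z\<bar> \<le> b"
      using norm_triangle_ineq3[of "z - t" z] b(1)[OF t] by simp
    finally show "\<bar>ln (cmod (z - t)) - ln (cmod z)\<bar> \<le> b / (cmod z - b)"
      using z by (simp add: divide_right_mono)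
  qed (use continuous_on_ln_dist[OF \<open>z \<notin> S\<close>] in auto)
  then show ?thesis
    by (simp add: pot_def pos_mean_const[OF I])
qed

text \<open>The hypothesis makes the difference of the two potentials attain its maximum over the
  exterior of \<open>E\<close>, point at infinity included. Hence it is constant, and it vanishes at infinity.\<close>

lemma pot_eq_exterior:
  fixes E :: "complex set"
  assumes E: "compact E" "connected (- E)" "S \<subseteq> E" "compact S"
    and I: "pos_mean S I" and J: "pos_mean S J" and d: "d > 0"
    and inner: "\<And>z. z \<notin> E \<Longrightarrow> infdist z E \<le> d \<Longrightarrow>
      \<exists>k. k \<notin> E \<and> infdist k E = d \<and> pot J z - pot I z \<le> pot J k - pot I k"
    and z: "z \<notin> E"
  shows "pot I z = pot J z"
proof -
  define v where "v w = pot J w - pot I w" for w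
  obtain b0 where b0: "\<And>w. w \<in> E \<Longrightarrow> cmod w \<le> b0"
    using compact_imp_bounded[OF E(1)] by (auto simp: bounded_iff)
  define b where "b = max b0 1"
  have b: "b > 0" "\<And>w. w \<in> E \<Longrightarrow> cmod w \<le> b" "\<And>t. t \<in> S \<Longrightarrow> cmod t \<le> b"
    using b0 E(3) by (auto simp: b_def le_max_iff_disj)
  have cont: "continuous_on (- E) v"
    unfolding v_def using E(3) continuous_on_pot[OF E(4)] I J
    by (intro continuous_on_diff) (auto intro: continuous_on_subset)
  have asymp: "\<bar>v w\<bar> \<le> 2 * b / (cmod w - b)" if "b < cmod w" for w
  proof -
    have "\<bar>pot I w - ln (cmod w)\<bar> \<le> b / (cmod w - b)" "\<bar>pot J w - ln (cmod w)\<bar> \<le> b / (cmod w - b)"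
      using pot_minus_ln_norm_le[OF I b(3)] pot_minus_ln_norm_le[OF J b(3)] b that by auto
    then show ?thesis
      unfolding v_def by (simp add: abs_le_iff)
  qed
  have small: "\<exists>B>b. \<forall>w. B \<le> cmod w \<longrightarrow> \<bar>v w\<bar> \<le> e" if "e > 0" for e
  proof (intro exI[of _ "b + 2 * b / e"] conjI allI impI)
    fix w assume w: "b + 2 * b / e \<le> cmod w"
    moreover have "0 < 2 * b / e" using b that by simp
    ultimately have "2 * b / (cmod w - b) \<le> 2 * b / (2 * b / e)"
      using b by (intro divide_left_mono mult_pos_pos) (linarith | simp)+
    also have "\<dots> = e" using b that by simp
    finally show "\<bar>v w\<bar> \<le> e"
      using asymp[of w] w \<open>0 < 2 * b / e\<close> by linarith
  qed (use b that in auto)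
  have mv: "\<exists>e>0. \<forall>c. cmod c < e \<longrightarrow> circle_mean v w c \<longlonglongrightarrow> v w" if w: "w \<in> - E" for w
  proof -
    obtain e where e: "e > 0" "\<And>t. t \<in> S \<Longrightarrow> e \<le> cmod (w - t)"
      using dist_closed_pos[of S w] w E(3,4) compact_imp_closed by blast
    have "circle_mean v w c \<longlonglongrightarrow> v w" if "cmod c < e" for c
      unfolding v_def circle_mean_diff using that e(2)
      by (intro tendsto_diff circle_mean_pot_tendsto[OF E(4)] I J) (auto intro: order.strict_trans2)
    then show ?thesis using e(1) by blast
  qed
  \<comment> \<open>If \<open>v\<close> is positive somewhere, its decay at infinity and
    \<open>inner\<close> confine the search for a maximum to the compact set \<open>A\<close>.
    Otherwise \<open>v\<close> is nowhere positive, and since its means over a circle enclosing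
    \<open>E\<close> tend to 0, it reaches 0 on that circle.\<close>
  have "\<exists>p. p \<in> - E \<and> (\<forall>w\<in>- E. v w \<le> v p)"
  proof (cases "\<exists>w\<in>- E. v w > 0")
    case True
    then obtain z1 where z1: "z1 \<notin> E" "v z1 > 0" by auto
    obtain z2 where z2: "z2 \<notin> E" "infdist z2 E \<ge> d" "v z1 \<le> v z2"
    proof (cases "infdist z1 E \<ge> d")
      case False
      then show ?thesis using inner[OF z1(1)] that unfolding v_def by force
    qed (use z1 that in auto)
    obtain B where B: "B > b" "\<And>w. B \<le> cmod w \<Longrightarrow> \<bar>v w\<bar> \<le> v z2 / 2"
      using small[of "v z2 / 2"] z1 z2 by auto
    define A where "A = {w. infdist w E \<ge> d} \<inter> cball 0 B"
    have "closed {w. infdist w E \<ge> d}"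
      by (intro closed_Collect_le continuous_intros)
    then have "compact A"
      unfolding A_def by (intro closed_Int_compact) auto
    have "A \<subseteq> - E"
      using d by (auto simp: A_def)
    have "z2 \<in> A"
      using z2 z1 B(2)[of z2] by (cases "B \<le> cmod z2") (auto simp: A_def)
    then have "\<exists>p\<in>A. \<forall>w\<in>A. v w \<le> v p"
      using \<open>A \<subseteq> - E\<close> cont \<open>compact A\<close> by (intro continuous_attains_sup) (auto intro: continuous_on_subset)
    then obtain p where p: "p \<in> A" "\<And>w. w \<in> A \<Longrightarrow> v w \<le> v p" by blast
    have far: "v w \<le> v p" if "w \<notin> E" "infdist w E \<ge> d" for w
    proof (cases "w \<in> A")
      case False
      then have "\<bar>v w\<bar> \<le> v z2 / 2" using that B(2) by (auto simp: A_def)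
      then show ?thesis using p(2)[OF \<open>z2 \<in> A\<close>] z1 z2 by linarith
    qed (use p in auto)
    have "v w \<le> v p" if w: "w \<notin> E" for w
    proof (cases "infdist w E \<ge> d")
      case False
      then obtain k where "k \<notin> E" "infdist k E = d" "v w \<le> v k"
        using inner[OF w] unfolding v_def by force
      then show ?thesis using far[of k] by auto
    qed (use far w in auto)
    then show ?thesis using p(1) \<open>A \<subseteq> - E\<close> by auto
  next
    case False
    define c where "c = complex_of_real (b + 1)"
    have c: "cmod c = b + 1" using b by (simp add: c_def)
    have sph: "sphere 0 (b + 1) \<subseteq> - E" using b by fastforce
    have "c \<in> sphere 0 (b + 1)" using c by simp
    then have "\<exists>p\<in>sphere 0 (b + 1). \<forall>w\<in>sphere 0 (b + 1). v w \<le> v p"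
      using sph cont b(1) by (intro continuous_attains_sup) (auto intro: continuous_on_subset)
    then obtain p where p: "p \<in> sphere 0 (b + 1)" "\<And>w. w \<in> sphere 0 (b + 1) \<Longrightarrow> v w \<le> v p" by blast
    have "circle_mean v 0 c \<longlonglongrightarrow> ln (cmod c) - ln (cmod c)"
      unfolding v_def circle_mean_diff using b c
      by (intro tendsto_diff circle_mean_pot_tendsto_outside[OF E(4)] I J) force+
    moreover have "circle_mean v 0 c N \<le> v p" if "N > 0" for N
      using p(2) c by (intro circle_mean_le that) (auto simp: dist_norm)
    ultimately have "0 \<le> v p"
      by (intro LIMSEQ_le_const2[of _ 0 "v p"] exI[of _ 1]) auto
    moreover have "v w \<le> 0" if "w \<in> - E" for w
      using False that by force
    ultimately show ?thesis using p(1) sph by (intro exI[of _ p]) force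
  qed
  then obtain p where p: "p \<in> - E" "\<And>w. w \<in> - E \<Longrightarrow> v w \<le> v p" by blast
  have const: "v w = v p" if "w \<in> - E" for w
    by (rule strong_maximum_principle[OF _ E(2) cont mv p that]) (use E compact_imp_closed in auto)
  have "\<bar>v p\<bar> \<le> e" if e: "e > 0" for e
  proof -
    obtain B where B: "B > b" "\<And>w. B \<le> cmod w \<Longrightarrow> \<bar>v w\<bar> \<le> e" using small[OF e] by auto
    have "complex_of_real B \<in> - E" using b B(1) by force
    then show ?thesis using B(2)[of "complex_of_real B"] B(1) b const by force
  qed
  then have "v p = 0"
    by (metis abs_le_zero_iff field_le_epsilon add_0)
  then show ?thesis
    using const[of z] z by (simp add: v_def)
qed

subsection \<open>Uniqueness of measures with given exterior potential\<close>

lemma sum_ln_ratio_le: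
  fixes J :: nat
  assumes "J > 0"
  shows "(\<Sum>k=1..J. ln (J / k)) \<le> J"
proof -
  \<comment> \<open>A single term of the exponential series gives J^J / J! \<le> e^J. In other
    words, the logarithms of the points k / J have mean at least -1.\<close>
  have "exp (real J) = (\<Sum>n. real J ^ n / fact n)"
    by (simp add: exp_def field_simps)
  also have "\<dots> \<ge> real J ^ J / fact J"
    using sum_le_suminf[of "\<lambda>n. real J ^ n / fact n" "{J}"] summable_exp[of "real J"]
    by (simp add: field_simps)
  finally have "real J ^ J / fact J \<le> exp (real J)" .
  then have "ln (real J ^ J / fact J) \<le> J"
    using assms by (metis divide_pos_pos fact_gt_zero ln_exp ln_mono of_nat_0_less_iff zero_less_power)
  moreover have "(\<Sum>k=1..J. ln (J / k)) = ln (\<Prod>k=1..J. real J / k)"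
    using assms by (subst ln_prod) auto
  moreover have "(\<Prod>k=1..J. real J / k) = real J ^ J / fact J"
    by (simp add: prod_dividef fact_prod)
  ultimately show ?thesis by simp
qed

text \<open>Each distance from \<open>j0\<close> occurs at most twice, once on either side.\<close>

lemma sum_dist_le_two_sums:
  fixes f :: "nat \<Rightarrow> real"
  assumes f: "\<And>k. k \<ge> 1 \<Longrightarrow> k \<le> J \<Longrightarrow> f k \<ge> 0" and "j0 < J"
  shows "(\<Sum>j\<in>{..<J} - {j0}. f (nat \<bar>int j - int j0\<bar>)) \<le> 2 * (\<Sum>k=1..J. f k)"
proof -
  let ?g = "\<lambda>j. nat \<bar>int j - int j0\<bar>"
  have "{..<J} - {j0} = {..<j0} \<union> {j0<..<J}"
    using assms(2) by auto
  then have "(\<Sum>j\<in>{..<J} - {j0}. f (?g j)) = (\<Sum>j\<in>{..<j0}. f (?g j)) + (\<Sum>j\<in>{j0<..<J}. f (?g j))"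
    by (simp add: sum.union_disjoint Int_def)
  also have "(\<Sum>j\<in>{..<j0}. f (?g j)) = sum f (?g ` {..<j0})"
    by (subst sum.reindex) (auto simp: inj_on_def)
  also have "\<dots> \<le> sum f {1..J}"
    using assms by (intro sum_mono2) auto
  also have "(\<Sum>j\<in>{j0<..<J}. f (?g j)) = sum f (?g ` {j0<..<J})"
    by (subst sum.reindex) (auto simp: inj_on_def)
  also have "\<dots> \<le> sum f {1..J}"
    using assms by (intro sum_mono2) auto
  finally show ?thesis by simp
qed

text \<open>A point \<open>t\<close> within \<open>\<delta>\<close> of the boundary is replaced by points \<open>\<zeta> j\<close> on a path in the
  complement, one on each of \<open>J\<close> equally spaced circles around \<open>t\<close>. Their distances to \<open>z\<close> are at
  least the differences of the radii, except for one \<open>j\<close>, which does not count if \<open>J\<close> is large.\<close>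

lemma exterior_log_approx:
  fixes E :: "complex set" and t :: complex
  assumes E: "compact E" "connected (- E)" and \<delta>: "\<delta> > 0"
    and t: "z0 \<in> frontier E" "cmod (t - z0) \<le> \<delta>"
  shows "\<exists>J \<zeta>. J > 0 \<and> (\<forall>j<J. \<zeta> j \<notin> E) \<and>
    (\<forall>z\<in>E. \<bar>(\<Sum>j<J. ln (cmod (z - \<zeta> j))) / real J - ln (max (cmod (z - t)) \<delta>)\<bar>
              \<le> 20 * sqrt (\<delta> / max (cmod (z - t)) \<delta>))"
proof -
  have opn: "open (- E)" using E(1) compact_imp_closed by blast
  obtain b where b: "b \<notin> E" "cmod (b - z0) < \<delta>"
  proof -
    have "z0 \<in> closure (- E)"
      using t(1) by (simp add: frontier_closures)
    then show ?thesis
      using that \<delta> by (auto simp: closure_approachable dist_norm)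
  qed
  have bt: "cmod (b - t) < 2 * \<delta>"
    using norm_triangle_ineq[of "b - z0" "z0 - t"] b(2) t(2) by (simp add: norm_minus_commute)
  obtain B where B: "\<And>w. w \<in> E \<Longrightarrow> cmod w \<le> B"
    using compact_imp_bounded[OF E(1)] by (auto simp: bounded_iff)
  define c where "c = complex_of_real (\<bar>B\<bar> + cmod t + 4 * \<delta> + 1)"
  have nc: "cmod c = \<bar>B\<bar> + cmod t + 4 * \<delta> + 1"
    unfolding c_def norm_of_real using \<delta> by auto
  have c: "c \<notin> E" "cmod (c - t) > 4 * \<delta>"
  proof -
    show "c \<notin> E"
      using B[of c] nc \<delta> norm_ge_zero[of t] by linarith
    show "cmod (c - t) > 4 * \<delta>"
      using nc norm_triangle_ineq2[of c t] by linarith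
  qed
  have "path_connected (- E)"
    using E(2) opn connected_open_path_connected by blast
  then obtain \<gamma> where \<gamma>: "path \<gamma>" "path_image \<gamma> \<subseteq> - E" "pathstart \<gamma> = b" "pathfinish \<gamma> = c"
    using b c unfolding path_connected_def by (metis ComplI)
  \<comment> \<open>The path leads from within 2 \<delta> of \<open>t\<close> to beyond 4 \<delta>,
    so the distance to \<open>t\<close> takes every value in between.\<close>
  have hit: "\<exists>\<zeta>\<in>path_image \<gamma>. cmod (\<zeta> - t) = \<rho>" if "2 * \<delta> \<le> \<rho>" "\<rho> \<le> 4 * \<delta>" for \<rho>
  proof -
    have "connected ((\<lambda>\<zeta>. cmod (\<zeta> - t)) ` path_image \<gamma>)"
      using \<gamma>(1) by (intro connected_continuous_image continuous_intros connected_path_image)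
    moreover have "cmod (b - t) \<in> (\<lambda>\<zeta>. cmod (\<zeta> - t)) ` path_image \<gamma>"
      "cmod (c - t) \<in> (\<lambda>\<zeta>. cmod (\<zeta> - t)) ` path_image \<gamma>"
      using \<gamma>(3,4) pathstart_in_path_image[of \<gamma>] pathfinish_in_path_image[of \<gamma>] by auto
    moreover have "cmod (b - t) \<le> \<rho>" "\<rho> \<le> cmod (c - t)"
      using that bt c(2) by linarith+
    ultimately have "\<rho> \<in> (\<lambda>\<zeta>. cmod (\<zeta> - t)) ` path_image \<gamma>"
      by (rule connectedD_interval)
    then show ?thesis by auto
  qed
  obtain d0 where d0: "d0 > 0" "\<And>z \<zeta>. z \<in> E \<Longrightarrow> \<zeta> \<in> path_image \<gamma> \<Longrightarrow> d0 \<le> cmod (z - \<zeta>)"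
  proof -
    have "E \<inter> path_image \<gamma> = {}" using \<gamma>(2) by blast
    then show ?thesis
      using separate_compact_closed[OF E(1) closed_path_image[OF \<gamma>(1)]] that
      unfolding dist_norm by blast
  qed
  \<comment> \<open>The path, and with it its distance \<open>d0\<close> from \<open>E\<close>, is
    fixed before \<open>J\<close>. So the one term without a better lower bound than ln (d0 /
    \<delta>) lowers a mean of \<open>J\<close> terms by at most 1.\<close>
  obtain J :: nat where J: "J > 0" "\<bar>ln (d0 / \<delta>)\<bar> \<le> J"
  proof -
    obtain n :: nat where "\<bar>ln (d0 / \<delta>)\<bar> < n"
      using reals_Archimedean2 by blast
    then show ?thesis using that[of "Suc n"] by simp
  qed
  define \<rho> where "\<rho> j = 2 * \<delta> * (1 + real j / J)" for j
  have \<rho>: "2 * \<delta> \<le> \<rho> j" "\<rho> j \<le> 4 * \<delta>" if "j < J" for j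
    using that \<delta> J(1) by (auto simp: \<rho>_def field_simps)
  have "\<forall>j\<in>{..<J}. \<exists>\<zeta>. \<zeta> \<in> path_image \<gamma> \<and> cmod (\<zeta> - t) = \<rho> j"
    using hit \<rho> by (simp add: Bex_def)
  then have "\<exists>\<zeta>. \<forall>j\<in>{..<J}. \<zeta> j \<in> path_image \<gamma> \<and> cmod (\<zeta> j - t) = \<rho> j"
    by (rule bchoice)
  then obtain \<zeta> where \<zeta>: "\<And>j. j < J \<Longrightarrow> \<zeta> j \<in> path_image \<gamma>" "\<And>j. j < J \<Longrightarrow> cmod (\<zeta> j - t) = \<rho> j"
    by auto
  have est: "\<bar>(\<Sum>j<J. ln (cmod (z - \<zeta> j))) / real J - ln (max (cmod (z - t)) \<delta>)\<bar>
              \<le> 20 * sqrt (\<delta> / max (cmod (z - t)) \<delta>)" if z: "z \<in> E" for z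
  proof -
    define x where "x = max (cmod (z - t)) \<delta>"
    have x: "x \<ge> \<delta>" "x > 0" using \<delta> by (auto simp: x_def)
    have zpos: "cmod (z - \<zeta> j) > 0" if "j < J" for j
      using d0(2)[OF z \<zeta>(1)[OF that]] d0(1) by linarith
    have avg: "(\<Sum>j<J. ln (cmod (z - \<zeta> j))) / real J - ln x = (\<Sum>j<J. ln (cmod (z - \<zeta> j)) - ln x) / J"
      using J(1) by (simp add: sum_subtractf field_simps)
    show ?thesis
    \<comment> \<open>At distance 8 \<delta> or more, replacing \<open>t\<close> by
      \<open>\<zeta> j\<close> is a small relative change and the Lipschitz bound of the logarithm
      suffices. Closer in, sqrt (\<delta> / x) is at least 1/3, so any error below 20/3 is
      acceptable.\<close>
    proof (cases "x \<ge> 8 * \<delta>")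
      case True
      then have xz: "x = cmod (z - t)" using \<delta> by (auto simp: x_def max_def split: if_splits)
      have "\<bar>ln (cmod (z - \<zeta> j)) - ln x\<bar> \<le> 8 * \<delta> / x" if j: "j < J" for j
      proof -
        have "\<bar>cmod (z - \<zeta> j) - x\<bar> \<le> 4 * \<delta>"
          using norm_triangle_ineq3[of "z - \<zeta> j" "z - t"] \<zeta>(2)[OF j] \<rho>(2)[OF j] xz
          by (simp add: norm_minus_commute)
        moreover have "\<bar>ln (cmod (z - \<zeta> j)) - ln x\<bar> \<le> \<bar>cmod (z - \<zeta> j) - x\<bar> / (x / 2)"
          using calculation True x by (intro abs_ln_diff_le) (auto simp: abs_le_iff)
        ultimately have "\<bar>ln (cmod (z - \<zeta> j)) - ln x\<bar> \<le> 4 * \<delta> / (x / 2)"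
          using x by (meson divide_right_mono half_gt_zero less_imp_le order.trans)
        then show ?thesis by simp
      qed
      then have "\<bar>\<Sum>j<J. ln (cmod (z - \<zeta> j)) - ln x\<bar> \<le> (\<Sum>j<J. 8 * \<delta> / x)"
        by (intro order.trans[OF sum_abs] sum_mono) auto
      then have "\<bar>(\<Sum>j<J. ln (cmod (z - \<zeta> j)) - ln x) / J\<bar> \<le> 8 * (\<delta> / x)"
        using J(1) by (simp add: abs_divide divide_le_eq mult.commute)
      also have "\<delta> / x \<le> sqrt (\<delta> / x)"
      proof -
        have "(\<delta> / x)\<^sup>2 \<le> \<delta> / x"
          using x \<delta> power_decreasing[of 1 2 "\<delta> / x"] by simp
        then show ?thesis by (rule real_le_rsqrt)
      qed
      finally have "\<bar>(\<Sum>j<J. ln (cmod (z - \<zeta> j)) - ln x) / J\<bar> \<le> 8 * sqrt (\<delta> / x)" by simp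
      also have "\<dots> \<le> 20 * sqrt (\<delta> / x)"
        using x \<delta> by (intro mult_right_mono) auto
      finally show ?thesis unfolding x_def[symmetric] avg .
    next
      case False
      define y where "y = cmod (z - t) / \<delta>"
      have y: "0 \<le> y" "y < 8"
        using False \<delta> by (auto simp: y_def x_def field_simps)
      define u where "u j = cmod (z - \<zeta> j) / \<delta>" for j
      have up: "u j > 0" if "j < J" for j
        using zpos[OF that] \<delta> by (simp add: u_def)
      have ur: "\<bar>y - 2 * (1 + real j / J)\<bar> \<le> u j" if j: "j < J" for j
      proof -
        have "\<bar>cmod (z - t) - \<rho> j\<bar> \<le> cmod (z - \<zeta> j)"
          using norm_triangle_ineq3[of "z - t" "\<zeta> j - t"] \<zeta>(2)[OF j] by simp
        then have "\<bar>cmod (z - t) - \<rho> j\<bar> / \<delta> \<le> u j"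
          using \<delta> unfolding u_def by (intro divide_right_mono) auto
        moreover have "\<bar>cmod (z - t) - \<rho> j\<bar> / \<delta> = \<bar>(cmod (z - t) - \<rho> j) / \<delta>\<bar>"
          using \<delta> by simp
        moreover have "(cmod (z - t) - \<rho> j) / \<delta> = y - 2 * (1 + real j / J)"
          using \<delta> by (simp add: y_def \<rho>_def diff_divide_distrib)
        ultimately show ?thesis by simp
      qed
      have uu: "u j \<le> 12" if j: "j < J" for j
      proof -
        have "cmod (z - \<zeta> j) \<le> 12 * \<delta>"
          using norm_triangle_ineq3[of "z - \<zeta> j" "z - t"] \<zeta>(2)[OF j] \<rho>(2)[OF j] False
          by (auto simp: norm_minus_commute x_def)
        then show ?thesis using \<delta> by (simp add: u_def divide_le_eq)
      qed
      obtain j0 where j0: "j0 < J" "\<And>j. j < J \<Longrightarrow> \<bar>y - 2 * (1 + real j0 / J)\<bar> \<le> \<bar>y - 2 * (1 + real j / J)\<bar>"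
      proof -
        let ?f = "\<lambda>j. \<bar>y - 2 * (1 + real j / J)\<bar>"
        have "Min (?f ` {..<J}) \<in> ?f ` {..<J}"
          using J(1) by (intro Min_in) auto
        then obtain j0 where "j0 < J" "?f j0 = Min (?f ` {..<J})" by auto
        then show ?thesis using that[of j0] by simp
      qed
      \<comment> \<open>Since the radius of index \<open>j0\<close> is nearest to \<open>y\<close>,
        the distance from \<open>y\<close> to any other radius is at least half the distance of the
        two radii. In units of \<delta> the radii are 2 / J apart.\<close>
      have sep: "real (nat \<bar>int j - int j0\<bar>) / J \<le> u j" if j: "j < J" for j
      proof -
        have "2 * \<bar>real j - real j0\<bar> / J = \<bar>2 * (1 + real j / J) - 2 * (1 + real j0 / J)\<bar>"
        proof -
          have "2 * (1 + real j / J) - 2 * (1 + real j0 / J) = 2 * (real j - real j0) / J"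
            by (simp add: diff_divide_distrib)
          then show ?thesis
            by (simp only: abs_divide abs_mult abs_numeral abs_of_nat)
        qed
        also have "\<dots> \<le> 2 * \<bar>y - 2 * (1 + real j / J)\<bar>"
        proof -
          have "\<bar>a - a'\<bar> \<le> 2 * \<bar>y - a\<bar>" if "\<bar>y - a'\<bar> \<le> \<bar>y - a\<bar>" for a a'
            using that abs_triangle_ineq4[of "y - a'" "y - a"] by simp
          from this[OF j0(2)[OF j]] show ?thesis .
        qed
        finally have "\<bar>real j - real j0\<bar> / J \<le> u j"
          using ur[OF j] by simp
        moreover have "real (nat \<bar>int j - int j0\<bar>) = \<bar>real j - real j0\<bar>"
          by simp
        ultimately show ?thesis by simp
      qed
      have "(\<Sum>j<J. ln (u j)) \<le> (\<Sum>j<J. 3)"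
      proof (intro sum_mono)
        fix j assume "j \<in> {..<J}"
        then have "ln (u j) \<le> ln 12" using up uu by simp
        also have "ln (12::real) \<le> ln (exp 3)"
        proof -
          have "(12::real) \<le> (5/2) ^ 3" by (simp add: power3_eq_cube)
          also have "(5/2::real) ^ 3 \<le> exp 1 ^ 3"
            using exp_lower_Taylor_quadratic[of 1] by (intro power_mono) auto
          also have "\<dots> = exp 3" by (simp add: exp_of_nat_mult[symmetric])
          finally show ?thesis by (rule ln_mono) simp
        qed
        finally show "ln (u j) \<le> 3" by simp
      qed
      then have up3: "(\<Sum>j<J. ln (u j)) / J \<le> 3"
        using J(1) by (simp add: divide_le_eq mult.commute)
      have "(\<Sum>j<J. - ln (u j)) = - ln (u j0) + (\<Sum>j\<in>{..<J} - {j0}. - ln (u j))"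
        using j0(1) by (subst sum.remove[of _ j0]) auto
      also have "- ln (u j0) \<le> J"
      proof -
        have "d0 / \<delta> \<le> u j0"
          unfolding u_def using d0(2)[OF z \<zeta>(1)[OF j0(1)]] \<delta> by (intro divide_right_mono) auto
        then have "ln (d0 / \<delta>) \<le> ln (u j0)"
          using d0(1) \<delta> by (intro ln_mono) auto
        then show ?thesis using J(2) by linarith
      qed
      also have "(\<Sum>j\<in>{..<J} - {j0}. - ln (u j)) \<le> (\<Sum>j\<in>{..<J} - {j0}. ln (J / real (nat \<bar>int j - int j0\<bar>)))"
      proof (intro sum_mono)
        fix j assume j: "j \<in> {..<J} - {j0}"
        let ?k = "real (nat \<bar>int j - int j0\<bar>)"
        have k: "?k > 0" using j by auto
        have "ln (?k / J) \<le> ln (u j)"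
          using sep[of j] j k J(1) by (intro ln_mono) auto
        then show "- ln (u j) \<le> ln (J / ?k)"
          using k J(1) by (simp add: ln_div)
      qed
      also have "\<dots> \<le> 2 * (\<Sum>k=1..J. ln (J / real k))"
        using j0(1) by (intro sum_dist_le_two_sums[of J "\<lambda>k. ln (J / real k)"]) auto
      also have "\<dots> \<le> 2 * J"
        using sum_ln_ratio_le[OF J(1)] by simp
      finally have "- (\<Sum>j<J. ln (u j)) \<le> 3 * J" by (simp add: sum_negf)
      then have lo3: "(\<Sum>j<J. ln (u j)) / J \<ge> - 3"
        using J(1) by (simp add: le_divide_eq)
      have lnx: "0 \<le> ln (x / \<delta>)" "ln (x / \<delta>) \<le> 3"
      proof -
        have "1 \<le> x / \<delta>" using x \<delta> by simp
        then show "0 \<le> ln (x / \<delta>)" by simp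
        have "x / \<delta> \<le> 8" using False \<delta> by (simp add: field_simps)
        also have "(8::real) = 2 ^ 3" by simp
        also have "\<dots> \<le> exp 1 ^ 3"
          using exp_ge_add_one_self[of 1] by (intro power_mono) auto
        also have "\<dots> = exp 3" by (simp add: exp_of_nat_mult[symmetric])
        finally show "ln (x / \<delta>) \<le> 3"
          using x \<delta> by (metis divide_pos_pos ln_exp ln_mono)
      qed
      have "ln (cmod (z - \<zeta> j)) - ln x = ln (u j) - ln (x / \<delta>)" if "j < J" for j
        using zpos[OF that] \<delta> x by (simp add: u_def ln_div)
      then have "(\<Sum>j<J. ln (cmod (z - \<zeta> j)) - ln x) / J = (\<Sum>j<J. ln (u j)) / J - ln (x / \<delta>)"
        using J(1) by (simp add: sum_subtractf diff_divide_distrib)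
      \<comment> \<open>The mean of \<open>ln (u j)\<close> lies in [-3, 3], where -3 consists of 1
        for the index \<open>j0\<close> and 2 for all others, and \<open>ln (x / \<delta>)\<close>
        lies in [0, 3]. The error is thus at most 6, which is below 20/3.\<close>
      then have "\<bar>(\<Sum>j<J. ln (cmod (z - \<zeta> j)) - ln x) / J\<bar> \<le> 20 * (1 / 3)"
        using up3 lo3 lnx by linarith
      also have "1 / 3 \<le> sqrt (\<delta> / x)"
      proof (rule real_le_rsqrt)
        show "(1 / 3)\<^sup>2 \<le> \<delta> / x"
          using False x by (simp add: field_simps power2_eq_square)
      qed
      finally show ?thesis unfolding x_def[symmetric] avg by simp
    qed
  qed
  show ?thesis
    using J(1) \<zeta>(1) \<gamma>(2) est by (intro exI[of _ J] exI[of _ \<zeta>]) auto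
qed

section \<open>Functions to which two functionals assign the same value\<close>

definition agree :: "complex set \<Rightarrow> ((complex \<Rightarrow> real) \<Rightarrow> real) \<Rightarrow> ((complex \<Rightarrow> real) \<Rightarrow> real) \<Rightarrow> (complex \<Rightarrow> real) \<Rightarrow> bool"
  where "agree S I J \<phi> \<longleftrightarrow> continuous_on S \<phi> \<and> I \<phi> = J \<phi>"

context
  fixes S :: "complex set" and I J :: "(complex \<Rightarrow> real) \<Rightarrow> real"
  assumes I: "pos_mean S I" and J: "pos_mean S J"
begin

lemma agree_const: "agree S I J (\<lambda>_. c)"
  by (simp add: agree_def pos_mean_const[OF I] pos_mean_const[OF J])

lemma agree_add: "agree S I J f \<Longrightarrow> agree S I J g \<Longrightarrow> agree S I J (\<lambda>x. f x + g x)"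
  by (auto simp: agree_def pos_mean_add[OF I] pos_mean_add[OF J] intro: continuous_on_add)

lemma agree_diff: "agree S I J f \<Longrightarrow> agree S I J g \<Longrightarrow> agree S I J (\<lambda>x. f x - g x)"
  by (auto simp: agree_def pos_mean_diff[OF I] pos_mean_diff[OF J] intro: continuous_on_diff)

lemma agree_cmult: "agree S I J f \<Longrightarrow> agree S I J (\<lambda>x. c * f x)"
  by (auto simp: agree_def pos_mean_cmult[OF I] pos_mean_cmult[OF J] intro: continuous_on_mult_left)

lemma agree_sum: "(\<And>k. k \<in> A \<Longrightarrow> agree S I J (f k)) \<Longrightarrow> agree S I J (\<lambda>x. \<Sum>k\<in>A. f k x)"
  by (auto simp: agree_def pos_mean_sum[OF I] pos_mean_sum[OF J] intro: continuous_on_sum)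

lemma agree_limit:
  assumes "continuous_on S \<phi>"
    and "\<And>e. e > 0 \<Longrightarrow> \<exists>\<psi>. agree S I J \<psi> \<and> (\<forall>x\<in>S. \<bar>\<phi> x - \<psi> x\<bar> \<le> e)"
  shows "agree S I J \<phi>"
proof -
  have "\<bar>I \<phi> - J \<phi>\<bar> \<le> e" if e: "e > 0" for e
  proof -
    obtain \<psi> where \<psi>: "agree S I J \<psi>" "\<And>x. x \<in> S \<Longrightarrow> \<bar>\<phi> x - \<psi> x\<bar> \<le> e / 2"
      using assms(2)[of "e / 2"] e by auto
    have c: "continuous_on S \<psi>" using \<psi>(1) by (simp add: agree_def)
    have "\<bar>I \<phi> - I \<psi>\<bar> \<le> e / 2" "\<bar>J \<phi> - J \<psi>\<bar> \<le> e / 2"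
      by (rule pos_mean_dist_const[OF I assms(1) c \<psi>(2)] pos_mean_dist_const[OF J assms(1) c \<psi>(2)]; simp)+
    then show ?thesis
      using \<psi>(1) abs_triangle_ineq4[of "I \<phi> - I \<psi>" "J \<phi> - J \<psi>"] by (simp add: agree_def)
  qed
  then have "I \<phi> = J \<phi>"
    by (metis abs_le_zero_iff add_0 eq_iff_diff_eq_0 field_le_epsilon)
  then show ?thesis using assms(1) by (simp add: agree_def)
qed

lemma agree_ln: "z \<notin> S \<Longrightarrow> agree S I J (\<lambda>t. ln (cmod (t - z))) \<longleftrightarrow> pot I z = pot J z"
  unfolding agree_def pot_def using continuous_on_ln_dist[of z S] by (simp add: norm_minus_commute)

end

text \<open>This trades the square root error for a small multiple of a kernel whose integral is a
  potential. For x \<ge> \<kappa> a small \<delta> makes the root at most \<epsilon>. Below \<kappa>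
  = L e^(-1/\<epsilon>) the logarithm has grown by 1 / \<epsilon>, while the root never exceeds
  1.\<close>

lemma sqrt_ratio_le_log:
  assumes "\<epsilon> > 0" "L > 0"
  obtains \<delta>0 where "\<delta>0 > 0"
    "\<And>\<delta> x. \<lbrakk>0 < \<delta>; \<delta> \<le> \<delta>0; \<delta> \<le> x; x \<le> L\<rbrakk> \<Longrightarrow> sqrt (\<delta> / x) \<le> \<epsilon> * (1 + ln L - ln x)"
proof
  define \<kappa> where "\<kappa> = L * exp (- 1 / \<epsilon>)"
  show "\<epsilon>\<^sup>2 * \<kappa> > 0" using assms by (simp add: \<kappa>_def)
  fix \<delta> x assume *: "0 < \<delta>" "\<delta> \<le> \<epsilon>\<^sup>2 * \<kappa>" "\<delta> \<le> x" "x \<le> L"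
  then have lnx: "ln x \<le> ln L" using assms by simp
  show "sqrt (\<delta> / x) \<le> \<epsilon> * (1 + ln L - ln x)"
  proof (cases "x \<ge> \<kappa>")
    case True
    have \<kappa>: "\<kappa> > 0" using assms by (simp add: \<kappa>_def)
    have "\<delta> / x \<le> \<delta> / \<kappa>" using True \<kappa> * by (intro divide_left_mono) auto
    also have "\<dots> \<le> \<epsilon>\<^sup>2" using * \<kappa> by (simp add: divide_le_eq)
    finally have "sqrt (\<delta> / x) \<le> \<epsilon>" using assms by (simp add: real_le_lsqrt)
    also have "\<dots> \<le> \<epsilon> * (1 + ln L - ln x)" using lnx assms by simp
    finally show ?thesis .
  next
    case False
    have "\<delta> / x \<le> 1" using * by simp
    then have "sqrt (\<delta> / x) \<le> 1" by simp
    also have "1 \<le> \<epsilon> * (ln L - ln x)"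
    proof -
      have "ln x \<le> ln \<kappa>" using False * by simp
      also have "\<dots> = ln L - 1 / \<epsilon>" using assms by (simp add: \<kappa>_def ln_mult)
      finally have "1 / \<epsilon> \<le> ln L - ln x" by simp
      then show ?thesis using assms by (simp add: divide_le_eq mult.commute)
    qed
    also have "\<dots> \<le> \<epsilon> * (1 + ln L - ln x)" using assms by simp
    finally show ?thesis .
  qed
qed

lemma exterior_log_approx_agree:
  fixes E :: "complex set"
  assumes E: "compact E" "connected (- E)" and I: "pos_mean (frontier E) I" and J: "pos_mean (frontier E) J"
    and ext: "\<And>z. z \<notin> E \<Longrightarrow> pot I z = pot J z"
    and \<delta>: "\<delta> > 0" and t: "z0 \<in> frontier E" "cmod (t - z0) \<le> \<delta>"
  obtains A where "agree (frontier E) I J A"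
    "\<And>z. z \<in> frontier E \<Longrightarrow> \<bar>A z - ln (max (cmod (z - t)) \<delta>)\<bar> \<le> 20 * sqrt (\<delta> / max (cmod (z - t)) \<delta>)"
proof -
  have SE: "frontier E \<subseteq> E"
    using E(1) frontier_subset_closed compact_imp_closed by blast
  obtain n :: nat and \<zeta> where n: "n > 0" "\<And>j. j < n \<Longrightarrow> \<zeta> j \<notin> E"
    "\<And>z. z \<in> E \<Longrightarrow> \<bar>(\<Sum>j<n. ln (cmod (z - \<zeta> j))) / real n - ln (max (cmod (z - t)) \<delta>)\<bar>
              \<le> 20 * sqrt (\<delta> / max (cmod (z - t)) \<delta>)"
    using exterior_log_approx[OF E \<delta> t] by blast
  have "agree (frontier E) I J (\<lambda>z. ln (cmod (z - \<zeta> j)))" if "j < n" for j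
    using agree_ln[OF I J, of "\<zeta> j"] n(2)[OF that] ext SE by blast
  then have "agree (frontier E) I J (\<lambda>z. 1 / n * (\<Sum>j<n. ln (cmod (z - \<zeta> j))))"
    by (intro agree_cmult[OF I J] agree_sum[OF I J]) simp
  then show thesis
    using n(3) SE by (intro that[of "\<lambda>z. 1 / n * (\<Sum>j<n. ln (cmod (z - \<zeta> j)))"]) auto
qed

text \<open>On the set of points of \<open>E\<close> at distance \<open>\<delta>\<close> from the boundary, the difference of the potentials
  is at most a small multiple of the positive harmonic function \<open>2 + (I + J)(ln (L / |z - \<cdot>|))\<close>. The
  maximum principle carries this bound inwards.\<close>

lemma pot_eq_interior:
  fixes E :: "complex set"
  assumes E: "compact E" "connected (- E)" and I: "pos_mean (frontier E) I" and J: "pos_mean (frontier E) J"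
    and ext: "\<And>z. z \<notin> E \<Longrightarrow> pot I z = pot J z"
    and t: "t \<in> interior E"
  shows "pot I t = pot J t"
proof -
  let ?S = "frontier E"
  have cE: "closed E" using E(1) compact_imp_closed by blast
  have SE: "?S \<subseteq> E" using frontier_subset_closed[OF cE] .
  have cS: "compact ?S" using compact_frontier[OF E(1)] .
  have Sn: "?S \<noteq> {}" using pos_mean_nonempty[OF I] .
  have tS: "t \<notin> ?S" using t by (simp add: frontier_def)
  obtain b where b: "\<And>w. w \<in> E \<Longrightarrow> cmod w \<le> b"
    using compact_imp_bounded[OF E(1)] by (auto simp: bounded_iff)
  define L where "L = 2 * \<bar>b\<bar> + 1"
  have L: "L > 0" "\<And>w s. w \<in> E \<Longrightarrow> s \<in> E \<Longrightarrow> cmod (w - s) \<le> L"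
  proof -
    show "L > 0" by (simp add: L_def)
    fix w s assume "w \<in> E" "s \<in> E"
    then show "cmod (w - s) \<le> L"
      using norm_triangle_ineq4[of w s] b[of w] b[of s] by (simp add: L_def)
  qed
  define V where "V s = 2 + 2 * ln L - pot I s - pot J s" for s
  have key: "\<bar>pot I t - pot J t\<bar> \<le> 20 * \<epsilon> * V t" if \<epsilon>: "\<epsilon> > 0" for \<epsilon>
  proof -
    obtain \<delta>0 where \<delta>0: "\<delta>0 > 0"
      "\<And>\<delta> x. \<lbrakk>0 < \<delta>; \<delta> \<le> \<delta>0; \<delta> \<le> x; x \<le> L\<rbrakk> \<Longrightarrow> sqrt (\<delta> / x) \<le> \<epsilon> * (1 + ln L - ln x)"
      using sqrt_ratio_le_log[OF \<epsilon> L(1)] by blast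
    have dt: "infdist t ?S > 0"
      using tS Sn cS compact_imp_closed by (simp add: infdist_pos_not_in_closed)
    \<comment> \<open>\<open>\<delta>0\<close> makes the square root error admissible, and the
      distance of \<open>t\<close> from the frontier keeps \<open>t\<close> in
      \<open>K\<close>.\<close>
    define \<delta> where "\<delta> = min \<delta>0 (infdist t ?S)"
    have \<delta>: "\<delta> > 0" "\<delta> \<le> \<delta>0" "\<delta> \<le> infdist t ?S"
      using \<delta>0(1) dt by (auto simp: \<delta>_def)
    define K where "K = E \<inter> {s. \<delta> \<le> infdist s ?S}"
    have "closed {s. \<delta> \<le> infdist s ?S}"
      by (intro closed_Collect_le continuous_intros)
    then have K: "compact K" unfolding K_def using E(1) by blast
    have KS: "\<delta> \<le> cmod (s - z)" if "s \<in> K" "z \<in> ?S" for s z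
      using that infdist_le[of z ?S s] by (auto simp: K_def dist_norm)
    have KnS: "K \<subseteq> - ?S" using KS \<delta>(1) by fastforce
    have bd: "\<bar>pot I s - pot J s\<bar> \<le> 20 * \<epsilon> * V s" if s: "s \<in> frontier K" for s
    proof -
      have sK: "s \<in> K" using s K frontier_subset_closed compact_imp_closed by blast
      have "\<not> \<delta> < infdist s ?S"
      proof
        assume *: "\<delta> < infdist s ?S"
        have "s \<in> interior E"
          using sK KnS cE by (auto simp: K_def frontier_def)
        have "open {s. \<delta> < infdist s ?S}"
          by (intro open_Collect_less continuous_intros)
        then have "open (interior E \<inter> {s. \<delta> < infdist s ?S})" by auto
        moreover have "interior E \<inter> {s. \<delta> < infdist s ?S} \<subseteq> K"
          using interior_subset by (auto simp: K_def)
        ultimately have "s \<in> interior K"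
          using * \<open>s \<in> interior E\<close> interior_maximal by blast
        then show False using s by (simp add: frontier_def)
      qed
      then have "infdist s ?S = \<delta>" using sK by (auto simp: K_def)
      then obtain z0 where z0: "z0 \<in> ?S" "cmod (s - z0) \<le> \<delta>"
        using infdist_attains_inf[OF frontier_closed[of E] Sn, of s] by (metis dist_norm order_refl)
      obtain A where A: "agree ?S I J A"
        "\<And>z. z \<in> ?S \<Longrightarrow> \<bar>A z - ln (max (cmod (z - s)) \<delta>)\<bar> \<le> 20 * sqrt (\<delta> / max (cmod (z - s)) \<delta>)"
        using exterior_log_approx_agree[OF E I J ext \<delta>(1) z0] by blast
      have snS: "s \<notin> ?S" using sK KnS by auto
      define g where "g z = 20 * \<epsilon> * (1 + ln L - ln (cmod (s - z)))" for z
      have Ag: "\<bar>ln (cmod (s - z)) - A z\<bar> \<le> g z" if z: "z \<in> ?S" for z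
      proof -
        have x: "\<delta> \<le> cmod (s - z)" "cmod (s - z) \<le> L"
          using KS[OF sK z] L(2)[of s z] sK z SE by (auto simp: K_def)
        then have "max (cmod (z - s)) \<delta> = cmod (s - z)"
          by (simp add: norm_minus_commute)
        then have "\<bar>A z - ln (cmod (s - z))\<bar> \<le> 20 * sqrt (\<delta> / cmod (s - z))"
          using A(2)[OF z] by simp
        also have "\<dots> \<le> 20 * (\<epsilon> * (1 + ln L - ln (cmod (s - z))))"
          using \<delta>0(2)[OF \<delta>(1,2) x] by simp
        finally show ?thesis by (simp add: g_def abs_minus_commute)
      qed
      have cg: "continuous_on ?S g" unfolding g_def
        by (intro continuous_intros) (use snS in auto)
      have Ig: "M g = 20 * \<epsilon> * (1 + ln L - pot M s)" if M: "pos_mean ?S M" for M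
      proof -
        have c: "continuous_on ?S (\<lambda>z. ln (cmod (s - z)))" by (rule continuous_on_ln_dist[OF snS])
        have "M g = 20 * \<epsilon> * M (\<lambda>z. (1 + ln L) - ln (cmod (s - z)))"
          unfolding g_def by (rule pos_mean_cmult[OF M]) (intro continuous_intros c)
        also have "M (\<lambda>z. (1 + ln L) - ln (cmod (s - z))) = 1 + ln L - pot M s"
          unfolding pot_def using pos_mean_diff[OF M _ c, of "\<lambda>_. 1 + ln L"] pos_mean_const[OF M] by simp
        finally show ?thesis .
      qed
      have cA: "continuous_on ?S A" "I A = J A" using A(1) by (auto simp: agree_def)
      have "\<bar>pot I s - I A\<bar> \<le> I g" "\<bar>pot J s - J A\<bar> \<le> J g"
        unfolding pot_def using pos_mean_dist[OF I continuous_on_ln_dist[OF snS] cA(1) cg Ag]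
          pos_mean_dist[OF J continuous_on_ln_dist[OF snS] cA(1) cg Ag] by auto
      then have "\<bar>pot I s - pot J s\<bar> \<le> I g + J g"
        using cA(2) by linarith
      also have "\<dots> = 20 * \<epsilon> * V s"
        unfolding Ig[OF I] Ig[OF J] V_def by (simp add: algebra_simps)
      finally show ?thesis .
    qed
    \<comment> \<open>Both signs of the absolute value in \<open>bd\<close> give inequalities that
      are linear in the two potentials, so one maximum principle for linear combinations serves
      both.\<close>
    have comb: "a * pot I s + a' * pot J s + a'' \<le> 0"
      if s: "s \<in> K" and fr: "\<And>s. s \<in> frontier K \<Longrightarrow> a * pot I s + a' * pot J s + a'' \<le> 0" for a a' a'' s
    proof (rule weak_maximum_principle[OF K _ _ fr s])
      show "continuous_on K (\<lambda>s. a * pot I s + a' * pot J s + a'')"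
        using continuous_on_subset[OF continuous_on_pot[OF cS I] KnS]
          continuous_on_subset[OF continuous_on_pot[OF cS J] KnS] by (intro continuous_intros)
      fix z and e :: real assume z: "z \<in> interior K" and e: "e > 0"
      define c where "c = complex_of_real (min \<delta> e / 2)"
      have c: "cmod c < \<delta>" "cmod c < e" "c \<noteq> 0"
        using \<delta>(1) e by (auto simp: c_def min_def)
      have "cmod c < cmod (z - w)" if "w \<in> ?S" for w
        using KS[of z w] z interior_subset[of K] c(1) that by (auto intro: order.strict_trans2)
      then have 1: "circle_mean (pot I) z c \<longlonglongrightarrow> pot I z" "circle_mean (pot J) z c \<longlonglongrightarrow> pot J z"
        by (auto intro!: circle_mean_pot_tendsto[OF cS] I J)
      have "(\<lambda>N. a * circle_mean (pot I) z c N + a' * circle_mean (pot J) z c N + a'') \<longlonglongrightarrow>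
          a * pot I z + a' * pot J z + a''"
        by (intro tendsto_intros 1)
      moreover have "\<forall>\<^sub>F N in sequentially. a * circle_mean (pot I) z c N + a' * circle_mean (pot J) z c N + a'' =
          circle_mean (\<lambda>s. a * pot I s + a' * pot J s + a'') z c N"
        by (rule eventually_sequentiallyI[of 1])
          (simp add: circle_mean_add circle_mean_cmult circle_mean_const)
      ultimately have "circle_mean (\<lambda>s. a * pot I s + a' * pot J s + a'') z c \<longlonglongrightarrow>
          a * pot I z + a' * pot J z + a''"
        by (rule Lim_transform_eventually)
      then show "\<exists>c. c \<noteq> 0 \<and> cmod c < e \<and> circle_mean (\<lambda>s. a * pot I s + a' * pot J s + a'') z c \<longlonglongrightarrow>
          a * pot I z + a' * pot J z + a''"
        using c by blast
    qed
    have tK: "t \<in> K" using t interior_subset \<delta>(3) by (auto simp: K_def)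
    have "(1 + 20 * \<epsilon>) * pot I t + (20 * \<epsilon> - 1) * pot J t + (- 20 * \<epsilon> * (2 + 2 * ln L)) \<le> 0"
    proof (rule comb[OF tK])
      fix s assume "s \<in> frontier K"
      from bd[OF this] show "(1 + 20 * \<epsilon>) * pot I s + (20 * \<epsilon> - 1) * pot J s + (- 20 * \<epsilon> * (2 + 2 * ln L)) \<le> 0"
        unfolding abs_le_iff by (simp add: V_def algebra_simps)
    qed
    moreover have "(20 * \<epsilon> - 1) * pot I t + (20 * \<epsilon> + 1) * pot J t + (- 20 * \<epsilon> * (2 + 2 * ln L)) \<le> 0"
    proof (rule comb[OF tK])
      fix s assume "s \<in> frontier K"
      from bd[OF this] show "(20 * \<epsilon> - 1) * pot I s + (20 * \<epsilon> + 1) * pot J s + (- 20 * \<epsilon> * (2 + 2 * ln L)) \<le> 0"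
        unfolding abs_le_iff by (simp add: V_def algebra_simps)
    qed
    ultimately show ?thesis
      unfolding abs_le_iff by (simp add: V_def algebra_simps)
  qed
  \<comment> \<open>\<delta> and \<open>K\<close> vary with \<epsilon>, but \<open>V t\<close> does
    not.\<close>
  have "((\<lambda>\<epsilon>. 20 * \<epsilon> * V t) \<longlongrightarrow> 20 * 0 * V t) (at_right 0)"
    by (intro tendsto_intros)
  then have "\<bar>pot I t - pot J t\<bar> \<le> 20 * 0 * V t"
    using key by (intro tendsto_le[OF trivial_limit_at_right_real _ tendsto_const])
      (auto simp: eventually_at_right_less intro: eventually_mono[OF eventually_at_right_less[of 0]])
  then show ?thesis by simp
qed

text \<open>Within \<delta> of the frontier the exterior approximation applies. Farther away the
  truncation is inactive on the frontier, and ln |z - t| itself qualifies because the potentials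
  agree at \<open>t\<close>, outside \<open>E\<close> by \<open>ext\<close> and inside by
  \<open>pot_eq_interior\<close>.\<close>

lemma log_approx_agree:
  fixes E :: "complex set"
  assumes E: "compact E" "connected (- E)" and I: "pos_mean (frontier E) I" and J: "pos_mean (frontier E) J"
    and ext: "\<And>z. z \<notin> E \<Longrightarrow> pot I z = pot J z" and \<delta>: "\<delta> > 0"
  shows "\<exists>A. agree (frontier E) I J A \<and> (\<forall>z\<in>frontier E.
    \<bar>A z - ln (max (cmod (z - t)) \<delta>)\<bar> \<le> 20 * sqrt (\<delta> / max (cmod (z - t)) \<delta>))"
proof (cases "\<exists>z0\<in>frontier E. cmod (t - z0) \<le> \<delta>")
  case True
  then obtain z0 where "z0 \<in> frontier E" "cmod (t - z0) \<le> \<delta>" by blast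
  from exterior_log_approx_agree[OF E I J ext \<delta> this] show ?thesis by metis
next
  case False
  then have far: "\<delta> < cmod (z - t)" if "z \<in> frontier E" for z
    using that by (force simp: norm_minus_commute)
  then have t: "t \<notin> frontier E" using \<delta> by fastforce
  have "pot I t = pot J t"
  proof (cases "t \<in> E")
    case True
    then have "t \<in> interior E" using t closure_subset by (auto simp: frontier_def)
    then show ?thesis using pot_eq_interior[OF E I J ext] by blast
  qed (rule ext)
  then have "agree (frontier E) I J (\<lambda>z. ln (cmod (z - t)))"
    using agree_ln[OF I J t] by simp
  moreover have "max (cmod (z - t)) \<delta> = cmod (z - t)" if "z \<in> frontier E" for z
    using far[OF that] by simp
  ultimately show ?thesis using \<delta> by (intro exI[of _ "\<lambda>z. ln (cmod (z - t))"]) auto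
qed

text \<open>The mean over one circle is hard to control when \<open>z\<close> is close to that circle. Therefore \<open>M\<close>
  circles of nearly equal radii are averaged, of which at most one is close to \<open>z\<close>.\<close>

lemma agree_circle:
  fixes E :: "complex set"
  assumes E: "compact E" "connected (- E)" and I: "pos_mean (frontier E) I" and J: "pos_mean (frontier E) J"
    and ext: "\<And>z. z \<notin> E \<Longrightarrow> pot I z = pot J z" and r: "r > 0"
  shows "agree (frontier E) I J (\<lambda>z. ln (max (cmod (z - a)) r))"
proof (rule agree_limit[OF I J])
  let ?S = "frontier E"
  show "continuous_on ?S (\<lambda>z. ln (max (cmod (z - a)) r))"
    using r by (intro continuous_intros) (auto simp: max_def)
  fix e :: real assume e: "e > 0"
  obtain b where b: "\<And>w. w \<in> ?S \<Longrightarrow> cmod w \<le> b"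
    using compact_imp_bounded[OF compact_frontier[OF E(1)]] by (auto simp: bounded_iff)
  define B where "B = \<bar>b\<bar> + cmod a + r + 1"
  have B: "B \<ge> 1" "r + 1 \<le> B" "\<And>z. z \<in> ?S \<Longrightarrow> cmod (z - a) \<le> B"
  proof -
    fix z assume "z \<in> ?S"
    then show "cmod (z - a) \<le> B"
      using b[of z] norm_triangle_ineq4[of z a] r by (simp add: B_def)
  qed (use r norm_ge_zero[of a] in \<open>auto simp: B_def\<close>)
  \<comment> \<open>\<open>G M\<close> will bound the error of a good circle, and
    \<open>D + 3 * ln M\<close> the additional error of the bad one, which has weight 1 / M in the
    mean.\<close>
  define D where "D = 20 + ln (2 * B) + ln B + \<bar>ln r\<bar>"
  define G where "G M = 20 * sqrt (2 / M) + 2 * B / M + 1 / M / r" for M :: real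
  have "((\<lambda>M. G M + (D + 3 * ln M) / M) \<longlongrightarrow> 0) at_top"
  proof -
    have 1: "((\<lambda>M::real. sqrt (2 / M)) \<longlongrightarrow> 0) at_top" by real_asymp
    have 2: "((\<lambda>M::real. 1 / M) \<longlongrightarrow> 0) at_top" by real_asymp
    have 3: "((\<lambda>M::real. ln M / M) \<longlongrightarrow> 0) at_top" by real_asymp
    have "((\<lambda>M. 20 * sqrt (2 / M) + (2 * B + 1 / r + D) * (1 / M) + 3 * (ln M / M)) \<longlongrightarrow>
        20 * 0 + (2 * B + 1 / r + D) * 0 + 3 * 0) at_top"
      by (intro tendsto_intros 1 2 3)
    moreover have "G M + (D + 3 * ln M) / M = 20 * sqrt (2 / M) + (2 * B + 1 / r + D) * (1 / M) + 3 * (ln M / M)" for M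
      by (simp add: G_def algebra_simps add_divide_distrib)
    ultimately show ?thesis by simp
  qed
  then have "(\<lambda>M. G (real M) + (D + 3 * ln (real M)) / real M) \<longlonglongrightarrow> 0"
    by (rule filterlim_compose[OF _ filterlim_real_sequentially])
  then have "\<forall>\<^sub>F M in sequentially. G (real M) + (D + 3 * ln (real M)) / real M < e"
    using e by (rule order_tendstoD)
  then have "\<forall>\<^sub>F M in sequentially. G (real M) + (D + 3 * ln (real M)) / real M < e \<and> M \<ge> 2"
    using eventually_ge_at_top[of 2] by eventually_elim auto
  then obtain M :: nat where M: "G M + (D + 3 * ln M) / M < e" "M \<ge> 2"
    unfolding eventually_sequentially by blast
  have M0: "real M > 0" "real M \<ge> 2" using M(2) by auto
  \<comment> \<open>The radii are 1 / M^2 apart and \<eta> is half of this, so at most one circle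
    comes closer than \<eta> to a given z. On the others the truncation error involves \<delta> /
    \<eta> = 2 / M and the sampling error is B / (\<eta> N) = 2 B / M. All radii stay within 1 / M
    of \<open>r\<close>.\<close>
  define N where "N = M ^ 3"
  have N: "N > 0" "real N = real M ^ 3" using M0 by (auto simp: N_def)
  define \<delta> where "\<delta> = 1 / real M ^ 3"
  define \<eta> where "\<eta> = 1 / (2 * real M ^ 2)"
  have \<delta>: "\<delta> > 0" using M0 by (simp add: \<delta>_def)
  have \<eta>: "\<eta> > 0" "\<delta> \<le> \<eta>" "\<delta> / \<eta> = 2 / M" "\<eta> \<le> 1"
  proof -
    show "\<eta> > 0" using M0 by (simp add: \<eta>_def)
    show "\<delta> / \<eta> = 2 / M" using M0 by (simp add: \<delta>_def \<eta>_def power2_eq_square power3_eq_cube)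
    then have "\<delta> = 2 / M * \<eta>" using \<open>\<eta> > 0\<close> by (simp add: field_simps)
    also have "\<dots> \<le> 1 * \<eta>" using M0 \<open>\<eta> > 0\<close> by (intro mult_right_mono) auto
    finally show "\<delta> \<le> \<eta>" by simp
    have "1 \<le> real M ^ 2" using M0 by (intro one_le_power) auto
    then have "1 / (2 * real M ^ 2) \<le> 1 / 1"
      by (intro frac_le) linarith+
    then show "\<eta> \<le> 1" by (simp add: \<eta>_def)
  qed
  define \<rho> where "\<rho> i = r + real i / real M ^ 2" for i :: nat
  have \<rho>: "r \<le> \<rho> i" "\<rho> i \<le> B" "\<rho> i - r \<le> 1 / M" if "i < M" for i
  proof -
    show "r \<le> \<rho> i" using M0 by (simp add: \<rho>_def)
    have "real i / real M ^ 2 \<le> real M / real M ^ 2"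
      using that by (intro divide_right_mono) auto
    also have "\<dots> = 1 / M" using M0 by (simp add: power2_eq_square)
    finally show "\<rho> i - r \<le> 1 / M" by (simp add: \<rho>_def)
    moreover have "1 / real M \<le> 1" using M0 by simp
    ultimately show "\<rho> i \<le> B" using B(2) by linarith
  qed
  define t where "t i k = a + complex_of_real (\<rho> i) * cis (2 * pi * real k / real N)" for i k
  have "\<exists>A. agree ?S I J A \<and> (\<forall>z\<in>?S. \<bar>A z - ln (max (cmod (z - t i k)) \<delta>)\<bar>
      \<le> 20 * sqrt (\<delta> / max (cmod (z - t i k)) \<delta>))" for i k
    by (rule log_approx_agree[OF E I J ext \<delta>])
  then obtain A where A: "\<And>i k. agree ?S I J (A i k)"
    "\<And>i k z. z \<in> ?S \<Longrightarrow> \<bar>A i k z - ln (max (cmod (z - t i k)) \<delta>)\<bar>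
      \<le> 20 * sqrt (\<delta> / max (cmod (z - t i k)) \<delta>)"
    by metis
  define T where "T i z = 1 / N * (\<Sum>k<N. A i k z)" for i z
  have Tdiff: "\<bar>T i z - (\<Sum>k<N. c k) / N\<bar> \<le> y" if "\<And>k. k < N \<Longrightarrow> \<bar>A i k z - c k\<bar> \<le> y" for i z c y
  proof -
    have "\<bar>\<Sum>k<N. A i k z - c k\<bar> \<le> (\<Sum>k<N. y)"
      using that by (intro order.trans[OF sum_abs] sum_mono) auto
    moreover have "T i z - (\<Sum>k<N. c k) / N = (\<Sum>k<N. A i k z - c k) / N"
      by (simp add: T_def sum_subtractf diff_divide_distrib)
    ultimately show ?thesis using N(1) by (simp add: divide_le_eq mult.commute)
  qed
  define bad where "bad z = {i. i < M \<and> \<bar>cmod (z - a) - \<rho> i\<bar> < \<eta>}" for z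
  have card_bad: "card (bad z) \<le> 1" for z
  proof -
    have "i = j" if "i \<in> bad z" "j \<in> bad z" for i j
    proof (rule ccontr)
      assume "i \<noteq> j"
      then have "1 \<le> \<bar>real i - real j\<bar>" by linarith
      then have "1 / real M ^ 2 \<le> \<bar>real i - real j\<bar> / real M ^ 2"
        by (intro divide_right_mono) auto
      also have "\<dots> = \<bar>\<rho> i - \<rho> j\<bar>"
        by (simp add: \<rho>_def diff_divide_distrib[symmetric] abs_divide)
      also have "\<dots> < 2 * \<eta>" using that by (auto simp: bad_def abs_less_iff)
      finally show False using M0 by (simp add: \<eta>_def)
    qed
    then show ?thesis by (simp add: card_le_Suc0_iff_eq bad_def)
  qed
  have est: "\<bar>T i z - ln (max (cmod (z - a)) r)\<bar> \<le> G M + (if i \<in> bad z then D + 3 * ln M else 0)"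
    if i: "i < M" and z: "z \<in> ?S" for i z
  proof -
    have G0: "G M \<ge> 0" using M0 B(1) r by (simp add: G_def)
    have nt: "\<bar>cmod (z - a) - \<rho> i\<bar> \<le> cmod (z - t i k)" "cmod (z - t i k) \<le> cmod (z - a) + \<rho> i" for k
    proof -
      have n: "cmod (t i k - a) = \<rho> i" using \<rho>(1)[OF i] r by (simp add: t_def norm_mult)
      then show "\<bar>cmod (z - a) - \<rho> i\<bar> \<le> cmod (z - t i k)"
        using norm_triangle_ineq3[of "z - a" "t i k - a"] by simp
      show "cmod (z - t i k) \<le> cmod (z - a) + \<rho> i"
        using n norm_triangle_ineq4[of "z - a" "t i k - a"] by simp
    qed
    show ?thesis
    proof (cases "i \<in> bad z")
      case False
      then have far: "\<eta> \<le> \<bar>cmod (z - a) - \<rho> i\<bar>" using i by (simp add: bad_def)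
      define mx where "mx = max (cmod (z - a)) (\<rho> i)"
      define mn where "mn = min (cmod (z - a)) (\<rho> i)"
      have mx: "mx > 0" "mx \<le> B" "mn \<le> mx - \<eta>"
        using \<rho>[OF i] r B(3)[OF z] far by (auto simp: mx_def mn_def)
      have q: "mn \<le> (1 - \<eta> / B) * mx"
      proof -
        have "\<eta> / B * mx \<le> \<eta> / B * B" using mx \<eta> B(1) by (intro mult_left_mono) auto
        then show ?thesis using mx(3) B(1) by (simp add: algebra_simps)
      qed
      have q01: "1 - \<eta> / B < 1" "0 \<le> 1 - \<eta> / B" using \<eta> B(1) by (auto simp: divide_le_eq)
      have n\<rho>: "cmod (complex_of_real (\<rho> i)) = \<rho> i" using \<rho>(1)[OF i] r by simp
      have "\<bar>(\<Sum>k<N. ln (cmod (z - a - complex_of_real (\<rho> i) * cis (2 * pi * real k / real N)))) / N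
           - ln (max (cmod (z - a)) (cmod (complex_of_real (\<rho> i))))\<bar> \<le> 1 / ((1 - (1 - \<eta> / B)) * N)"
      proof (rule mean_ln_circle[OF N(1) _ q01])
        show "min (cmod (z - a)) (cmod (complex_of_real (\<rho> i))) \<le> (1 - \<eta> / B) * max (cmod (z - a)) (cmod (complex_of_real (\<rho> i)))"
          using q unfolding n\<rho> mx_def mn_def .
        show "0 < max (cmod (z - a)) (cmod (complex_of_real (\<rho> i)))"
          using mx(1) unfolding n\<rho> mx_def .
      qed
      moreover have "1 / ((1 - (1 - \<eta> / B)) * N) = 2 * B / M"
        using M0 B(1) by (simp add: \<eta>_def N power2_eq_square power3_eq_cube)
      moreover have "z - a - complex_of_real (\<rho> i) * cis (2 * pi * real k / real N) = z - t i k" for k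
        by (simp add: t_def)
      ultimately have 1: "\<bar>(\<Sum>k<N. ln (cmod (z - t i k))) / N - ln mx\<bar> \<le> 2 * B / M"
        by (simp only: n\<rho> mx_def)
      have "\<bar>A i k z - ln (cmod (z - t i k))\<bar> \<le> 20 * sqrt (2 / M)" for k
      proof -
        have d: "\<eta> \<le> cmod (z - t i k)" using nt(1)[of k] far by linarith
        then have "max (cmod (z - t i k)) \<delta> = cmod (z - t i k)" using \<eta> by simp
        then have "\<bar>A i k z - ln (cmod (z - t i k))\<bar> \<le> 20 * sqrt (\<delta> / cmod (z - t i k))"
          using A(2)[OF z, of i k] by simp
        also have "\<delta> / cmod (z - t i k) \<le> \<delta> / \<eta>"
          using d \<eta>(1) \<delta> by (intro divide_left_mono mult_pos_pos) auto
        finally show ?thesis using \<eta>(3) by simp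
      qed
      then have 2: "\<bar>T i z - (\<Sum>k<N. ln (cmod (z - t i k))) / N\<bar> \<le> 20 * sqrt (2 / M)"
        by (rule Tdiff)
      have "\<bar>ln mx - ln (max (cmod (z - a)) r)\<bar> \<le> \<bar>mx - max (cmod (z - a)) r\<bar> / r"
        using r \<rho>(1)[OF i] by (intro abs_ln_diff_le) (auto simp: mx_def)
      also have "\<dots> \<le> 1 / M / r"
        using r \<rho>(1,3)[OF i] by (intro divide_right_mono) (auto simp: mx_def max_def)
      finally show ?thesis using 1 2 False by (simp add: G_def)
    next
      case True
      \<comment> \<open>On the bad circle a crude bound is enough: truncation at \<delta> = M^(-3)
        keeps the logarithm above -3 ln M.\<close>
      define c where "c k = ln (max (cmod (z - t i k)) \<delta>)" for k
      have "\<bar>A i k z - 0\<bar> \<le> 20 + 3 * ln M + ln (2 * B)" for k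
      proof -
        have "\<delta> / max (cmod (z - t i k)) \<delta> \<le> 1" using \<delta> by simp
        then have "sqrt (\<delta> / max (cmod (z - t i k)) \<delta>) \<le> 1" by simp
        then have "\<bar>A i k z - c k\<bar> \<le> 20" using A(2)[OF z, of i k] unfolding c_def by linarith
        moreover have "c k \<le> ln (2 * B)"
          unfolding c_def using nt(2)[of k] \<rho>(2)[OF i] B(1) B(3)[OF z] \<delta> \<eta>(2,4)
          by (intro ln_mono) auto
        moreover have "- (3 * ln M) \<le> c k"
        proof -
          have "- (3 * ln M) = ln \<delta>" using M0 by (simp add: \<delta>_def ln_div ln_realpow)
          also have "\<dots> \<le> c k" unfolding c_def using \<delta> by (intro ln_mono) auto
          finally show ?thesis .
        qed
        moreover have "0 \<le> ln (2 * B)" "0 \<le> ln M" using B(1) M0 by auto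
        ultimately show ?thesis by linarith
      qed
      then have "\<bar>T i z - (\<Sum>k<N. 0) / N\<bar> \<le> 20 + 3 * ln M + ln (2 * B)"
        by (rule Tdiff)
      moreover have "\<bar>ln (max (cmod (z - a)) r)\<bar> \<le> ln B + \<bar>ln r\<bar>"
      proof -
        have "ln (max (cmod (z - a)) r) \<le> ln B"
          using B(2) B(3)[OF z] r by (intro ln_mono) auto
        moreover have "ln r \<le> ln (max (cmod (z - a)) r)"
          using r by (intro ln_mono) auto
        moreover have "0 \<le> ln B" using B(1) by simp
        ultimately show ?thesis by linarith
      qed
      ultimately have "\<bar>T i z - ln (max (cmod (z - a)) r)\<bar> \<le> D + 3 * ln M"
        unfolding D_def by (simp add: abs_le_iff)
      then show ?thesis using True G0 by simp
    qed
  qed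
  define \<psi> where "\<psi> z = 1 / M * (\<Sum>i<M. T i z)" for z
  have "agree ?S I J \<psi>"
    unfolding \<psi>_def T_def by (intro agree_cmult[OF I J] agree_sum[OF I J] A(1))
  moreover have "\<bar>ln (max (cmod (z - a)) r) - \<psi> z\<bar> \<le> e" if z: "z \<in> ?S" for z
  proof -
    define c where "c = ln (max (cmod (z - a)) r)"
    have D0: "0 \<le> D + 3 * ln M" using B(1) M0 by (simp add: D_def)
    have "\<bar>\<Sum>i<M. T i z - c\<bar> \<le> (\<Sum>i<M. G M + (if i \<in> bad z then D + 3 * ln M else 0))"
      using est z by (intro order.trans[OF sum_abs] sum_mono) (auto simp: c_def)
    also have "\<dots> = M * G M + card (bad z) * (D + 3 * ln M)"
    proof -
      have "(\<Sum>i<M. if i \<in> bad z then D + 3 * ln M else 0) = (\<Sum>i\<in>bad z. D + 3 * ln M)"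
        by (rule sum.mono_neutral_cong_right) (auto simp: bad_def)
      then show ?thesis by (simp add: sum.distrib)
    qed
    also have "\<dots> \<le> M * G M + 1 * (D + 3 * ln M)"
      using card_bad[of z] D0 by (intro add_left_mono mult_right_mono) auto
    finally have "\<bar>\<Sum>i<M. T i z - c\<bar> / M \<le> (M * G M + 1 * (D + 3 * ln M)) / M"
      by (rule divide_right_mono) simp
    also have "\<dots> = G M + (D + 3 * ln M) / M" using M0 by (simp add: field_simps)
    also have "\<dots> \<le> e" using M(1) by simp
    finally have "\<bar>\<Sum>i<M. T i z - c\<bar> / M \<le> e" .
    moreover have "\<psi> z - c = (\<Sum>i<M. T i z - c) / M"
      using M0 by (simp add: \<psi>_def sum_subtractf diff_divide_distrib)
    ultimately show ?thesis by (simp add: c_def abs_minus_commute)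
  qed
  ultimately show "\<exists>\<psi>. agree ?S I J \<psi> \<and> (\<forall>z\<in>?S. \<bar>ln (max (cmod (z - a)) r) - \<psi> z\<bar> \<le> e)"
    by blast
qed

text \<open>Each \<open>\<rho> i\<close> is a ramp, of any shape, from 0 to 1 between (i + 1) h and
  (i + 2) h. At any x all ramps but one are constant, so the sum telescopes up to one increment of
  \<phi>; that increment and the variation of \<phi> within one step cost \<open>e\<close> each. The
  first ramp starts at h rather than 0 because the ramps will come from logarithms of positive
  radii.\<close>

lemma piecewise_linear_approx:
  fixes \<phi> :: "real \<Rightarrow> real" and \<rho> :: "nat \<Rightarrow> real \<Rightarrow> real"
  assumes h: "h > 0" and mod: "\<And>x y. \<lbrakk>0 \<le> x; 0 \<le> y; \<bar>x - y\<bar> \<le> h; x \<le> (real m + 1) * h; y \<le> (real m + 1) * h\<rbrakk> \<Longrightarrow> \<bar>\<phi> x - \<phi> y\<bar> \<le> e"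
    and \<rho>: "\<And>i x. x \<le> (real i + 1) * h \<Longrightarrow> \<rho> i x = 0" "\<And>i x. x \<ge> (real i + 2) * h \<Longrightarrow> \<rho> i x = 1"
      "\<And>i x. 0 \<le> \<rho> i x \<and> \<rho> i x \<le> 1"
    and x: "0 \<le> x" "x \<le> (real m + 1) * h"
  shows "\<bar>\<phi> h + (\<Sum>i<m. (\<phi> ((real i + 2) * h) - \<phi> ((real i + 1) * h)) * \<rho> i x) - \<phi> x\<bar> \<le> 2 * e"
proof -
  define p where "p n x = \<phi> h + (\<Sum>i<n. (\<phi> ((real i + 2) * h) - \<phi> ((real i + 1) * h)) * \<rho> i x)" for n x
  have e0: "0 \<le> e" using mod[of 0 0] h by simp
  have "n \<le> m \<Longrightarrow> (\<forall>x. 0 \<le> x \<longrightarrow> x \<le> (real n + 1) * h \<longrightarrow> \<bar>p n x - \<phi> x\<bar> \<le> 2 * e) \<and>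
      (\<forall>x. x \<ge> (real n + 1) * h \<longrightarrow> p n x = \<phi> ((real n + 1) * h))" for n
  proof (induction n)
    case 0
    have "\<bar>\<phi> h - \<phi> x\<bar> \<le> 2 * e" if "0 \<le> x" "x \<le> h" for x
    proof -
      have "1 * h \<le> (real m + 1) * h" using h by (intro mult_right_mono) auto
      then have "\<bar>\<phi> h - \<phi> x\<bar> \<le> e" using that h by (intro mod) linarith+
      then show ?thesis using e0 by linarith
    qed
    then show ?case by (simp add: p_def)
  next
    case (Suc n)
    then have IH: "\<And>x. 0 \<le> x \<Longrightarrow> x \<le> (real n + 1) * h \<Longrightarrow> \<bar>p n x - \<phi> x\<bar> \<le> 2 * e"
      "\<And>x. x \<ge> (real n + 1) * h \<Longrightarrow> p n x = \<phi> ((real n + 1) * h)" by auto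
    define \<Delta> where "\<Delta> = \<phi> ((real n + 2) * h) - \<phi> ((real n + 1) * h)"
    have step: "p (Suc n) x = p n x + \<Delta> * \<rho> n x" for x by (simp add: p_def \<Delta>_def)
    have nm: "(real n + 2) * h \<le> (real m + 1) * h"
      using Suc.prems h by (intro mult_right_mono) auto
    have XY: "(real n + 2) * h = (real n + 1) * h + h" "0 \<le> (real n + 1) * h"
      using h by (simp_all add: algebra_simps)
    have "\<bar>\<Delta>\<bar> \<le> e" unfolding \<Delta>_def using h nm XY by (intro mod) linarith+
    have "\<bar>p (Suc n) x - \<phi> x\<bar> \<le> 2 * e" if x: "0 \<le> x" "x \<le> (real n + 2) * h" for x
    proof (cases "x \<le> (real n + 1) * h")
      case True
      then show ?thesis using IH(1) x by (simp add: step \<rho>(1))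
    next
      case False
      have "\<bar>\<phi> ((real n + 1) * h) - \<phi> x\<bar> \<le> e"
        using x False h nm XY by (intro mod) linarith+
      moreover have "\<bar>\<Delta> * \<rho> n x\<bar> \<le> e * 1"
        unfolding abs_mult using \<open>\<bar>\<Delta>\<bar> \<le> e\<close> \<rho>(3)[of n x] e0 by (intro mult_mono) auto
      ultimately show ?thesis using IH(2)[of x] False by (simp add: step)
    qed
    moreover have "p (Suc n) x = \<phi> ((real n + 2) * h)" if x: "x \<ge> (real n + 2) * h" for x
    proof -
      have "(real n + 1) * h \<le> x" using x h XY by linarith
      then show ?thesis using IH(2)[of x] x by (simp add: step \<rho>(2) \<Delta>_def)
    qed
    ultimately show ?case by (simp add: add.commute)
  qed
  then show ?thesis using x unfolding p_def by blast
qed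

text \<open>For radii u < u' the difference of ln max (x, u) and ln max (x, u') is constant below u
  and above u'. Normalized, it is a ramp in x = |z - a| to which \<open>agree_circle\<close>
  applies.\<close>

lemma agree_radial:
  fixes E :: "complex set" and \<phi> :: "real \<Rightarrow> real"
  assumes E: "compact E" "connected (- E)" and I: "pos_mean (frontier E) I" and J: "pos_mean (frontier E) J"
    and ext: "\<And>z. z \<notin> E \<Longrightarrow> pot I z = pot J z" and \<phi>: "continuous_on UNIV \<phi>"
  shows "agree (frontier E) I J (\<lambda>z. \<phi> (cmod (z - a)))"
proof (rule agree_limit[OF I J])
  let ?S = "frontier E"
  show "continuous_on ?S (\<lambda>z. \<phi> (cmod (z - a)))"
    by (intro continuous_on_compose2[OF \<phi>] continuous_intros) auto
  fix e :: real assume e: "e > 0"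
  obtain b where b: "\<And>w. w \<in> ?S \<Longrightarrow> cmod w \<le> b"
    using compact_imp_bounded[OF compact_frontier[OF E(1)]] by (auto simp: bounded_iff)
  define B where "B = \<bar>b\<bar> + cmod a + 1"
  have B: "B > 0" "\<And>z. z \<in> ?S \<Longrightarrow> cmod (z - a) \<le> B"
  proof -
    show "B > 0" using norm_ge_zero[of a] unfolding B_def by linarith
    fix z assume "z \<in> ?S"
    then show "cmod (z - a) \<le> B"
      using b[of z] norm_triangle_ineq4[of z a] by (simp add: B_def)
  qed
  have "uniformly_continuous_on {0..B} \<phi>"
    by (intro compact_uniformly_continuous continuous_on_subset[OF \<phi>]) auto
  then obtain d where d: "d > 0" "\<And>x y. \<lbrakk>x \<in> {0..B}; y \<in> {0..B}; dist y x < d\<rbrakk> \<Longrightarrow> dist (\<phi> y) (\<phi> x) < e / 2"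
    unfolding uniformly_continuous_on_def using e by (meson half_gt_zero)
  obtain m :: nat where m: "B / d < real m + 1"
    using reals_Archimedean2[of "B / d"] by (metis add.commute less_add_one order.strict_trans)
  define h where "h = B / (real m + 1)"
  have h: "h > 0" "(real m + 1) * h = B" "h < d"
    using B(1) d(1) m by (auto simp: h_def field_simps)
  define u where "u i = (real i + 1) * h" for i :: nat
  have u: "u i > 0" "u i < u (Suc i)" "u (Suc i) = (real i + 2) * h" for i
    using h(1) by (auto simp: u_def algebra_simps add_pos_nonneg)
  define \<rho> where "\<rho> i x = 1 / (ln (u (Suc i)) - ln (u i)) *
      (ln (max x (u i)) - ln (max x (u (Suc i))) + (ln (u (Suc i)) - ln (u i)))" for i x
  have lnu: "ln (u i) < ln (u (Suc i))" for i using u[of i] by simp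
  have \<rho>: "x \<le> (real i + 1) * h \<Longrightarrow> \<rho> i x = 0" "x \<ge> (real i + 2) * h \<Longrightarrow> \<rho> i x = 1"
    "0 \<le> \<rho> i x \<and> \<rho> i x \<le> 1" for i x
  proof -
    show "x \<le> (real i + 1) * h \<Longrightarrow> \<rho> i x = 0"
      using u(2)[of i] by (simp add: \<rho>_def u_def[symmetric] max_absorb2)
    show "x \<ge> (real i + 2) * h \<Longrightarrow> \<rho> i x = 1"
      using u(2)[of i] lnu[of i] by (simp add: \<rho>_def u(3)[symmetric] max_absorb1)
    have "ln (max x (u i)) \<le> ln (max x (u (Suc i)))"
      using u[of i] by (intro ln_mono) auto
    moreover have "ln (max x (u (Suc i))) - ln (max x (u i)) \<le> ln (u (Suc i)) - ln (u i)"
    proof (cases "x \<ge> u (Suc i)")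
      case False
      then have "max x (u (Suc i)) = u (Suc i)" by simp
      moreover have "ln (u i) \<le> ln (max x (u i))" using u(1)[of i] by (intro ln_mono) auto
      ultimately show ?thesis by simp
    qed (use u(2)[of i] lnu[of i] in auto)
    ultimately show "0 \<le> \<rho> i x \<and> \<rho> i x \<le> 1"
      using lnu[of i] by (auto simp: \<rho>_def divide_le_eq)
  qed
  have ag: "agree ?S I J (\<lambda>z. \<rho> i (cmod (z - a)))" for i
    unfolding \<rho>_def using u(1)
    by (intro agree_cmult[OF I J] agree_add[OF I J] agree_diff[OF I J] agree_const[OF I J] agree_circle[OF E I J ext])
  let ?\<psi> = "\<lambda>z. \<phi> h + (\<Sum>i<m. (\<phi> ((real i + 2) * h) - \<phi> ((real i + 1) * h)) * \<rho> i (cmod (z - a)))"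
  have "agree ?S I J ?\<psi>"
    by (intro agree_add[OF I J] agree_sum[OF I J] agree_cmult[OF I J] agree_const[OF I J] ag)
  moreover have "\<bar>\<phi> (cmod (z - a)) - ?\<psi> z\<bar> \<le> e" if z: "z \<in> ?S" for z
  proof -
    have "\<bar>?\<psi> z - \<phi> (cmod (z - a))\<bar> \<le> 2 * (e / 2)"
    proof (rule piecewise_linear_approx[OF h(1) _ \<rho>])
      fix x y :: real
      assume "0 \<le> x" "0 \<le> y" "\<bar>x - y\<bar> \<le> h" "x \<le> (real m + 1) * h" "y \<le> (real m + 1) * h"
      then have "x \<in> {0..B}" "y \<in> {0..B}" "dist x y < d"
        unfolding h(2) using h(3) by (auto simp: dist_real_def)
      then have "dist (\<phi> x) (\<phi> y) < e / 2" by (intro d(2))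
      then show "\<bar>\<phi> x - \<phi> y\<bar> \<le> e / 2" by (simp add: dist_real_def)
    qed (use B(2)[OF z] in \<open>simp_all add: h(2)\<close>)
    then show ?thesis by (simp add: abs_minus_commute)
  qed
  ultimately show "\<exists>\<psi>. agree ?S I J \<psi> \<and> (\<forall>z\<in>?S. \<bar>\<phi> (cmod (z - a)) - \<psi> z\<bar> \<le> e)"
    by blast
qed

text \<open>The linear span of Gaussians; the coefficient \<open>c\<close> replaces a rule for
  scalar multiples, and s = 0 provides the constants.\<close>

inductive gauss_span :: "(complex \<Rightarrow> real) \<Rightarrow> bool" where
  base: "s \<ge> 0 \<Longrightarrow> gauss_span (\<lambda>z. c * exp (- s * (cmod (z - a))\<^sup>2))"
| add: "gauss_span f \<Longrightarrow> gauss_span g \<Longrightarrow> gauss_span (\<lambda>z. f z + g z)"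

text \<open>Completing the square in each coordinate, at the weighted mean of the two centres. It is
  the reason why products of Gaussians are Gaussians up to a constant factor.\<close>

lemma gauss_product:
  assumes "s + s' > 0"
  shows "s * (cmod (z - a))\<^sup>2 + s' * (cmod (z - a'))\<^sup>2 =
    (s + s') * (cmod (z - (of_real s * a + of_real s' * a') / of_real (s + s')))\<^sup>2 + s * s' / (s + s') * (cmod (a - a'))\<^sup>2"
proof -
  have *: "s * (x - y)\<^sup>2 + s' * (x - y')\<^sup>2 = (s + s') * (x - (s * y + s' * y') / (s + s'))\<^sup>2 + s * s' / (s + s') * (y - y')\<^sup>2"
    for x y y' :: real
  proof -
    define c where "c = (s * y + s' * y') / (s + s')"
    define k where "k = s * s' / (s + s')"
    have "(s + s') * c = s * y + s' * y'" "(s + s') * k = s * s'" using assms by (auto simp: c_def k_def)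
    then have "(s + s') * (s * (x - y)\<^sup>2 + s' * (x - y')\<^sup>2) = (s + s') * ((s + s') * (x - c)\<^sup>2 + k * (y - y')\<^sup>2)"
      by algebra
    then show ?thesis using assms by (simp add: c_def k_def)
  qed
  have Re: "Re ((of_real s * a + of_real s' * a') / of_real (s + s')) = (s * Re a + s' * Re a') / (s + s')"
    and Im: "Im ((of_real s * a + of_real s' * a') / of_real (s + s')) = (s * Im a + s' * Im a') / (s + s')"
    by (simp_all del: of_real_add)
  show ?thesis
    using *[of "Re z" "Re a" "Re a'"] *[of "Im z" "Im a" "Im a'"]
    unfolding cmod_power2 minus_complex.sel Re Im by (simp add: algebra_simps)
qed

lemma gauss_span_mult_base:
  assumes "s \<ge> 0" "s' \<ge> 0"
  shows "gauss_span (\<lambda>z. (c * exp (- s * (cmod (z - a))\<^sup>2)) * (c' * exp (- s' * (cmod (z - a'))\<^sup>2)))"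
proof (cases "s + s' > 0")
  case True
  define b where "b = (of_real s * a + of_real s' * a') / of_real (s + s')"
  have "(c * exp (- s * (cmod (z - a))\<^sup>2)) * (c' * exp (- s' * (cmod (z - a'))\<^sup>2)) =
      (c * c' * exp (- (s * s' / (s + s') * (cmod (a - a'))\<^sup>2))) * exp (- (s + s') * (cmod (z - b))\<^sup>2)" for z
  proof -
    have "exp (- s * (cmod (z - a))\<^sup>2) * exp (- s' * (cmod (z - a'))\<^sup>2) =
        exp (- (s * (cmod (z - a))\<^sup>2 + s' * (cmod (z - a'))\<^sup>2))"
      by (simp add: exp_add[symmetric])
    also have "\<dots> = exp (- (s * s' / (s + s') * (cmod (a - a'))\<^sup>2)) * exp (- (s + s') * (cmod (z - b))\<^sup>2)"
      unfolding gauss_product[OF True] b_def[symmetric] by (simp add: exp_add[symmetric] algebra_simps)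
    finally show ?thesis by (simp add: mult.assoc mult.left_commute)
  qed
  then show ?thesis using base[of "s + s'"] assms by (simp only: add_nonneg_nonneg)
next
  case False
  then have "s = 0" "s' = 0" using assms by auto
  then show ?thesis using base[of 0 "c * c'" 0] by simp
qed

lemma gauss_span_mult: "gauss_span f \<Longrightarrow> gauss_span g \<Longrightarrow> gauss_span (\<lambda>z. f z * g z)"
proof (induction f rule: gauss_span.induct)
  case (base s c a)
  show ?case using base(2)
  proof (induction g rule: gauss_span.induct)
    case (base s' c' a')
    show ?case by (rule gauss_span_mult_base) fact+
  next
    case (add f g)
    show ?case using gauss_span.add[OF add.IH] by (simp add: distrib_left)
  qed
next
  case (add f f')
  then show ?case using gauss_span.add[of "\<lambda>z. f z * g z" "\<lambda>z. f' z * g z"] by (simp add: distrib_right)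
qed

text \<open>This is the Walsh-Lebesgue theorem in dual form: on the boundary of a compact set with connected
  complement the functions \<open>ln |z - \<cdot>|\<close>, \<open>z \<notin> E\<close>, span a dense space.\<close>

lemma pos_mean_eq_if_pot_eq_exterior:
  fixes E :: "complex set"
  assumes E: "compact E" "connected (- E)" and I: "pos_mean (frontier E) I" and J: "pos_mean (frontier E) J"
    and ext: "\<And>z. z \<notin> E \<Longrightarrow> pot I z = pot J z" and \<phi>: "continuous_on (frontier E) \<phi>"
  shows "I \<phi> = J \<phi>"
proof -
  let ?S = "frontier E"
  have gauss: "agree ?S I J f" if "gauss_span f" for f
    using that
  proof induction
    case (base s c a)
    show ?case
      by (rule agree_radial[OF E I J ext, of "\<lambda>x. c * exp (- s * x\<^sup>2)" a]) (auto intro!: continuous_intros)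
  qed (rule agree_add[OF I J])
  interpret function_ring_on "Collect gauss_span" ?S
  proof
    show "compact ?S" using E(1) by (rule compact_frontier)
    show "(\<lambda>_. c) \<in> Collect gauss_span" for c
      using base[of 0 c 0] by simp
    fix x y :: complex assume xy: "x \<noteq> y"
    have "(cmod (y - x))\<^sup>2 > 0" using xy by simp
    then have "1 * exp (- 1 * (cmod (y - x))\<^sup>2) \<noteq> 1 * exp (- 1 * (cmod (x - x))\<^sup>2)" by simp
    then show "\<exists>f\<in>Collect gauss_span. f x \<noteq> f y"
      using base[of 1 1 x] by (intro bexI[of _ "\<lambda>z. 1 * exp (- 1 * (cmod (z - x))\<^sup>2)"]) auto
  qed (use gauss in \<open>auto simp: agree_def intro: gauss_span.add gauss_span_mult\<close>)
  have "agree ?S I J \<phi>"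
  proof (rule agree_limit[OF I J \<phi>])
    fix e :: real assume "e > 0"
    then obtain g where "gauss_span g" "\<forall>x\<in>?S. \<bar>\<phi> x - g x\<bar> < e"
      using Stone_Weierstrass_basic[OF \<phi>] by blast
    then show "\<exists>\<psi>. agree ?S I J \<psi> \<and> (\<forall>x\<in>?S. \<bar>\<phi> x - \<psi> x\<bar> \<le> e)"
      using gauss by (intro exI[of _ g]) auto
  qed
  then show ?thesis by (simp add: agree_def)
qed

subsection \<open>Logarithmic potentials of measures\<close>

lemma set_integrable_continuous_on_prob:
  fixes \<phi> :: "complex \<Rightarrow> real"
  assumes "compact S" "\<nu> \<in> prob_measures_on S" "continuous_on S \<phi>"
  shows "set_integrable \<nu> S \<phi>"
proof -
  interpret prob_space \<nu> using assms(2) by (simp add: prob_measures_on_def)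
  have sets[measurable_cong]: "sets \<nu> = sets borel" using assms(2) by (simp add: prob_measures_on_def)
  have "bounded (\<phi> ` S)" using assms by (intro compact_imp_bounded compact_continuous_image)
  then obtain B where B: "\<And>x. x \<in> S \<Longrightarrow> \<bar>\<phi> x\<bar> \<le> B" by (auto simp: bounded_iff)
  have "(\<lambda>x. indicator S x *\<^sub>R \<phi> x) \<in> borel_measurable borel"
    using assms(3) borel_closed[OF compact_imp_closed[OF assms(1)]]
    by (intro borel_measurable_continuous_on_indicator)
  then have "(\<lambda>x. indicator S x *\<^sub>R \<phi> x) \<in> borel_measurable \<nu>" by simp
  then show ?thesis
    unfolding set_integrable_def
    by (intro integrable_const_bound[of _ "\<bar>B\<bar>"] AE_I2) (use B in \<open>force simp: indicator_def\<close>)+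
qed

lemma AE_prob_measures_on:
  assumes "compact S" "\<nu> \<in> prob_measures_on S"
  shows "AE x in \<nu>. x \<in> S"
proof (rule AE_I)
  have "sets \<nu> = sets borel" using assms(2) by (simp add: prob_measures_on_def)
  then show "- S \<in> sets \<nu>" using compact_imp_closed[OF assms(1)] by (simp add: borel_open open_Compl)
  show "{x \<in> space \<nu>. x \<notin> S} \<subseteq> - S" by auto
qed (use assms(2) in \<open>simp add: prob_measures_on_def\<close>)

lemma pos_mean_set_integral:
  assumes S: "compact S" and \<nu>: "\<nu> \<in> prob_measures_on S"
  shows "pos_mean S (\<lambda>\<phi>. LINT z:S|\<nu>. \<phi> z)"
proof -
  interpret prob_space \<nu> using \<nu> by (simp add: prob_measures_on_def)
  have sets: "sets \<nu> = sets borel" using \<nu> by (simp add: prob_measures_on_def)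
  have "(LINT z:S|\<nu>. (1::real)) = 1"
  proof -
    have "space \<nu> = UNIV" using sets_eq_imp_space_eq[OF sets] by simp
    then have "(LINT z:S|\<nu>. (1::real)) = prob S"
      using sets borel_compact[OF S] by (simp add: set_lebesgue_integral_def)
    also have "prob S = 1"
      using AE_prob_measures_on[OF S \<nu>] sets borel_compact[OF S] by (subst prob_eq_1) auto
    finally show ?thesis .
  qed
  then show ?thesis
    unfolding pos_mean_def
    using set_integrable_continuous_on_prob[OF S \<nu>]
    by (auto intro: set_integral_add set_integral_mono)
qed

text \<open>Connects weak convergence, which integrates over \<open>E\<close>, with functionals on
  the boundary.\<close>

lemma set_integral_subset_carrier:
  fixes \<phi> :: "complex \<Rightarrow> real"
  assumes S: "compact S" "S \<subseteq> E" "compact E" and \<nu>: "\<nu> \<in> prob_measures_on S" and \<phi>: "continuous_on E \<phi>"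
  shows "(LINT z:E|\<nu>. \<phi> z) = (LINT z:S|\<nu>. \<phi> z)"
  unfolding set_lebesgue_integral_def
proof (rule integral_cong_AE)
  have sets: "sets \<nu> = sets borel" using \<nu> by (simp add: prob_measures_on_def)
  have m: "(\<lambda>x. indicator A x *\<^sub>R \<phi> x) \<in> borel_measurable \<nu>" if "compact A" "A \<subseteq> E" for A
    using that \<phi> borel_measurable_continuous_on_indicator[of A \<phi>] continuous_on_subset[OF \<phi>] compact_imp_closed sets
    by (metis borel_closed measurable_cong_sets)
  show "(\<lambda>x. indicator E x *\<^sub>R \<phi> x) \<in> borel_measurable \<nu>" "(\<lambda>x. indicator S x *\<^sub>R \<phi> x) \<in> borel_measurable \<nu>"
    using m S by auto
  show "AE x in \<nu>. indicator E x *\<^sub>R \<phi> x = indicator S x *\<^sub>R \<phi> x"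
    using AE_prob_measures_on[OF S(1) \<nu>] by eventually_elim (use S in auto)
qed

text \<open>The potential of the kernel cut off at height k, that is, of min (- ln |z - t|,
  k).\<close>

abbreviation trunc_pot :: "complex set \<Rightarrow> complex measure \<Rightarrow> nat \<Rightarrow> complex \<Rightarrow> real" where
  "trunc_pot S \<mu> k z \<equiv> (LINT t:S|\<mu>. - ln (max (cmod (z - t)) (exp (- real k))))"

text \<open>Monotone convergence handles the positive part of the kernel. The negative part is
  continuous on the compact set \<open>S\<close>, so its integral is finite and can be subtracted
  inside the supremum.\<close>

lemma log_potential_eq_SUP:
  assumes S: "compact S" and \<mu>: "\<mu> \<in> prob_measures_on S"
  shows "log_potential \<mu> z = (SUP k. ereal (trunc_pot S \<mu> k z))"
proof -
  interpret prob_space \<mu> using \<mu> by (simp add: prob_measures_on_def)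
  have sets[measurable_cong]: "sets \<mu> = sets borel" using \<mu> by (simp add: prob_measures_on_def)
  have mean: "pos_mean S (\<lambda>\<phi>. LINT z:S|\<mu>. \<phi> z)" by (rule pos_mean_set_integral[OF S \<mu>])
  have nn: "(\<integral>\<^sup>+ t. ennreal (\<phi> t) \<partial>\<mu>) = ennreal (LINT t:S|\<mu>. \<phi> t)"
    if c: "continuous_on UNIV \<phi>" and p: "\<And>t. \<phi> t \<ge> 0" for \<phi> :: "complex \<Rightarrow> real"
  proof -
    have "(\<integral>\<^sup>+ t. ennreal (\<phi> t) \<partial>\<mu>) = (\<integral>\<^sup>+ t. ennreal (indicator S t *\<^sub>R \<phi> t) \<partial>\<mu>)"
      by (rule nn_integral_cong_AE)
        (use AE_prob_measures_on[OF S \<mu>] in \<open>eventually_elim, auto\<close>)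
    also have "\<dots> = ennreal (LINT t:S|\<mu>. \<phi> t)"
      unfolding set_lebesgue_integral_def
      using set_integrable_continuous_on_prob[OF S \<mu> continuous_on_subset[OF c]] p
      by (intro nn_integral_eq_integral) (auto simp: set_integrable_def indicator_def)
    finally show ?thesis .
  qed
  \<comment> \<open>\<open>a k\<close> and \<open>b\<close> are the positive and negative parts of
    the truncated kernel; only the positive part depends on k.\<close>
  define a where "a k t = - ln (max (min (cmod (z - t)) 1) (exp (- real k)))" for k t
  define b where "b t = ln (max (cmod (z - t)) 1)" for t
  have pos: "max x (exp y) \<noteq> 0" for x y :: real
    by (metis exp_gt_zero less_irrefl max.strict_coboundedI2)
  have ca: "continuous_on A (a k)" for A k unfolding a_def by (intro continuous_intros) (use pos in auto)
  have cb: "continuous_on A b" for A unfolding b_def by (intro continuous_intros) (auto simp: max_def)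
  have a0: "0 \<le> a k t" for k t
  proof -
    have "max (min (cmod (z - t)) 1) (exp (- real k)) \<le> 1" by simp
    then have "ln (max (min (cmod (z - t)) 1) (exp (- real k))) \<le> ln 1"
      by (intro ln_mono) (auto intro: max.strict_coboundedI2)
    then show ?thesis by (simp add: a_def)
  qed
  have b0: "0 \<le> b t" for t by (simp add: b_def)
  have ab: "a k t - b t = - ln (max (cmod (z - t)) (exp (- real k)))" for k t
  proof (cases "cmod (z - t) \<le> 1")
    case True
    then show ?thesis by (simp add: a_def b_def)
  next
    case False
    have "exp (- real k) \<le> 1" by simp
    then have "max (cmod (z - t)) (exp (- real k)) = cmod (z - t)"
      using False by (intro max_absorb1) linarith
    then show ?thesis using False by (simp add: a_def b_def)
  qed
  have a_Suc: "a k t \<le> a (Suc k) t" for k t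
  proof -
    have "ln (max (min (cmod (z - t)) 1) (exp (- real (Suc k)))) \<le> ln (max (min (cmod (z - t)) 1) (exp (- real k)))"
      by (intro ln_mono max.mono) (auto intro: max.strict_coboundedI2)
    then show ?thesis by (simp add: a_def)
  qed
  have mono: "incseq (\<lambda>k t. ennreal (a k t))"
    by (intro incseq_SucI le_funI ennreal_leI a_Suc)
  have plus: "e2ennreal (log_kernel z t) = (SUP k. ennreal (a k t))" for t
  proof (cases "t = z")
    case True
    have "a k t = real k" for k using True by (simp add: a_def max_absorb2)
    then have "(SUP k. ennreal (a k t)) = (SUP k. of_nat k)" by (simp add: ennreal_of_nat_eq_real_of_nat)
    also have "\<dots> = e2ennreal (log_kernel z t)"
      unfolding ennreal_SUP_of_nat_eq_top using True by (simp add: log_kernel_def)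
    finally show ?thesis ..
  next
    case False
    then have d: "cmod (z - t) > 0" by simp
    have k: "e2ennreal (log_kernel z t) = ennreal (- ln (cmod (z - t)))"
      using False d by (simp add: log_kernel_def ln_div ennreal.rep_eq e2ennreal_ereal)
    have "a k t \<le> max 0 (- ln (cmod (z - t)))" for k
    proof -
      have "ln (min (cmod (z - t)) 1) \<le> ln (max (min (cmod (z - t)) 1) (exp (- real k)))"
        using d by (intro ln_mono) auto
      then show ?thesis using d by (auto simp: a_def min_def split: if_splits)
    qed
    then have "ennreal (a k t) \<le> ennreal (- ln (cmod (z - t)))" for k
      using a0 by (smt (verit) ennreal_leI ennreal_neg max_def)
    moreover obtain n :: nat where n: "- ln (cmod (z - t)) \<le> n" using real_arch_simple by blast
    have "a n t = max 0 (- ln (cmod (z - t)))"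
    proof -
      have "exp (- real n) \<le> exp (ln (cmod (z - t)))" using n by (subst exp_le_cancel_iff) linarith
      then have "exp (- real n) \<le> min (cmod (z - t)) 1" unfolding exp_ln[OF d] by simp
      then show ?thesis using d by (auto simp: a_def max_def min_def not_le)
    qed
    then have "ennreal (- ln (cmod (z - t))) = ennreal (a n t)"
      by (cases "- ln (cmod (z - t)) \<ge> 0") (auto simp: ennreal_neg max_def)
    ultimately have "(SUP k. ennreal (a k t)) = ennreal (- ln (cmod (z - t)))"
      by (intro antisym SUP_least) (auto intro: SUP_upper)
    then show ?thesis using k by simp
  qed
  have minus: "e2ennreal (- log_kernel z t) = ennreal (b t)" for t
  proof (cases "t = z")
    case True
    then show ?thesis by (simp add: log_kernel_def b_def e2ennreal_neg)
  next
    case False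
    then have d: "cmod (z - t) > 0" by simp
    have "e2ennreal (- log_kernel z t) = ennreal (ln (cmod (z - t)))"
      using False d by (simp add: log_kernel_def ln_div e2ennreal_ereal)
    also have "\<dots> = ennreal (b t)"
    proof (cases "cmod (z - t) \<ge> 1")
      case False
      then have "ln (cmod (z - t)) \<le> 0" using d by simp
      then show ?thesis using False by (simp add: b_def ennreal_neg)
    qed (simp add: b_def)
    finally show ?thesis .
  qed
  have "(\<integral>\<^sup>+ t. e2ennreal (log_kernel z t) \<partial>\<mu>) = (SUP k. \<integral>\<^sup>+ t. ennreal (a k t) \<partial>\<mu>)"
    unfolding plus
  proof (rule nn_integral_monotone_convergence_SUP[OF mono])
    show "(\<lambda>t. ennreal (a k t)) \<in> borel_measurable \<mu>" for k
      using borel_measurable_continuous_onI[OF ca[of UNIV k]] by simp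
  qed
  also have "\<dots> = (SUP k. ennreal (LINT t:S|\<mu>. a k t))"
    using nn[OF ca a0] by simp
  finally have P: "(\<integral>\<^sup>+ t. e2ennreal (log_kernel z t) \<partial>\<mu>) = (SUP k. ennreal (LINT t:S|\<mu>. a k t))" .
  have I0: "0 \<le> (LINT t:S|\<mu>. a k t)" "0 \<le> (LINT t:S|\<mu>. b t)" for k
    using pos_mean_mono[OF mean _ ca, of "\<lambda>_. 0"] pos_mean_mono[OF mean _ cb, of "\<lambda>_. 0"] a0 b0
      pos_mean_const[OF mean, of 0] by auto
  have "enn2ereal (SUP k. ennreal (LINT t:S|\<mu>. a k t)) = (SUP k. enn2ereal (ennreal (LINT t:S|\<mu>. a k t)))"
  proof (rule sup_continuousD)
    show "sup_continuous enn2ereal"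
      using sup_continuous_enn2ereal[OF sup_continuous_id] by (simp add: id_def)
    show "mono (\<lambda>k. ennreal (LINT t:S|\<mu>. a k t))"
      by (intro incseq_SucI ennreal_leI pos_mean_mono[OF mean ca ca] a_Suc)
  qed
  then have enn: "enn2ereal (SUP k. ennreal (LINT t:S|\<mu>. a k t)) = (SUP k. ereal (LINT t:S|\<mu>. a k t))"
    using I0(1) by simp
  have "log_potential \<mu> z = (SUP k. ereal (LINT t:S|\<mu>. a k t)) - ereal (LINT t:S|\<mu>. b t)"
    unfolding log_potential_def P minus nn[OF cb b0] enn using I0(2) by simp
  also have "\<dots> = (SUP k. ereal (LINT t:S|\<mu>. a k t) - ereal (LINT t:S|\<mu>. b t))"
    by (subst SUP_ereal_minus_left) auto
  also have "\<dots> = (SUP k. ereal (trunc_pot S \<mu> k z))"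
    using pos_mean_diff[OF mean ca cb] by (simp add: ab)
  finally show ?thesis .
qed

lemma continuous_on_trunc_pot:
  assumes S: "compact S" and \<mu>: "\<mu> \<in> prob_measures_on S"
  shows "continuous_on UNIV (trunc_pot S \<mu> k)"
proof -
  have mean: "pos_mean S (\<lambda>\<phi>. LINT z:S|\<mu>. \<phi> z)" by (rule pos_mean_set_integral[OF S \<mu>])
  define \<eta> where "\<eta> = exp (- real k)"
  have \<eta>: "\<eta> > 0" by (simp add: \<eta>_def)
  have c: "continuous_on S (\<lambda>t. - ln (max (cmod (z - t)) \<eta>))" for z
    by (intro continuous_intros) (use \<eta> in \<open>auto simp: max_def\<close>)
  have "\<bar>(LINT t:S|\<mu>. - ln (max (cmod (z - t)) \<eta>)) - (LINT t:S|\<mu>. - ln (max (cmod (z' - t)) \<eta>))\<bar> \<le> cmod (z - z') / \<eta>"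
    for z z'
  proof (rule pos_mean_dist_const[OF mean c c])
    fix t
    have "\<bar>ln (max (cmod (z - t)) \<eta>) - ln (max (cmod (z' - t)) \<eta>)\<bar> \<le> \<bar>max (cmod (z - t)) \<eta> - max (cmod (z' - t)) \<eta>\<bar> / \<eta>"
      using \<eta> by (intro abs_ln_diff_le) auto
    also have "\<bar>max (cmod (z - t)) \<eta> - max (cmod (z' - t)) \<eta>\<bar> \<le> \<bar>cmod (z - t) - cmod (z' - t)\<bar>" by (auto simp: max_def)
    also have "\<dots> \<le> cmod (z - z')" using norm_triangle_ineq3[of "z - t" "z' - t"] by simp
    finally show "\<bar>- ln (max (cmod (z - t)) \<eta>) - - ln (max (cmod (z' - t)) \<eta>)\<bar> \<le> cmod (z - z') / \<eta>"
      using \<eta> by (simp add: divide_right_mono abs_minus_commute)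
  qed
  then have "(1 / \<eta>)-lipschitz_on UNIV (\<lambda>z. LINT t:S|\<mu>. - ln (max (cmod (z - t)) \<eta>))"
    using \<eta> by (intro lipschitz_onI) (auto simp: dist_norm)
  then show ?thesis unfolding \<eta>_def by (rule lipschitz_on_continuous_on)
qed

text \<open>A supremum exceeds - ln r exactly if one of its members does. With continuous
  truncations this presents a level set as a union of open sets; points of infinite potential are
  included through the value 0 of \<open>exp_potential\<close>.\<close>

lemma exp_potential_less_iff:
  assumes S: "compact S" and \<mu>: "\<mu> \<in> prob_measures_on S" and r: "r > 0"
  shows "exp_potential \<mu> z < r \<longleftrightarrow> (\<exists>k. - ln r < trunc_pot S \<mu> k z)"
proof -
  have L: "log_potential \<mu> z = (SUP k. ereal (trunc_pot S \<mu> k z))"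
    by (rule log_potential_eq_SUP[OF S \<mu>])
  have "(\<exists>k. - ln r < trunc_pot S \<mu> k z) \<longleftrightarrow> ereal (- ln r) < log_potential \<mu> z"
    unfolding L less_SUP_iff by simp
  also have "\<dots> \<longleftrightarrow> exp_potential \<mu> z < r"
  proof (cases "log_potential \<mu> z")
    case (real u)
    have "exp (- u) < r \<longleftrightarrow> - u < ln r" using r by (metis exp_less_cancel_iff exp_ln)
    then show ?thesis using real by (auto simp: exp_potential_def)
  next
    case MInf
    have "ereal (trunc_pot S \<mu> 0 z) \<le> log_potential \<mu> z" unfolding L by (rule SUP_upper) simp
    then show ?thesis using MInf by simp
  qed (use r in \<open>simp add: exp_potential_def\<close>)
  finally show ?thesis ..
qed

lemma exp_potential_nonneg: "exp_potential \<mu> z \<ge> 0"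
  by (simp add: exp_potential_def)

lemma open_level_set:
  assumes S: "compact S" and \<mu>: "\<mu> \<in> prob_measures_on S"
  shows "open (level_set \<mu> r)"
proof (cases "r > 0")
  case True
  have eq: "level_set \<mu> r = (\<Union>k. {z. - ln r < trunc_pot S \<mu> k z})"
    using exp_potential_less_iff[OF S \<mu> True] by (auto simp: level_set_def)
  have "open {z. - ln r < trunc_pot S \<mu> k z}" for k
    by (intro open_Collect_less continuous_on_trunc_pot[OF S \<mu>] continuous_on_const)
  then show ?thesis unfolding eq by (intro open_UN ballI)
next
  case False
  then have "\<not> exp_potential \<mu> z < r" for z using exp_potential_nonneg[of \<mu> z] by linarith
  then show ?thesis by (simp add: level_set_def)
qed

text \<open>On bounded sets |z - t| is bounded, so the potential is bounded below. Without this the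
  supremum in \<open>rho_max\<close> would carry no information.\<close>

lemma exp_potential_bounded:
  assumes S: "compact S" and \<mu>: "\<mu> \<in> prob_measures_on S" and E: "bounded E"
  shows "bdd_above (exp_potential \<mu> ` E)"
proof -
  have mean: "pos_mean S (\<lambda>\<phi>. LINT z:S|\<mu>. \<phi> z)" by (rule pos_mean_set_integral[OF S \<mu>])
  obtain b c where b: "\<And>w. w \<in> E \<Longrightarrow> cmod w \<le> b" and c: "\<And>w. w \<in> S \<Longrightarrow> cmod w \<le> c"
    using E compact_imp_bounded[OF S] by (auto simp: bounded_iff)
  define L where "L = \<bar>b\<bar> + \<bar>c\<bar> + 1"
  have "exp_potential \<mu> z < L + 1" if z: "z \<in> E" for z
  proof -
    have "(LINT t:S|\<mu>. - ln L) \<le> trunc_pot S \<mu> 0 z"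
    proof (rule pos_mean_mono[OF mean])
      show "continuous_on S (\<lambda>t. - ln (max (cmod (z - t)) (exp (- real 0))))"
        by (intro continuous_intros) (auto simp: max_def)
      fix t assume t: "t \<in> S"
      have "cmod (z - t) \<le> L" using norm_triangle_ineq4[of z t] b[OF z] c[OF t] by (simp add: L_def)
      then have "ln (max (cmod (z - t)) (exp (- real 0))) \<le> ln L"
        by (intro ln_mono) (auto simp: L_def)
      then show "- ln L \<le> - ln (max (cmod (z - t)) (exp (- real 0)))" by simp
    qed auto
    moreover have "(LINT t:S|\<mu>. - ln L) = - ln L" by (rule pos_mean_const[OF mean])
    moreover have "- ln (L + 1) < - ln L" by (simp add: L_def)
    ultimately have "- ln (L + 1) < trunc_pot S \<mu> 0 z" by linarith
    moreover have "L + 1 > 0" by (simp add: L_def)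
    ultimately show ?thesis
      using exp_potential_less_iff[OF S \<mu>, of "L + 1" z] by blast
  qed
  then show ?thesis by (intro bdd_aboveI2[of _ _ "L + 1"]) (auto intro: less_imp_le)
qed

text \<open>Off \<open>S\<close> the truncation is inactive as soon as e^(-k) is below the distance
  to \<open>S\<close>.\<close>

lemma exp_potential_eq_exp_pot:
  assumes S: "compact S" and \<mu>: "\<mu> \<in> prob_measures_on S" and z: "z \<notin> S"
  shows "exp_potential \<mu> z = exp (pot (\<lambda>\<phi>. LINT t:S|\<mu>. \<phi> t) z)"
proof -
  have mean: "pos_mean S (\<lambda>\<phi>. LINT z:S|\<mu>. \<phi> z)" by (rule pos_mean_set_integral[OF S \<mu>])
  let ?p = "pot (\<lambda>\<phi>. LINT t:S|\<mu>. \<phi> t) z"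
  obtain d where d: "d > 0" "\<And>t. t \<in> S \<Longrightarrow> d \<le> cmod (z - t)"
    using dist_closed_pos[OF compact_imp_closed[OF S] z] by blast
  have c: "continuous_on S (\<lambda>t. - ln (max (cmod (z - t)) (exp (- real k))))" for k
    by (intro continuous_intros) (metis exp_gt_zero less_irrefl max.strict_coboundedI2)
  have cl: "continuous_on S (\<lambda>t. - ln (cmod (z - t)))"
    by (intro continuous_intros) (use z in auto)
  have neg: "(LINT t:S|\<mu>. - ln (cmod (z - t))) = - ?p"
    using pos_mean_cmult[OF mean continuous_on_ln_dist[OF z], of "-1"] by (simp add: pot_def)
  have le: "trunc_pot S \<mu> k z \<le> - ?p" for k
    unfolding neg[symmetric]
  proof (rule pos_mean_mono[OF mean c cl])
    fix t assume "t \<in> S"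
    then have "cmod (z - t) > 0" using z by auto
    then have "ln (cmod (z - t)) \<le> ln (max (cmod (z - t)) (exp (- real k)))" by (intro ln_mono) auto
    then show "- ln (max (cmod (z - t)) (exp (- real k))) \<le> - ln (cmod (z - t))" by simp
  qed
  obtain k :: nat where k: "- ln d \<le> k" using real_arch_simple by blast
  have "exp (- real k) \<le> exp (ln d)" using k by (subst exp_le_cancel_iff) linarith
  then have kd: "exp (- real k) \<le> d" using d(1) by simp
  have eq: "trunc_pot S \<mu> k z = - ?p"
    unfolding neg[symmetric]
  proof (rule pos_mean_cong[OF mean c])
    fix t assume "t \<in> S"
    then show "- ln (max (cmod (z - t)) (exp (- real k))) = - ln (cmod (z - t))"
      using d(2)[of t] kd by (simp add: max_absorb1)
  qed
  have "log_potential \<mu> z = ereal (- ?p)"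
    unfolding log_potential_eq_SUP[OF S \<mu>]
  proof (intro antisym SUP_least)
    show "ereal (- ?p) \<le> (SUP k. ereal (trunc_pot S \<mu> k z))"
      using SUP_upper[of k UNIV "\<lambda>k. ereal (trunc_pot S \<mu> k z)"] eq by simp
  qed (use le in auto)
  then show ?thesis by (simp add: exp_potential_def)
qed

section \<open>Zero counting measures of the node polynomials\<close>

lemma degree_node_poly: "degree (node_poly \<beta> n) = n"
  by (simp add: node_poly_def degree_prod_sum_eq)

lemma sum_mset_eq_sum_count:
  fixes g :: "'a \<Rightarrow> real"
  shows "(\<Sum>x\<in>#A. g x) = (\<Sum>x\<in>set_mset A. count A x * g x)"
proof (induction A)
  case (add y A)
  have "(\<Sum>x\<in>insert y (set_mset A). count (add_mset y A) x * g x) =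
      (\<Sum>x\<in>insert y (set_mset A). count A x * g x + (if x = y then g x else 0))"
    by (intro sum.cong) (auto simp: algebra_simps)
  also have "\<dots> = (\<Sum>x\<in>insert y (set_mset A). count A x * g x) + g y"
    by (simp add: sum.distrib)
  also have "(\<Sum>x\<in>insert y (set_mset A). count A x * g x) = (\<Sum>x\<in>set_mset A. count A x * g x)"
    by (rule sum.mono_neutral_right) (auto simp: not_in_iff)
  finally show ?case using add.IH by simp
qed simp

lemma zero_counting_measure_in_prob_measures_on:
  assumes S: "compact S" and \<beta>: "\<And>k. 1 \<le> k \<Longrightarrow> k \<le> n \<Longrightarrow> \<beta> n k \<in> S" and n: "n > 0"
  shows "zero_counting_measure (node_poly \<beta> n) \<in> prob_measures_on S"
proof -
  let ?p = "node_poly \<beta> n"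
  have roots: "x \<in> S" if "x \<in># proots ?p" for x
  proof -
    have "poly ?p x = 0" using that by (cases "?p = 0") auto
    then obtain k where "k \<in> {1..n}" "x = \<beta> n k" by (auto simp: node_poly_def poly_prod)
    then show ?thesis using \<beta> by auto
  qed
  interpret P: prob_space "zero_counting_measure ?p"
    unfolding zero_counting_measure_def by (intro measure_pmf.prob_space_distr) simp
  have "sets (zero_counting_measure ?p) = sets borel" by (simp add: zero_counting_measure_def)
  moreover have "measure (zero_counting_measure ?p) (- S) = 0"
  proof -
    have *: "filter_mset (\<lambda>z. z \<in> - S) (proots ?p) = {#}"
      using filter_mset_cong[of "proots ?p" "proots ?p" "\<lambda>z. z \<in> - S" "\<lambda>_. False"] roots by auto
    have "- S \<in> sets borel" using borel_compact[OF S] by auto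
    then show ?thesis
      using measure_zero_counting_measure[of ?p "- S"] n unfolding * by (simp add: degree_node_poly)
  qed
  ultimately show ?thesis
    using P.prob_space_axioms by (simp add: prob_measures_on_def P.emeasure_eq_measure)
qed

lemma pot_zero_counting_measure:
  assumes S: "compact S" and \<beta>: "\<And>k. 1 \<le> k \<Longrightarrow> k \<le> n \<Longrightarrow> \<beta> n k \<in> S" and n: "n > 0" and z: "z \<notin> S"
  shows "exp (n * pot (\<lambda>\<phi>. LINT t:S|zero_counting_measure (node_poly \<beta> n). \<phi> t) z) = cmod (poly (node_poly \<beta> n) z)"
proof -
  let ?p = "node_poly \<beta> n"
  let ?g = "\<lambda>t. indicator S t *\<^sub>R ln (cmod (z - t))"
  have pr: "proots ?p = (\<Sum>k\<in>{1..n}. {#\<beta> n k#})"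
    unfolding node_poly_def by (subst proots_prod) auto
  have sz: "size (proots ?p) = n" by (simp add: size_proots_complex degree_node_poly)
  then have ne: "proots ?p \<noteq> {#}" using n by auto
  have "pot (\<lambda>\<phi>. LINT t:S|zero_counting_measure ?p. \<phi> t) z = (\<integral>t. ?g t \<partial>measure_pmf (pmf_of_multiset (proots ?p)))"
    unfolding pot_def set_lebesgue_integral_def zero_counting_measure_def
    using continuous_on_ln_dist[OF z] compact_imp_closed[OF S]
    by (subst integral_distr) (auto intro!: borel_measurable_continuous_on_indicator)
  also have "\<dots> = (\<Sum>t\<in>set_mset (proots ?p). ?g t * pmf (pmf_of_multiset (proots ?p)) t)"
    using ne by (intro integral_measure_pmf_real) (auto simp: set_pmf_of_multiset)
  also have "\<dots> = (\<Sum>t\<in>set_mset (proots ?p). count (proots ?p) t * ?g t) / n"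
    using ne by (simp add: pmf_of_multiset sz sum_divide_distrib mult.commute)
  also have "(\<Sum>t\<in>set_mset (proots ?p). count (proots ?p) t * ?g t) = (\<Sum>t\<in>#proots ?p. ?g t)"
    by (simp add: sum_mset_eq_sum_count)
  also have "\<dots> = (\<Sum>k\<in>{1..n}. ?g (\<beta> n k))"
  proof -
    have "(\<Sum>t\<in>#(\<Sum>k\<in>A. {#\<beta> n k#}). g t) = (\<Sum>k\<in>A. g (\<beta> n k))" if "finite A"
      for A and g :: "complex \<Rightarrow> real"
      using that by induction auto
    then show ?thesis unfolding pr by blast
  qed
  also have "\<dots> = (\<Sum>k\<in>{1..n}. ln (cmod (z - \<beta> n k)))"
    using \<beta> by (intro sum.cong) auto
  also have "\<dots> = ln (\<Prod>k\<in>{1..n}. cmod (z - \<beta> n k))"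
    using \<beta> z by (subst ln_prod) auto
  also have "(\<Prod>k\<in>{1..n}. cmod (z - \<beta> n k)) = cmod (poly ?p z)"
    by (simp add: node_poly_def poly_prod prod_norm)
  finally have "n * pot (\<lambda>\<phi>. LINT t:S|zero_counting_measure ?p. \<phi> t) z = ln (cmod (poly ?p z))"
    using n by simp
  moreover have "poly ?p z \<noteq> 0" using \<beta> z by (force simp: node_poly_def poly_prod)
  ultimately show ?thesis by simp
qed

subsection \<open>Meromorphic continuation and the approximation error\<close>

text \<open>The exterior of a large disc is connected, so it lies on one side of any separation of
  the plane complement. Adding the point at infinity to that side keeps it open and yields a
  separation on the sphere.\<close>

lemma connected_Compl_if_connectedin_sphere:
  assumes E: "compact E" and con: "connectedin riemann_sphere (sphere_complement E)"
  shows "connected (- E)"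
proof (rule ccontr)
  assume "\<not> connected (- E)"
  then obtain A' B' where AB': "open A'" "open B'" "- E \<subseteq> A' \<union> B'" "A' \<inter> B' \<inter> - E = {}" "A' \<inter> - E \<noteq> {}" "B' \<inter> - E \<noteq> {}"
    unfolding connected_def by blast
  have oE: "open (- E)" using E compact_imp_closed by blast
  obtain R where R: "\<And>w. w \<in> E \<Longrightarrow> cmod w \<le> R"
    using compact_imp_bounded[OF E] by (auto simp: bounded_iff)
  have out: "- cball 0 R \<subseteq> - E" using R by auto
  have cout: "connected (- cball (0::complex) R)"
    by (intro connected_complement_bounded_convex) auto
  have False if o: "open A" "open B" and AB: "A \<union> B = - E" "A \<inter> B = {}" "A \<noteq> {}" "B \<noteq> {}"
    and sub: "- cball 0 R \<subseteq> A" for A B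
  proof -
    have "openin riemann_sphere (Some ` B)" using o by simp
    moreover have "compact (- A)"
      using sub o by (intro compact_eq_bounded_closed[THEN iffD2] conjI bounded_subset[OF bounded_cball[of 0 R]]) auto
    then have "openin riemann_sphere (insert None (Some ` A))"
      unfolding openin_Alexandroff_compactification using o
      by (intro disjI2 exI[of _ "- A"]) (auto simp: Compl_eq_Diff_UNIV[symmetric])
    moreover have "sphere_complement E \<subseteq> Some ` B \<union> insert None (Some ` A)"
      using AB(1) by (auto simp: sphere_complement_def)
    moreover have "Some ` B \<inter> insert None (Some ` A) \<inter> sphere_complement E = {}"
      using AB(2) by auto
    ultimately have "Some ` B \<inter> sphere_complement E = {} \<or> insert None (Some ` A) \<inter> sphere_complement E = {}"
      using con unfolding connectedin by blast
    moreover have "None \<in> sphere_complement E" by (auto simp: sphere_complement_def)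
    moreover obtain b where "b \<in> B" using AB by blast
    then have "Some b \<in> Some ` B \<inter> sphere_complement E"
      using AB(1) by (auto simp: sphere_complement_def)
    ultimately show False by blast
  qed
  note * = this
  have 1: "open (A' \<inter> - E)" "open (B' \<inter> - E)" using AB' oE by auto
  have 2: "(A' \<inter> - E) \<union> (B' \<inter> - E) = - E" "(A' \<inter> - E) \<inter> (B' \<inter> - E) = {}"
    "(B' \<inter> - E) \<union> (A' \<inter> - E) = - E" "(B' \<inter> - E) \<inter> (A' \<inter> - E) = {}" using AB' by blast+
  have "A' \<inter> - cball 0 R = {} \<or> B' \<inter> - cball 0 R = {}"
    using connectedD[OF cout AB'(1,2)] AB'(3,4) out by blast
  then have "- cball 0 R \<subseteq> B' \<inter> - E \<or> - cball 0 R \<subseteq> A' \<inter> - E"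
    using AB'(3) out by blast
  then show False using *[OF 1 2(1,2) AB'(5,6)] *[OF 1(2,1) 2(3,4) AB'(6,5)] by blast
qed

text \<open>A nicely meromorphic function is 0 at its poles and equals its limit elsewhere, so its
  value at a point is determined by the punctured neighbourhood.\<close>

lemma nicely_meromorphic_eq_at:
  assumes "f nicely_meromorphic_on A" "g nicely_meromorphic_on A" "z \<in> A"
    and ev: "eventually (\<lambda>w. f w = g w) (at z)"
  shows "f z = g z"
proof (cases "is_pole f z")
  case True
  then have "is_pole g z" using is_pole_cong[OF ev refl] by simp
  then show ?thesis
    using True assms(1-3) unfolding nicely_meromorphic_on_def is_pole_def
    by (metis at_neq_bot not_tendsto_and_filterlim_at_infinity)
next
  case False
  then have "\<not> is_pole g z" using is_pole_cong[OF ev refl] by simp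
  then have "f \<midarrow>z\<rightarrow> f z" "g \<midarrow>z\<rightarrow> g z"
    using False assms(1-3) unfolding nicely_meromorphic_on_def by blast+
  moreover have "f \<midarrow>z\<rightarrow> g z" using tendsto_cong[OF ev] calculation(2) by blast
  ultimately show ?thesis using LIM_unique by blast
qed

text \<open>Poles of \<open>f\<close> and \<open>g\<close> may cancel in the difference without the
  value there being the limit, so the identity theorem is applied after removing
  singularities.\<close>

lemma nicely_meromorphic_identity:
  assumes f: "f nicely_meromorphic_on A" and g: "g nicely_meromorphic_on A"
    and A: "open A" "connected A" "z \<in> A" and ev: "eventually (\<lambda>w. f w = g w) (at z)" and w: "w \<in> A"
  shows "f w = g w"
proof -
  let ?h = "\<lambda>w. f w - g w"
  have h: "?h meromorphic_on A"
    using f g by (intro meromorphic_on_diff) (auto simp: nicely_meromorphic_on_def)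
  have iso: "isolated_singularity_at ?h x" if "x \<in> A" for x
    using h that meromorphic_on_altdef by blast
  have "eventually (\<lambda>w. remove_sings ?h w = 0) (at z)"
    using eventually_remove_sings_eq_at[OF iso[OF A(3)]] ev by eventually_elim simp
  then have "frequently (\<lambda>w. remove_sings ?h w = 0) (at z)"
    by (simp add: eventually_frequently)
  then have zero: "remove_sings ?h x = 0" if "x \<in> A" for x
    using frequently_eq_meromorphic_imp_constant[OF _ remove_sings_nicely_meromorphic[OF h] A] that by blast
  have "eventually (\<lambda>x. x \<in> A) (at w)" using A(1) w by (intro eventually_at_in_open')
  then have "eventually (\<lambda>x. f x = g x) (at w)"
    using eventually_remove_sings_eq_at[OF iso[OF w]] by eventually_elim (use zero in auto)
  then show ?thesis by (rule nicely_meromorphic_eq_at[OF f g w])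
qed

lemma level_set_mono: "r \<le> s \<Longrightarrow> level_set \<mu> r \<subseteq> level_set \<mu> s"
  by (auto simp: level_set_def)

text \<open>The continuations to the smaller level sets need not agree on components of these sets which do
  not meet \<open>E\<close>. They are therefore glued along the components \<open>W r\<close> of a point of \<open>E\<close>. These exhaust
  \<open>D\<close>, since \<open>D\<close> is connected.\<close>

lemma ex_meromorphic_continuation_level_set:
  assumes E: "compact E" "E \<noteq> {}" and op: "\<And>r. open (level_set \<mu> r)"
    and bdd: "bdd_above (exp_potential \<mu> ` E)" and rm: "rho_max E \<mu> < R"
    and rad: "radius_meromorphy m E \<mu> f = ereal R" and con: "connected (level_set \<mu> R)"
  shows "\<exists>F. meromorphic_continuation m E f (level_set \<mu> R) F"
proof -
  define D where "D = level_set \<mu> R"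
  define T where "T = {r. rho_min E \<mu> < r \<and> (\<exists>g. meromorphic_continuation m E f (level_set \<mu> r) g)}"
  \<comment> \<open>Radii above \<open>rho_max E \<mu>\<close> have level sets that contain
    \<open>E\<close>, so the base point \<open>z0\<close> has a component in each of them.\<close>
  define T' where "T' = {r\<in>T. rho_max E \<mu> < r}"
  have SupT: "Sup (ereal ` T) = ereal R"
    using rad unfolding radius_meromorphy_def T_def by (simp add: setcompr_eq_image)
  have le: "r \<le> R" if "r \<in> T" for r
    using Sup_upper[of "ereal r" "ereal ` T"] that SupT by simp
  have ex: "\<exists>r\<in>T'. r0 < r" if "r0 < R" for r0
  proof -
    have "ereal (max r0 (rho_max E \<mu>)) < Sup (ereal ` T)" using that rm SupT by simp
    then obtain r where "r \<in> T" "max r0 (rho_max E \<mu>) < r" unfolding less_Sup_iff by auto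
    then show ?thesis by (auto simp: T'_def)
  qed
  have EL: "E \<subseteq> level_set \<mu> r" if "rho_max E \<mu> < r" for r
    using that cSUP_upper[OF _ bdd] by (force simp: level_set_def rho_max_def)
  obtain z0 where z0: "z0 \<in> E" using E(2) by blast
  define W where "W r = connected_component_set (level_set \<mu> r) z0" for r
  have W: "open (W r)" "connected (W r)" "W r \<subseteq> level_set \<mu> r" for r
    using op connected_component_subset by (auto simp: W_def open_connected_component)
  have z0W: "z0 \<in> W r" if "r \<in> T'" for r
    using EL z0 that by (auto simp: W_def T'_def)
  have Wmono: "W r \<subseteq> W s" if "r \<le> s" for r s
    unfolding W_def using level_set_mono[OF that] by (rule connected_component_mono)
  have cover: "\<exists>r\<in>T'. x \<in> W r" if x: "x \<in> D" for x
  proof -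
    have "path_connected D" using con op connected_open_path_connected unfolding D_def by blast
    moreover have "z0 \<in> D" using EL[OF rm] z0 by (auto simp: D_def)
    ultimately obtain \<gamma> where \<gamma>: "path \<gamma>" "path_image \<gamma> \<subseteq> D" "pathstart \<gamma> = z0" "pathfinish \<gamma> = x"
      using x unfolding path_connected_def by blast
    \<comment> \<open>The level sets below \<open>R\<close> increase to \<open>D\<close>, so a
      compact path in \<open>D\<close> already lies in one of them.\<close>
    have "path_image \<gamma> \<subseteq> (\<Union>r\<in>{..<R}. level_set \<mu> r)"
    proof
      fix y assume "y \<in> path_image \<gamma>"
      then have "exp_potential \<mu> y < R" using \<gamma>(2) by (auto simp: D_def level_set_def)
      then obtain r where "exp_potential \<mu> y < r" "r < R" using dense by blast
      then show "y \<in> (\<Union>r\<in>{..<R}. level_set \<mu> r)" by (auto simp: level_set_def)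
    qed
    then obtain C where C: "C \<subseteq> {..<R}" "finite C" "path_image \<gamma> \<subseteq> (\<Union>r\<in>C. level_set \<mu> r)"
      using compactE_image[OF compact_path_image[OF \<gamma>(1)], of "{..<R}" "level_set \<mu>"] op by metis
    have zx: "z0 \<in> path_image \<gamma>" "x \<in> path_image \<gamma>" using \<gamma>(3,4) by auto
    then have Cn: "C \<noteq> {}" using C(3) by auto
    obtain r where r: "r \<in> T'" "Max C < r" using ex[of "Max C"] C Cn by (auto simp: subset_iff)
    have "level_set \<mu> s \<subseteq> level_set \<mu> r" if "s \<in> C" for s
      using Max_ge[OF C(2) that] r(2) by (intro level_set_mono) linarith
    then have "path_image \<gamma> \<subseteq> level_set \<mu> r" using C(3) by blast
    then have "connected_component (level_set \<mu> r) z0 x"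
      unfolding connected_component_def using zx connected_path_image[OF \<gamma>(1)] by blast
    then show ?thesis using r(1) by (auto simp: W_def)
  qed
  define G where "G r = (SOME g. meromorphic_continuation m E f (level_set \<mu> r) g)" for r
  have G: "meromorphic_continuation m E f (level_set \<mu> r) (G r)" if r: "r \<in> T'" for r
  proof -
    obtain g where "meromorphic_continuation m E f (level_set \<mu> r) g"
      using r by (auto simp: T'_def T_def)
    then show ?thesis unfolding G_def by (rule someI[of "meromorphic_continuation m E f (level_set \<mu> r)"])
  qed
  have Gn: "G r nicely_meromorphic_on W r" "G s nicely_meromorphic_on W r" if "r \<in> T'" "s \<in> T'" "r \<le> s" for r s
    using G[OF that(1)] G[OF that(2)] W(3)[of r] level_set_mono[OF that(3)] nicely_meromorphic_on_subset
    unfolding meromorphic_continuation_def by (metis order.trans)+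
  have cons': "G r x = G s x" if rs: "r \<in> T'" "s \<in> T'" "r \<le> s" and x: "x \<in> W r" for r s x
  proof (rule nicely_meromorphic_identity[OF Gn[OF rs] W(1,2) z0W[OF rs(1)] _ x])
    obtain U where U: "open U" "E \<subseteq> U" "\<forall>z\<in>U \<inter> level_set \<mu> r. G r z = f z"
      using G[OF rs(1)] unfolding meromorphic_continuation_def by blast
    obtain U' where U': "open U'" "E \<subseteq> U'" "\<forall>z\<in>U' \<inter> level_set \<mu> s. G s z = f z"
      using G[OF rs(2)] unfolding meromorphic_continuation_def by blast
    have "eventually (\<lambda>w. w \<in> U \<inter> U' \<inter> W r) (at z0)"
      using U U' W(1) z0 z0W[OF rs(1)] by (intro eventually_at_in_open') auto
    then show "eventually (\<lambda>w. G r w = G s w) (at z0)"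
    proof eventually_elim
      case (elim w)
      then have "w \<in> level_set \<mu> r" "w \<in> level_set \<mu> s"
        using W(3)[of r] level_set_mono[OF rs(3), of \<mu>] by blast+
      then show ?case using U(3) U'(3) elim by auto
    qed
  qed
  have cons: "G r x = G s x" if "r \<in> T'" "s \<in> T'" "x \<in> W r" "x \<in> W s" for r s x
  proof (cases "r \<le> s")
    case True
    then show ?thesis by (intro cons' that)
  next
    case False
    then have "s \<le> r" by simp
    then show ?thesis by (intro cons'[symmetric] that)
  qed
  define F where "F x = G (SOME r. r \<in> T' \<and> x \<in> W r) x" for x
  have F: "F x = G r x" if "r \<in> T'" "x \<in> W r" for r x
  proof -
    have "(SOME r. r \<in> T' \<and> x \<in> W r) \<in> T' \<and> x \<in> W (SOME r. r \<in> T' \<and> x \<in> W r)"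
      using that by (intro someI[of "\<lambda>r. r \<in> T' \<and> x \<in> W r" r]) simp
    then show ?thesis unfolding F_def by (intro cons that) auto
  qed
  have evF: "eventually (\<lambda>w. F w = G r w) (at x)" if "r \<in> T'" "x \<in> W r" for r x
    using eventually_at_in_open'[OF W(1) that(2)] by eventually_elim (use F that in auto)
  have "F nicely_meromorphic_on D"
    unfolding nicely_meromorphic_on_def
  proof (intro conjI ballI)
    show "F meromorphic_on D"
      unfolding meromorphic_on_meromorphic_at[of F D]
    proof
      fix x assume "x \<in> D"
      then obtain r where r: "r \<in> T'" "x \<in> W r" using cover by blast
      have "G r meromorphic_on {x}"
        using Gn[OF r(1) r(1)] r(2) by (auto simp: nicely_meromorphic_on_def intro: meromorphic_on_subset)
      then show "F meromorphic_on {x}"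
        using meromorphic_on_cong[of "{x}" F "G r" "{x}"] evF[OF r] by auto
    qed
    fix x assume "x \<in> D"
    then obtain r where r: "r \<in> T'" "x \<in> W r" using cover by blast
    have "(is_pole (G r) x \<and> G r x = 0) \<or> G r \<midarrow>x\<rightarrow> G r x"
      using Gn[OF r(1) r(1)] r(2) by (auto simp: nicely_meromorphic_on_def)
    then show "(is_pole F x \<and> F x = 0) \<or> F \<midarrow>x\<rightarrow> F x"
      using is_pole_cong[OF evF[OF r] refl] tendsto_cong[OF evF[OF r]] F[OF r] by simp
  qed
  \<comment> \<open>Finiteness of the pole set is still open, so finite sets of poles are counted.
    Each fits into a single \<open>W r\<close>, whose continuation has at most \<open>m\<close>
    poles with multiplicity; every order is at least 1, which bounds the cardinality too.\<close>
  moreover have fin: "(\<Sum>z\<in>X. nat (- zorder F z)) \<le> m \<and> card X \<le> m" if X: "finite X" "X \<subseteq> {z\<in>D. is_pole F z}" for X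
  proof -
    have "\<exists>r\<in>T'. X \<subseteq> W r"
      using X
    proof (induction X)
      case empty
      then show ?case using ex[of "R - 1"] by auto
    next
      case (insert x X)
      then obtain r where r: "r \<in> T'" "X \<subseteq> W r" by auto
      obtain s where s: "s \<in> T'" "x \<in> W s" using cover insert.prems by blast
      show ?case
        using r s Wmono[of r s] Wmono[of s r] by (cases "r \<le> s") auto
    qed
    then obtain r where r: "r \<in> T'" "X \<subseteq> W r" by blast
    have pole: "is_pole (G r) z" "zorder F z = zorder (G r) z" "nat (- zorder F z) \<ge> 1" if "z \<in> X" for z
    proof -
      have e: "eventually (\<lambda>w. F w = G r w) (at z)" using evF r that by blast
      then show p: "is_pole (G r) z" using X that is_pole_cong[OF e refl] by auto
      show z: "zorder F z = zorder (G r) z" by (rule zorder_cong[OF e refl])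
      have "isolated_singularity_at (G r) z"
        using Gn[OF r(1) r(1)] r(2) that unfolding nicely_meromorphic_on_def meromorphic_on_altdef by auto
      from isolated_pole_imp_neg_zorder[OF this p] show "nat (- zorder F z) \<ge> 1" using z by simp
    qed
    have mc: "finite {z \<in> level_set \<mu> r. is_pole (G r) z}"
      "(\<Sum>z | z \<in> level_set \<mu> r \<and> is_pole (G r) z. nat (- zorder (G r) z)) \<le> m"
      using G[OF r(1)] by (auto simp: meromorphic_continuation_def)
    have "(\<Sum>z\<in>X. nat (- zorder F z)) = (\<Sum>z\<in>X. nat (- zorder (G r) z))"
      using pole by (intro sum.cong) auto
    also have "\<dots> \<le> (\<Sum>z | z \<in> level_set \<mu> r \<and> is_pole (G r) z. nat (- zorder (G r) z))"
      using mc(1) pole(1) r(2) W(3)[of r] by (intro sum_mono2) auto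
    finally have 1: "(\<Sum>z\<in>X. nat (- zorder F z)) \<le> m" using mc(2) by simp
    have "card X = (\<Sum>z\<in>X. 1)" by simp
    also have "\<dots> \<le> (\<Sum>z\<in>X. nat (- zorder F z))" using pole(3) by (intro sum_mono)
    finally show ?thesis using 1 by simp
  qed
  moreover have finp: "finite {z\<in>D. is_pole F z}"
    using fin finite_if_finite_subsets_card_bdd[of "{z\<in>D. is_pole F z}" m] by blast
  moreover have "\<exists>U. open U \<and> E \<subseteq> U \<and> (\<forall>z\<in>U \<inter> D. F z = f z)"
  proof -
    \<comment> \<open>\<open>E\<close> may be disconnected, but the increasing components
      \<open>W r\<close> exhaust \<open>D\<close>, so by compactness one of them contains
      \<open>E\<close>.\<close>
    have "E \<subseteq> (\<Union>r\<in>T'. W r)" using cover EL[OF rm] by (auto simp: D_def)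
    then obtain C where C: "C \<subseteq> T'" "finite C" "E \<subseteq> (\<Union>r\<in>C. W r)"
      using compactE_image[OF E(1), of T' W] W(1) by metis
    have Cn: "C \<noteq> {}" using C(3) z0 by auto
    have r: "Max C \<in> T'" using Max_in[OF C(2) Cn] C(1) by auto
    have EW: "E \<subseteq> W (Max C)" using C(3) Wmono[OF Max_ge[OF C(2)]] by blast
    obtain U where U: "open U" "E \<subseteq> U" "\<forall>z\<in>U \<inter> level_set \<mu> (Max C). G (Max C) z = f z"
      using G[OF r] unfolding meromorphic_continuation_def by blast
    show ?thesis
      using U EW W(1,3)[of "Max C"] F[OF r] by (intro exI[of _ "U \<inter> W (Max C)"]) auto
  qed
  ultimately have "meromorphic_continuation m E f D F"
    unfolding meromorphic_continuation_def using fin[OF finp] by auto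
  then show ?thesis unfolding D_def by blast
qed

section \<open>The approximation error with the poles cleared\<close>

lemma analytic_on_poly: "poly p analytic_on A" for p :: "complex poly"
proof -
  have "poly p holomorphic_on UNIV"
    unfolding holomorphic_on_def field_differentiable_def using poly_DERIV by blast
  then show ?thesis
    by (meson analytic_on_open analytic_on_subset open_UNIV subset_UNIV)
qed

text \<open>The factor of \<open>Q\<close> at a pole cancels its order. \<open>F\<close> has the
  value 0 there, however, so the plain product need not be continuous, and
  \<open>remove_sings\<close> puts in the limit. Near \<open>E\<close> both \<open>f\<close> and
  \<open>F\<close> are analytic and nothing is changed.\<close>

lemma meromorphic_continuation_error:
  fixes f F :: "complex \<Rightarrow> complex" and P q :: "complex poly"
  assumes mc: "meromorphic_continuation m E f D F" and D: "open D" "E \<subseteq> D" and f: "f analytic_on E"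
  defines "Q \<equiv> pole_poly D F"
  defines "H \<equiv> remove_sings (\<lambda>z. poly Q z * F z * poly q z - poly Q z * poly P z)"
  shows "H analytic_on D"
    and "\<exists>U. open U \<and> E \<subseteq> U \<and> U \<subseteq> D \<and> (\<forall>z\<in>U. H z = poly Q z * (f z * poly q z - poly P z))"
proof -
  let ?e = "\<lambda>z. poly Q z * F z * poly q z - poly Q z * poly P z"
  have nm: "F nicely_meromorphic_on D" and fin: "finite {z\<in>D. is_pole F z}"
    using mc by (auto simp: meromorphic_continuation_def)
  have at: "H analytic_on {z}" if z: "z \<in> D" for z
  proof (cases "is_pole F z")
    case False
    then have "F analytic_on {z}" using nm z nicely_meromorphic_on_imp_analytic_at by blast
    then have "?e analytic_on {z}" by (intro analytic_intros analytic_on_poly)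
    then show ?thesis unfolding H_def by (rule remove_sings_analytic_on)
  next
    case True
    have mF: "F meromorphic_on {z}" using nm z by (auto simp: nicely_meromorphic_on_def intro: meromorphic_on_subset)
    then have iso: "isolated_singularity_at F z" by (simp add: meromorphic_at_iff)
    then obtain S where S: "open S" "z \<in> S" "F holomorphic_on S - {z}"
      using analytic_imp_holomorphic isolated_singularity_at_iff_analytic_nhd by metis
    define k where "k = nat (- zorder F z)"
    define g where "g = zor_poly F z"
    obtain r where r: "r > 0" "g holomorphic_on cball z r" "\<And>w. w \<in> cball z r - {z} \<Longrightarrow> F w = g w / (w - z) ^ k"
      using zorder_exist_pole[OF S(3,1,2) True] unfolding k_def g_def by blast
    define Q1 where "Q1 = (\<Prod>x\<in>{x\<in>D. is_pole F x} - {z}. [:- x, 1:] ^ nat (- zorder F x))"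
    have Q1: "Q = [:- z, 1:] ^ k * Q1"
      unfolding Q_def pole_poly_def Q1_def k_def using fin z True by (intro prod.remove) auto
    have "eventually (\<lambda>w. w \<in> ball z r - {z}) (at z)"
      using r(1) by (intro eventually_at_in_open) auto
    then have ev: "eventually (\<lambda>w. poly Q1 w * g w * poly q w - poly Q w * poly P w = ?e w) (at z)"
      by eventually_elim (auto simp: r(3) Q1 poly_power)
    have "isCont g z" using r by (intro continuous_on_interior[OF holomorphic_on_imp_continuous_on[OF r(2)]]) auto
    then have "isCont (\<lambda>w. poly Q1 w * g w * poly q w - poly Q w * poly P w) z"
      by (intro continuous_intros) auto
    then have "(\<lambda>w. poly Q1 w * g w * poly q w - poly Q w * poly P w) \<midarrow>z\<rightarrow>
        poly Q1 z * g z * poly q z - poly Q z * poly P z"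
      by (simp add: isCont_def)
    then have "?e \<midarrow>z\<rightarrow> poly Q1 z * g z * poly q z - poly Q z * poly P z"
      using tendsto_cong[OF ev] by blast
    moreover have "isolated_singularity_at ?e z"
    proof -
      have "?e meromorphic_on {z}"
        by (intro meromorphic_intros mF analytic_on_imp_meromorphic_on analytic_on_poly)
      then show ?thesis by (simp add: meromorphic_at_iff)
    qed
    ultimately show ?thesis unfolding H_def by (intro remove_sings_analytic_at)
  qed
  then show "H analytic_on D" using analytic_on_analytic_at by blast
  obtain U0 where U0: "open U0" "E \<subseteq> U0" "\<forall>z\<in>U0 \<inter> D. F z = f z"
    using mc by (auto simp: meromorphic_continuation_def)
  obtain U1 where U1: "open U1" "E \<subseteq> U1" "f holomorphic_on U1"
    using f analytic_on_holomorphic by metis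
  have "H z = poly Q z * (f z * poly q z - poly P z)" if z: "z \<in> U0 \<inter> U1 \<inter> D" for z
  proof -
    have "eventually (\<lambda>w. w \<in> U0 \<inter> D) (nhds z)"
      using U0(1) D(1) z by (intro eventually_nhds_in_open) auto
    then have "eventually (\<lambda>w. F w = f w) (nhds z)"
      by eventually_elim (use U0(3) in auto)
    then have "F analytic_on {z} \<longleftrightarrow> f analytic_on {z}" by (rule analytic_at_cong[OF _ refl])
    then have "F analytic_on {z}" using U1 z analytic_at by blast
    then have "?e analytic_on {z}" by (intro analytic_intros analytic_on_poly)
    then have "H z = ?e z" unfolding H_def by (rule remove_sings_at_analytic)
    then show ?thesis using U0(3) z by (simp add: algebra_simps)
  qed
  then show "\<exists>U. open U \<and> E \<subseteq> U \<and> U \<subseteq> D \<and> (\<forall>z\<in>U. H z = poly Q z * (f z * poly q z - poly P z))"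
    using U0(1,2) U1(1,2) D by (intro exI[of _ "U0 \<inter> U1 \<inter> D"]) auto
qed

text \<open>Induction on the degree of \<open>Q\<close>: a root of \<open>Q\<close> is not a root of
  \<open>P\<close>, hence is one of \<open>q\<close>, and the linear factor cancels.\<close>

lemma complex_poly_cross_mult_factor:
  fixes P Q p q :: "complex poly"
  assumes "P * q = p * Q" "Q \<noteq> 0" "\<And>a. poly P a = 0 \<Longrightarrow> poly Q a \<noteq> 0"
  shows "\<exists>s. q = Q * s \<and> p = P * s"
  using assms
proof (induction "degree Q" arbitrary: Q q)
  case 0
  then obtain c where c: "Q = [:c:]" "c \<noteq> 0" by (metis degree_eq_zeroE pCons_0_0)
  have "p = smult (1 / c) (P * q)" using 0(2) c by simp
  then show ?case using c by (intro exI[of _ "smult (1 / c) q"]) simp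
next
  case (Suc n)
  then obtain a where a: "poly Q a = 0"
    using fundamental_theorem_of_algebra[of Q] by (auto simp: constant_degree)
  then obtain Q' where Q': "Q = [:- a, 1:] * Q'" using poly_eq_0_iff_dvd by (metis dvdE)
  have "poly P a * poly q a = 0" using arg_cong[OF Suc.prems(1), of "\<lambda>x. poly x a"] a by simp
  then have "poly q a = 0" using Suc.prems(3) a by auto
  then obtain q' where q': "q = [:- a, 1:] * q'" using poly_eq_0_iff_dvd by (metis dvdE)
  have "[:- a, 1:] * (P * q') = [:- a, 1:] * (p * Q')"
    using Suc.prems(1) unfolding Q' q' by (simp only: mult.left_commute)
  then have eq: "P * q' = p * Q'" by (subst (asm) mult_cancel_left) auto
  have nz: "Q' \<noteq> 0" using Suc.prems(2) Q' by auto
  have "degree Q = Suc (degree Q')" unfolding Q' using nz by (subst degree_mult_eq) auto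
  then have "n = degree Q'" using Suc.hyps(2) by simp
  then obtain s where "q' = Q' * s" "p = P * s"
    using Suc.hyps(1)[OF _ eq nz] Suc.prems(3) unfolding Q' by auto
  then show ?case unfolding Q' q' by (intro exI[of _ s]) (simp only: mult.assoc)
qed

text \<open>\<open>g\<close> collects the common zeros of \<open>s\<close> and
  \<open>\<omega>\<close>. It has at most \<open>degree s\<close> linear factors, each with its zero
  among those of \<open>\<omega>\<close>, so |g| has bounds that do not depend on the degree of
  \<open>\<omega>\<close>.\<close>

lemma complex_poly_common_factor:
  fixes s \<omega> :: "complex poly"
  assumes "s \<noteq> 0"
  shows "\<exists>g s' \<omega>'. s = g * s' \<and> \<omega> = g * \<omega>' \<and> (\<forall>a. poly \<omega>' a = 0 \<longrightarrow> poly s' a \<noteq> 0) \<and>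
    (\<forall>z \<delta>. 0 < \<delta> \<longrightarrow> \<delta> \<le> 1 \<longrightarrow> (\<forall>a. poly \<omega> a = 0 \<longrightarrow> \<delta> \<le> cmod (z - a)) \<longrightarrow> \<delta> ^ degree s \<le> cmod (poly g z)) \<and>
    (\<forall>z B. 1 \<le> B \<longrightarrow> (\<forall>a. poly \<omega> a = 0 \<longrightarrow> cmod (z - a) \<le> B) \<longrightarrow> cmod (poly g z) \<le> B ^ degree s)"
  using assms
proof (induction "degree s" arbitrary: s \<omega>)
  case (0 s \<omega>)
  then have "poly s a \<noteq> 0" for a by (metis degree_eq_zeroE pCons_0_0 poly_const_conv)
  then show ?case by (intro exI[of _ 1] exI[of _ s] exI[of _ \<omega>]) (use 0 in auto)
next
  case (Suc n s \<omega>)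
  show ?case
  proof (cases "\<exists>a. poly \<omega> a = 0 \<and> poly s a = 0")
    case False
    then show ?thesis
      by (intro exI[of _ 1] exI[of _ s] exI[of _ \<omega>]) (auto intro: power_le_one one_le_power)
  next
    case True
    then obtain a where a: "poly \<omega> a = 0" "poly s a = 0" by blast
    then obtain s1 \<omega>1 where s1: "s = [:- a, 1:] * s1" and \<omega>1: "\<omega> = [:- a, 1:] * \<omega>1"
      using poly_eq_0_iff_dvd by (metis dvdE)
    have nz: "s1 \<noteq> 0" using Suc.prems s1 by auto
    have deg: "degree s = Suc (degree s1)" unfolding s1 using nz by (subst degree_mult_eq) auto
    then have "n = degree s1" using Suc.hyps(2) by simp
    then obtain g s' \<omega>' where g: "s1 = g * s'" "\<omega>1 = g * \<omega>'" "\<forall>a. poly \<omega>' a = 0 \<longrightarrow> poly s' a \<noteq> 0"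
      "\<And>z \<delta>. 0 < \<delta> \<Longrightarrow> \<delta> \<le> 1 \<Longrightarrow> (\<forall>a. poly \<omega>1 a = 0 \<longrightarrow> \<delta> \<le> cmod (z - a)) \<Longrightarrow> \<delta> ^ degree s1 \<le> cmod (poly g z)"
      "\<And>z B. 1 \<le> B \<Longrightarrow> (\<forall>a. poly \<omega>1 a = 0 \<longrightarrow> cmod (z - a) \<le> B) \<Longrightarrow> cmod (poly g z) \<le> B ^ degree s1"
      using Suc.hyps(1)[OF _ nz, of \<omega>1] by blast
    have 1: "\<delta> ^ degree s \<le> cmod (poly ([:- a, 1:] * g) z)"
      if "0 < \<delta>" "\<delta> \<le> 1" "\<forall>a. poly \<omega> a = 0 \<longrightarrow> \<delta> \<le> cmod (z - a)" for z \<delta>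
    proof -
      have "\<delta> * \<delta> ^ degree s1 \<le> cmod (z - a) * cmod (poly g z)"
        using that a(1) g(4)[of \<delta> z] by (intro mult_mono) (auto simp: \<omega>1)
      then show ?thesis by (simp add: deg norm_mult del: mult_pCons_left)
    qed
    have 2: "cmod (poly ([:- a, 1:] * g) z) \<le> B ^ degree s"
      if "1 \<le> B" "\<forall>a. poly \<omega> a = 0 \<longrightarrow> cmod (z - a) \<le> B" for z B
    proof -
      have "cmod (z - a) * cmod (poly g z) \<le> B * B ^ degree s1"
        using that a(1) g(5)[of B z] by (intro mult_mono) (auto simp: \<omega>1)
      then show ?thesis by (simp add: deg norm_mult del: mult_pCons_left)
    qed
    show ?thesis
      using g(1-3) 1 2 unfolding s1 \<omega>1
      by (intro exI[of _ "[:- a, 1:] * g"] exI[of _ s'] exI[of _ \<omega>']) (auto simp only: mult.assoc)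
  qed
qed

text \<open>The approximant is reduced, so the error \<open>H\<close> may fail to vanish at up to \<open>m\<close> of the nodes. The
  factor \<open>c\<close> makes up for them.\<close>

lemma pade_error_factor:
  assumes mc: "meromorphic_continuation m E f D F" and D: "open D" "E \<subseteq> D" and f: "f analytic_on E"
    and pa: "pade_approximant E \<beta> f n m D P q" and S: "S \<subseteq> E"
    and \<beta>: "\<And>k. 1 \<le> k \<Longrightarrow> k \<le> n + m + 1 \<Longrightarrow> \<beta> (n + m + 1) k \<in> S"
  shows "\<exists>G c. G analytic_on D \<and>
    (\<forall>z\<in>D - S. G z * poly (node_poly \<beta> (n + m + 1)) z = c z *
      remove_sings (\<lambda>z. poly (pole_poly D F) z * F z * poly q z - poly (pole_poly D F) z * poly P z) z) \<and>
    (\<forall>z \<delta>. 0 < \<delta> \<longrightarrow> \<delta> \<le> 1 \<longrightarrow> (\<forall>a\<in>S. \<delta> \<le> cmod (z - a)) \<longrightarrow> \<delta> ^ m \<le> cmod (c z)) \<and>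
    (\<forall>z B. 1 \<le> B \<longrightarrow> (\<forall>a\<in>S. cmod (z - a) \<le> B) \<longrightarrow> cmod (c z) \<le> B ^ m)"
proof -
  define Q where "Q = pole_poly D F"
  define H where "H = remove_sings (\<lambda>z. poly Q z * F z * poly q z - poly Q z * poly P z)"
  define \<omega> where "\<omega> = node_poly \<beta> (n + m + 1)"
  have root: "a \<in> S" if "poly \<omega> a = 0" for a
    using that \<beta> by (auto simp: \<omega>_def node_poly_def poly_prod)
  have H: "H analytic_on D" unfolding H_def Q_def by (rule meromorphic_continuation_error[OF mc D f])
  obtain U where U: "open U" "E \<subseteq> U" "U \<subseteq> D" "\<And>z. z \<in> U \<Longrightarrow> H z = poly Q z * (f z * poly q z - poly P z)"
    using meromorphic_continuation_error(2)[OF mc D f, of q P] unfolding H_def Q_def by blast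
  obtain p0 q0 h U0 where pq: "degree q0 \<le> m" "q0 \<noteq> 0" "h analytic_on E" "open U0" "E \<subseteq> U0"
    "\<And>z. z \<in> U0 \<Longrightarrow> f z * poly q0 z - poly p0 z = poly \<omega> z * h z"
    and cross: "P * q0 = p0 * q" and q: "q \<noteq> 0" and cop: "coprime P q"
    using pa unfolding pade_approximant_def pade_pair_def \<omega>_def by blast
  have nocom: "poly q a \<noteq> 0" if "poly P a = 0" for a
  proof
    assume "poly q a = 0"
    then have "[:- a, 1:] dvd P" "[:- a, 1:] dvd q" using that poly_eq_0_iff_dvd by blast+
    then have "is_unit [:- a, 1:]" using cop coprime_common_divisor by blast
    then show False by (simp add: is_unit_pCons_iff)
  qed
  \<comment> \<open>\<open>s\<close> is the factor lost in passing from the interpolating pair to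
    the reduced fraction. Its degree is at most \<open>m\<close>.\<close>
  obtain s where s: "q0 = q * s" "p0 = P * s"
    using complex_poly_cross_mult_factor[OF cross q nocom] by blast
  have s0: "s \<noteq> 0" using pq(2) s by auto
  have degs: "degree s \<le> m" using pq(1) q s0 by (simp add: s degree_mult_eq)
  obtain g s' \<omega>' where g: "s = g * s'" "\<omega> = g * \<omega>'" "\<And>a. poly \<omega>' a = 0 \<Longrightarrow> poly s' a \<noteq> 0"
    "\<And>z \<delta>. 0 < \<delta> \<Longrightarrow> \<delta> \<le> 1 \<Longrightarrow> (\<forall>a. poly \<omega> a = 0 \<longrightarrow> \<delta> \<le> cmod (z - a)) \<Longrightarrow> \<delta> ^ degree s \<le> cmod (poly g z)"
    "\<And>z B. 1 \<le> B \<Longrightarrow> (\<forall>a. poly \<omega> a = 0 \<longrightarrow> cmod (z - a) \<le> B) \<Longrightarrow> cmod (poly g z) \<le> B ^ degree s"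
    using complex_poly_common_factor[OF s0, of \<omega>] by blast
  have g0: "g \<noteq> 0" using s0 g(1) by auto
  have \<omega>0: "\<omega> \<noteq> 0" by (metis \<omega>_def add_is_0 degree_0 degree_node_poly one_neq_zero)
  have \<omega>'0: "\<omega>' \<noteq> 0" using \<omega>0 g(2) by auto
  \<comment> \<open>Near a node the interpolation condition reads s' H = Q \<omega>' h after
    division by \<open>g\<close>. At a zero of \<open>\<omega>'\<close> the factor \<open>s'\<close>
    does not vanish, so H / \<omega>' continues analytically as Q h / s'.\<close>
  define G where "G z = (if poly \<omega>' z = 0 then poly Q z * h z / poly s' z else H z / poly \<omega>' z)" for z
  have "G analytic_on {z}" if z: "z \<in> D" for z
  proof (cases "poly \<omega>' z = 0")
    case False
    have "open {w. poly \<omega>' w \<noteq> 0}" by (intro open_Collect_neq continuous_intros)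
    then have "eventually (\<lambda>w. w \<in> {w. poly \<omega>' w \<noteq> 0}) (nhds z)"
      using False by (intro eventually_nhds_in_open) auto
    then have ev: "eventually (\<lambda>w. G w = H w / poly \<omega>' w) (nhds z)"
      by eventually_elim (simp add: G_def)
    have "(\<lambda>w. H w / poly \<omega>' w) analytic_on {z}"
      using H z False by (intro analytic_intros analytic_on_poly) (auto intro: analytic_on_subset)
    then show ?thesis using analytic_at_cong[OF ev refl] by simp
  next
    case True
    then have zS: "z \<in> S" using root g(2) by simp
    then have zE: "z \<in> E" using S by auto
    \<comment> \<open>Excluding the remaining zeros of \<open>g\<close> and \<open>\<omega>'\<close>
      allows the division by \<open>g\<close> at all points near \<open>z\<close> other than
      \<open>z\<close>.\<close>
    define A where "A = {w. poly g w = 0} \<union> {w. poly \<omega>' w = 0} - {z}"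
    have "finite A" unfolding A_def using poly_roots_finite[OF g0] poly_roots_finite[OF \<omega>'0] by auto
    then have oA: "open (- A)" using finite_imp_closed by blast
    have "open {w. poly s' w \<noteq> 0}" by (intro open_Collect_neq continuous_intros)
    then have "eventually (\<lambda>w. w \<in> U \<inter> U0 \<inter> - A \<inter> {w. poly s' w \<noteq> 0}) (nhds z)"
      using U(1,2) pq(4,5) zE oA g(3)[OF True] by (intro eventually_nhds_in_open open_Int) (auto simp: A_def)
    then have ev: "eventually (\<lambda>w. G w = poly Q w * h w / poly s' w) (nhds z)"
    proof eventually_elim
      case (elim w)
      show ?case
      proof (cases "poly \<omega>' w = 0")
        case False
        then have gw: "poly g w \<noteq> 0" using elim True by (auto simp: A_def)
        have "poly g w * poly s' w * H w = poly Q w * (f w * poly q0 w - poly p0 w)"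
        proof -
          have Hw: "H w = poly Q w * (f w * poly q w - poly P w)" using elim by (intro U(4)) auto
          show ?thesis unfolding Hw s g(1) by (simp add: algebra_simps)
        qed
        also have "\<dots> = poly g w * (poly Q w * poly \<omega>' w * h w)"
        proof -
          have w: "f w * poly q0 w - poly p0 w = poly \<omega> w * h w" using elim by (intro pq(6)) auto
          show ?thesis unfolding w g(2) by simp
        qed
        finally have "poly s' w * H w = poly Q w * poly \<omega>' w * h w" using gw by (simp add: mult.assoc)
        then show ?thesis using False elim by (simp add: G_def field_simps)
      qed (simp add: G_def)
    qed
    have "(\<lambda>w. poly Q w * h w / poly s' w) analytic_on {z}"
      using pq(3) zE g(3)[OF True] by (intro analytic_intros analytic_on_poly) (auto intro: analytic_on_subset)
    then show ?thesis using analytic_at_cong[OF ev refl] by simp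
  qed
  then have 1: "G analytic_on D" using analytic_on_analytic_at by blast
  have 2: "G z * poly \<omega> z = poly g z * H z" if "z \<in> D - S" for z
  proof -
    have "poly \<omega> z \<noteq> 0" using root that by auto
    then have "poly \<omega>' z \<noteq> 0" using g(2) by auto
    then show ?thesis by (simp add: G_def g(2))
  qed
  have 3: "\<delta> ^ m \<le> cmod (poly g z)" if "0 < \<delta>" "\<delta> \<le> 1" "\<forall>a\<in>S. \<delta> \<le> cmod (z - a)" for z \<delta>
  proof -
    have "\<delta> ^ m \<le> \<delta> ^ degree s" using that degs by (intro power_decreasing) auto
    also have "\<dots> \<le> cmod (poly g z)" using that root by (intro g(4)) auto
    finally show ?thesis .
  qed
  have 4: "cmod (poly g z) \<le> B ^ m" if "1 \<le> B" "\<forall>a\<in>S. cmod (z - a) \<le> B" for z B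
  proof -
    have "cmod (poly g z) \<le> B ^ degree s" using that root by (intro g(5)) auto
    also have "\<dots> \<le> B ^ m" using that degs by (intro power_increasing) auto
    finally show ?thesis .
  qed
  show ?thesis
    using 1 2 3 4 unfolding H_def Q_def \<omega>_def by (intro exI[of _ G] exI[of _ "poly g"]) auto
qed

subsection \<open>Convergence of the zero counting measures\<close>

lemma pot_bounds:
  assumes I: "pos_mean S I" and z: "z \<notin> S" "0 < \<delta>" "\<And>t. t \<in> S \<Longrightarrow> \<delta> \<le> cmod (z - t)" "\<And>t. t \<in> S \<Longrightarrow> cmod (z - t) \<le> B"
  shows "\<bar>pot I z\<bar> \<le> \<bar>ln \<delta>\<bar> + \<bar>ln B\<bar>"
proof -
  have "\<bar>I (\<lambda>t. ln (cmod (z - t))) - I (\<lambda>_. 0)\<bar> \<le> \<bar>ln \<delta>\<bar> + \<bar>ln B\<bar>"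
  proof (rule pos_mean_dist_const[OF I continuous_on_ln_dist[OF z(1)]])
    fix t assume t: "t \<in> S"
    have "ln \<delta> \<le> ln (cmod (z - t))" "ln (cmod (z - t)) \<le> ln B"
      using z(2) z(3)[OF t] z(4)[OF t] by (auto intro!: ln_mono)
    then show "\<bar>ln (cmod (z - t)) - 0\<bar> \<le> \<bar>ln \<delta>\<bar> + \<bar>ln B\<bar>" by linarith
  qed auto
  then show ?thesis by (simp add: pot_def pos_mean_const[OF I])
qed

lemma sup_norm_on_upper:
  fixes g :: "complex \<Rightarrow> 'a::real_normed_vector"
  assumes "compact K" "continuous_on K g" "k \<in> K"
  shows "norm (g k) \<le> sup_norm_on K g"
  unfolding sup_norm_on_def
proof (rule cSUP_upper[OF assms(3)])
  have "bounded ((\<lambda>z. norm (g z)) ` K)"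
    using assms by (intro compact_imp_bounded compact_continuous_image continuous_intros)
  then show "bdd_above ((\<lambda>z. norm (g z)) ` K)" by (rule bounded_imp_bdd_above)
qed

lemma compact_cover_balls:
  fixes K :: "'a::metric_space set"
  assumes "compact K" "\<rho> > 0"
  obtains X where "finite X" "X \<subseteq> K" "K \<subseteq> (\<Union>x\<in>X. ball x \<rho>)"
proof -
  have "K \<subseteq> (\<Union>x\<in>K. ball x \<rho>)" using assms(2) by auto
  then show thesis
    using compactE_image[OF assms(1), of K "\<lambda>x. ball x \<rho>"] that by (metis open_ball)
qed

text \<open>With \<open>V\<close> the closed \<open>d\<close>-neighbourhood of \<open>E\<close>, the maximum modulus principle for \<open>G n\<close> on \<open>V\<close>
  compares \<open>|G n z|\<close>, which behaves like \<open>exp (n (pot J z - pot L z - ln R))\<close>, with its values at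
  distance \<open>d\<close> from \<open>E\<close>.\<close>

lemma pot_diff_le_at_distance:
  fixes E D S :: "complex set" and I :: "nat \<Rightarrow> (complex \<Rightarrow> real) \<Rightarrow> real" and H c G :: "nat \<Rightarrow> complex \<Rightarrow> complex"
    and \<omega> :: "nat \<Rightarrow> complex \<Rightarrow> complex"
  assumes E: "compact E" "E \<noteq> {}" "S \<subseteq> E" "compact S"
    and D: "open D" and d: "0 < d" "d \<le> 1" "\<And>w. infdist w E \<le> d \<Longrightarrow> w \<in> D" and R: "R > 0"
    and I: "\<And>n. pos_mean S (I n)" and J: "pos_mean S J" and L: "pos_mean S L"
    and \<GG>: "\<GG> \<noteq> bot" "\<GG> \<le> sequentially"
    and lim: "\<And>w. w \<notin> S \<Longrightarrow> ((\<lambda>n. pot (I n) w) \<longlongrightarrow> pot L w) \<GG>"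
    and Gan: "\<And>n. G n analytic_on D" and Han: "\<And>n. H n analytic_on D"
    and GH: "\<And>n w. w \<in> D - S \<Longrightarrow> G n w * \<omega> n w = c n w * H n w"
    and \<omega>: "\<And>n w. w \<notin> S \<Longrightarrow> cmod (\<omega> n w) = exp (real (n + m + 1) * pot (I n) w)"
    and clo: "\<And>n w \<delta>. \<lbrakk>0 < \<delta>; \<delta> \<le> 1; \<And>a. a \<in> S \<Longrightarrow> \<delta> \<le> cmod (w - a)\<rbrakk> \<Longrightarrow> \<delta> ^ m \<le> cmod (c n w)"
    and cup: "\<And>n w B. \<lbrakk>1 \<le> B; \<And>a. a \<in> S \<Longrightarrow> cmod (w - a) \<le> B\<rbrakk> \<Longrightarrow> cmod (c n w) \<le> B ^ m"
    and conv: "\<And>K. \<lbrakk>compact K; K \<noteq> {}; K \<subseteq> D - E\<rbrakk> \<Longrightarrow>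
      ((\<lambda>n. root n (sup_norm_on K (H n))) \<longlongrightarrow> sup_norm_on K (\<lambda>w. exp (pot J w)) / R) \<GG>"
    and z: "z \<notin> E" "infdist z E \<le> d"
  shows "\<exists>k. k \<notin> E \<and> infdist k E = d \<and> pot J z - pot L z \<le> pot J k - pot L k"
proof -
  define v where "v w = pot J w - pot L w" for w
  define V where "V = {w. infdist w E \<le> d}"
  define K where "K = {w. infdist w E = d}"
  have cE: "closed E" using E(1) compact_imp_closed by blast
  obtain b where b: "\<And>w. w \<in> E \<Longrightarrow> cmod w \<le> b"
    using compact_imp_bounded[OF E(1)] by (auto simp: bounded_iff)
  have near: "\<exists>e\<in>E. cmod (w - e) = infdist w E" for w
    using infdist_attains_inf[OF cE E(2), of w] by (metis dist_norm)
  have Vb: "cmod w \<le> b + d" if "w \<in> V" for w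
  proof -
    obtain e where "e \<in> E" "cmod (w - e) \<le> d" using near[of w] \<open>w \<in> V\<close> by (auto simp: V_def)
    then show ?thesis using b[of e] norm_triangle_ineq[of "w - e" e] by simp
  qed
  have "closed V" unfolding V_def by (intro closed_Collect_le continuous_intros)
  moreover have "bounded V" using Vb by (auto simp: bounded_iff)
  ultimately have V: "compact V" using compact_eq_bounded_closed by blast
  have "closed K" unfolding K_def by (intro closed_Collect_eq continuous_intros)
  moreover have KV: "K \<subseteq> V" by (auto simp: K_def V_def)
  ultimately have K: "compact K" using V by (meson bounded_subset compact_eq_bounded_closed)
  have VD: "V \<subseteq> D" using d(3) by (auto simp: V_def)
  have KE: "k \<notin> E" if "k \<in> K" for k using that d(1) by (auto simp: K_def)
  have KS: "k \<notin> S" if "k \<in> K" for k using KE[OF that] E(3) by blast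
  have Kd: "d \<le> cmod (k - t)" if "k \<in> K" "t \<in> S" for k t
    using infdist_le[of t E k] that E(3) by (auto simp: K_def dist_norm)
  have frV: "frontier V \<subseteq> K"
  proof
    fix w assume w: "w \<in> frontier V"
    have "open {w. infdist w E < d}" by (intro open_Collect_less continuous_intros)
    then have "{w. infdist w E < d} \<subseteq> interior V" by (intro interior_maximal) (auto simp: V_def)
    then have "\<not> infdist w E < d" using w by (auto simp: frontier_def)
    moreover have "w \<in> V" using w \<open>closed V\<close> frontier_subset_closed by blast
    ultimately show "w \<in> K" by (auto simp: K_def V_def)
  qed
  have zV: "z \<in> V" using z(2) by (simp add: V_def)
  have zS: "z \<notin> S" using z(1) E(3) by blast
  have "frontier V \<noteq> {}"
    using zV V compact_imp_bounded not_bounded_UNIV by (auto simp: frontier_eq_empty)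
  then have Kn: "K \<noteq> {}" using frV by auto
  have contv: "continuous_on K v"
    unfolding v_def using KS continuous_on_pot[OF E(4) J] continuous_on_pot[OF E(4) L]
    by (intro continuous_on_diff) (auto intro: continuous_on_subset)
  obtain k0 where k0: "k0 \<in> K" "\<And>k. k \<in> K \<Longrightarrow> v k \<le> v k0"
    using continuous_attains_sup[OF K Kn contv] by blast
  obtain \<delta> where \<delta>: "0 < \<delta>" "\<delta> \<le> d" "\<And>t. t \<in> S \<Longrightarrow> \<delta> \<le> cmod (z - t)"
  proof -
    obtain e where "e > 0" "\<And>t. t \<in> S \<Longrightarrow> e \<le> cmod (z - t)"
      using dist_closed_pos[OF compact_imp_closed[OF E(4)] zS] by blast
    then show ?thesis using that[of "min e d"] d(1) by force
  qed
  define B where "B = 2 * \<bar>b\<bar> + 2"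
  have B: "1 \<le> B" "\<And>w t. w \<in> V \<Longrightarrow> t \<in> S \<Longrightarrow> cmod (w - t) \<le> B"
  proof -
    fix w t assume "w \<in> V" "t \<in> S"
    then show "cmod (w - t) \<le> B"
      using Vb[of w] b[of t] E(3) d(2) norm_triangle_ineq4[of w t] by (auto simp: B_def)
  qed (simp add: B_def)
  \<comment> \<open>\<open>A\<close> bounds all potentials \<open>pot (I n)\<close> on
    \<open>K\<close> and at \<open>z\<close>. The degree n + m + 1 exceeds the n of the nth root by
    m + 1, and the surplus factor, between exp (-(m + 1) A) and exp ((m + 1) A), is absorbed in
    constants independent of n.\<close>
  define A where "A = \<bar>ln \<delta>\<bar> + \<bar>ln B\<bar>"
  have potA: "\<bar>pot (I n) w\<bar> \<le> A" if "w \<in> K \<or> w = z" for n w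
    unfolding A_def using that KS zS zV KV B(2) \<delta> Kd by (intro pot_bounds[OF I]) (auto intro: order.trans)
  have norm\<omega>: "cmod (\<omega> n w) = exp (n * pot (I n) w) * exp (real (m + 1) * pot (I n) w)" if "w \<notin> S" for n w
    by (simp add: \<omega>[OF that] exp_add[symmetric] algebra_simps)
  have rest: "exp (- (real (m + 1) * A)) \<le> exp (real (m + 1) * pot (I n) w)"
    "exp (real (m + 1) * pot (I n) w) \<le> exp (real (m + 1) * A)" if "w \<in> K \<or> w = z" for n w
  proof -
    have "- A \<le> pot (I n) w" "pot (I n) w \<le> A" using potA[OF that, of n] by (auto simp: abs_le_iff)
    then have "real (m + 1) * - A \<le> real (m + 1) * pot (I n) w" "real (m + 1) * pot (I n) w \<le> real (m + 1) * A"
      by (intro mult_left_mono; simp)+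
    then show "exp (- (real (m + 1) * A)) \<le> exp (real (m + 1) * pot (I n) w)"
      "exp (real (m + 1) * pot (I n) w) \<le> exp (real (m + 1) * A)" by auto
  qed
  define C1 where "C1 = B ^ m * exp (real (m + 1) * A)"
  define C2 where "C2 = \<delta> ^ m * exp (- (real (m + 1) * A))"
  have C: "C1 > 0" "C2 > 0" using B(1) \<delta>(1) by (auto simp: C1_def C2_def)
  have expR: "exp (real n * x) / R ^ n = exp (real n * (x - ln R))" for n x
  proof -
    have "R ^ n = exp (real n * ln R)" using R by (metis exp_ln exp_of_nat_mult)
    then show ?thesis by (simp add: exp_diff right_diff_distrib)
  qed
  \<comment> \<open>The hypothesis only yields maximum norms, so \<open>K\<close> is covered by
    pieces of radius \<epsilon> d, on which every potential varies by at most \<epsilon>. Of the 5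
    \<epsilon>, two come from \<open>H\<close> (variation and strict inequality), two from
    \<open>\<omega>\<close> (variation and convergence), and one is spare.\<close>
  have upper: "\<forall>\<^sub>F n in \<GG>. \<forall>k\<in>K. cmod (G n k) \<le> C1 * exp (real n * (v k0 - ln R + 5 * \<epsilon>))" if \<epsilon>: "\<epsilon> > 0" for \<epsilon>
  proof -
    have "\<epsilon> * d > 0" using \<epsilon> d(1) by simp
    then obtain X where X: "finite X" "X \<subseteq> K" "K \<subseteq> (\<Union>x\<in>X. ball x (\<epsilon> * d))"
      using compact_cover_balls[OF K] by blast
    have var: "\<bar>pot M k - pot M x\<bar> \<le> \<epsilon>" if M: "pos_mean S M" and kx: "k \<in> K" "x \<in> K" "dist x k \<le> \<epsilon> * d" for M k x
    proof -
      have "\<bar>pot M k - pot M x\<bar> \<le> cmod (k - x) / d"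
        using kx Kd by (intro pot_lipschitz[OF M d(1)]) auto
      also have "\<dots> \<le> \<epsilon>" using kx(3) d(1) by (simp add: divide_le_eq dist_norm norm_minus_commute)
      finally show ?thesis .
    qed
    have ev: "\<forall>\<^sub>F n in \<GG>. \<forall>k\<in>K \<inter> cball x (\<epsilon> * d). cmod (G n k) \<le> C1 * exp (real n * (v k0 - ln R + 5 * \<epsilon>))"
      if x: "x \<in> X" for x
    proof -
      define Kx where "Kx = K \<inter> cball x (\<epsilon> * d)"
      have xK: "x \<in> K" using x X by auto
      have Kx: "compact Kx" "Kx \<noteq> {}" "Kx \<subseteq> D - E"
        using K xK KV VD KE \<epsilon> d(1) by (auto simp: Kx_def)
      have "sup_norm_on Kx (\<lambda>w. exp (pot J w)) \<le> exp (pot J x + \<epsilon>)"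
        unfolding sup_norm_on_def
      proof (rule cSUP_least[OF Kx(2)])
        fix k assume "k \<in> Kx"
        then have "\<bar>pot J k - pot J x\<bar> \<le> \<epsilon>" using var[OF J _ xK] by (auto simp: Kx_def)
        then show "norm (exp (pot J k)) \<le> exp (pot J x + \<epsilon>)" by (simp add: abs_le_iff)
      qed
      then have "sup_norm_on Kx (\<lambda>w. exp (pot J w)) / R < exp (pot J x + 2 * \<epsilon>) / R"
        using R \<epsilon> by (intro divide_strict_right_mono) (auto intro: order.strict_trans1)
      then have e1: "\<forall>\<^sub>F n in \<GG>. root n (sup_norm_on Kx (H n)) < exp (pot J x + 2 * \<epsilon>) / R"
        by (rule order_tendstoD(2)[OF conv[OF Kx]])
      have e2: "\<forall>\<^sub>F n in \<GG>. pot L x - \<epsilon> < pot (I n) x"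
        using lim[OF KS[OF xK]] \<epsilon> by (intro order_tendstoD(1)) auto
      have e3: "\<forall>\<^sub>F n in \<GG>. n > 0"
        using filter_leD[OF \<GG>(2) eventually_gt_at_top[of 0]] .
      show ?thesis
        using e1 e2 e3
      proof eventually_elim
        case (elim n)
        show ?case
        proof
          fix k assume k: "k \<in> K \<inter> cball x (\<epsilon> * d)"
          have kK: "k \<in> K" and kS: "k \<notin> S" using k KS by auto
          have kD: "k \<in> D - S" using kK KV VD kS by auto
          let ?s = "sup_norm_on Kx (H n)"
          have "continuous_on Kx (H n)"
            using Han[of n] Kx(3) by (intro holomorphic_on_imp_continuous_on analytic_imp_holomorphic) (auto intro: analytic_on_subset)
          then have s: "cmod (H n k) \<le> ?s" using k by (intro sup_norm_on_upper Kx(1)) (auto simp: Kx_def)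
          then have s0: "0 \<le> ?s" by (meson norm_ge_zero order.trans)
          have "?s = root n ?s ^ n" using elim(3) s0 by simp
          also have "\<dots> \<le> (exp (pot J x + 2 * \<epsilon>) / R) ^ n"
            using elim s0 by (intro power_mono) (auto simp: real_root_ge_zero)
          also have "\<dots> = exp (real n * (pot J x + 2 * \<epsilon> - ln R))"
            by (simp add: power_divide exp_of_nat_mult[symmetric] expR)
          finally have Hk: "cmod (H n k) \<le> exp (real n * (pot J x + 2 * \<epsilon> - ln R))" using s by simp
          have "pot L x - 2 * \<epsilon> \<le> pot (I n) k"
            using var[OF I kK xK, of n] k elim(2) by (auto simp: abs_le_iff)
          then have "exp (real n * (pot L x - 2 * \<epsilon>)) * exp (- (real (m + 1) * A)) \<le> cmod (\<omega> n k)"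
            unfolding norm\<omega>[OF kS] using rest(1)[of k n] kK by (intro mult_mono) (auto intro: mult_left_mono)
          then have "cmod (G n k) * (exp (real n * (pot L x - 2 * \<epsilon>)) * exp (- (real (m + 1) * A))) \<le> cmod (G n k) * cmod (\<omega> n k)"
            by (intro mult_left_mono) auto
          also have "\<dots> = cmod (c n k) * cmod (H n k)"
            using GH[OF kD, of n] by (simp add: norm_mult[symmetric])
          also have "\<dots> \<le> B ^ m * exp (real n * (pot J x + 2 * \<epsilon> - ln R))"
            using kK KV B by (intro mult_mono Hk cup) auto
          finally have "cmod (G n k) \<le> B ^ m * exp (real n * (pot J x + 2 * \<epsilon> - ln R)) /
              (exp (real n * (pot L x - 2 * \<epsilon>)) * exp (- (real (m + 1) * A)))"
            by (simp add: pos_le_divide_eq)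
          also have "\<dots> = C1 * exp (real n * (v x - ln R + 4 * \<epsilon>))"
            unfolding C1_def v_def by (simp add: exp_minus exp_add[symmetric] exp_diff field_simps)
          also have "\<dots> \<le> C1 * exp (real n * (v k0 - ln R + 5 * \<epsilon>))"
          proof -
            have "real n * (v x - ln R + 4 * \<epsilon>) \<le> real n * (v k0 - ln R + 5 * \<epsilon>)"
              using k0(2)[OF xK] \<epsilon> by (intro mult_left_mono) auto
            then show ?thesis using C(1) by simp
          qed
          finally show "cmod (G n k) \<le> C1 * exp (real n * (v k0 - ln R + 5 * \<epsilon>))" .
        qed
      qed
    qed
    then have "\<forall>\<^sub>F n in \<GG>. \<forall>x\<in>X. \<forall>k\<in>K \<inter> cball x (\<epsilon> * d). cmod (G n k) \<le> C1 * exp (real n * (v k0 - ln R + 5 * \<epsilon>))"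
      using X(1) by (intro eventually_ball_finite) auto
    then show ?thesis
      by eventually_elim (use X(3) in \<open>force simp: subset_iff\<close>)
  qed
  \<comment> \<open>Applied to the compact set {z}, the hypothesis is a pointwise limit and bounds
    the error from below. \<open>H\<close> and \<open>\<omega>\<close> cost \<epsilon> each.\<close>
  have lower: "\<forall>\<^sub>F n in \<GG>. C2 * exp (real n * (v z - ln R - 2 * \<epsilon>)) \<le> cmod (G n z)" if \<epsilon>: "\<epsilon> > 0" for \<epsilon>
  proof -
    have zDS: "z \<in> D - S" "{z} \<subseteq> D - E" using zV VD zS z(1) by auto
    have "((\<lambda>n. root n (sup_norm_on {z} (H n))) \<longlongrightarrow> sup_norm_on {z} (\<lambda>w. exp (pot J w)) / R) \<GG>"
      using zDS by (intro conv) auto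
    then have "((\<lambda>n. root n (cmod (H n z))) \<longlongrightarrow> exp (pot J z) / R) \<GG>"
      by (simp add: sup_norm_on_def)
    moreover have "exp (pot J z - \<epsilon>) / R < exp (pot J z) / R"
      using R \<epsilon> by (intro divide_strict_right_mono) auto
    ultimately have e1: "\<forall>\<^sub>F n in \<GG>. exp (pot J z - \<epsilon>) / R < root n (cmod (H n z))"
      by (rule order_tendstoD(1))
    have e2: "\<forall>\<^sub>F n in \<GG>. pot (I n) z < pot L z + \<epsilon>"
      using lim[OF zS] \<epsilon> by (intro order_tendstoD(2)) auto
    have e3: "\<forall>\<^sub>F n in \<GG>. n > 0"
      using filter_leD[OF \<GG>(2) eventually_gt_at_top[of 0]] .
    show ?thesis
      using e1 e2 e3
    proof eventually_elim
      case (elim n)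
      have "exp (real n * (pot J z - \<epsilon> - ln R)) = (exp (pot J z - \<epsilon>) / R) ^ n"
        by (simp add: power_divide exp_of_nat_mult[symmetric] expR)
      also have "\<dots> \<le> root n (cmod (H n z)) ^ n"
        using elim(1) R by (intro power_mono) auto
      also have "\<dots> = cmod (H n z)" using elim(3) by simp
      finally have Hz: "exp (real n * (pot J z - \<epsilon> - ln R)) \<le> cmod (H n z)" .
      have \<omega>z: "cmod (\<omega> n z) \<le> exp (real n * (pot L z + \<epsilon>)) * exp (real (m + 1) * A)"
        unfolding norm\<omega>[OF zS] using rest(2)[of z n] elim(2) by (intro mult_mono) (auto intro: mult_left_mono)
      have "\<delta> ^ m * exp (real n * (pot J z - \<epsilon> - ln R)) \<le> cmod (c n z) * cmod (H n z)"
        using \<delta> d(2) by (intro mult_mono Hz clo) auto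
      also have "\<dots> = cmod (G n z) * cmod (\<omega> n z)"
        using GH[OF zDS(1), of n] by (simp add: norm_mult[symmetric])
      also have "\<dots> \<le> cmod (G n z) * (exp (real n * (pot L z + \<epsilon>)) * exp (real (m + 1) * A))"
        by (intro mult_left_mono \<omega>z) auto
      finally have "\<delta> ^ m * exp (real n * (pot J z - \<epsilon> - ln R)) / (exp (real n * (pot L z + \<epsilon>)) * exp (real (m + 1) * A)) \<le> cmod (G n z)"
        by (simp add: pos_divide_le_eq)
      moreover have "\<delta> ^ m * exp (real n * (pot J z - \<epsilon> - ln R)) / (exp (real n * (pot L z + \<epsilon>)) * exp (real (m + 1) * A)) =
          C2 * exp (real n * (v z - ln R - 2 * \<epsilon>))"
        unfolding C2_def v_def by (simp add: exp_minus exp_add[symmetric] exp_diff field_simps)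
      ultimately show ?case by simp
    qed
  qed
  have maxmod: "cmod (G n z) \<le> M" if "\<forall>k\<in>K. cmod (G n k) \<le> M" for n M
  proof (rule maximum_modulus_frontier[of "G n" V])
    have h: "G n holomorphic_on D" using Gan analytic_imp_holomorphic by blast
    then show "G n holomorphic_on interior V" using VD interior_subset holomorphic_on_subset by blast
    show "continuous_on (closure V) (G n)"
      using h VD \<open>closed V\<close> holomorphic_on_imp_continuous_on continuous_on_subset by (metis closure_closed)
  qed (use that frV zV \<open>bounded V\<close> in auto)
  \<comment> \<open>The two bounds together lose 7 \<epsilon>. A gap of more than 8 \<epsilon> would
    leave exp (n \<epsilon>) \<le> C1 / C2 for arbitrarily large n.\<close>
  have approx: "v z \<le> v k0 + 8 * \<epsilon>" if \<epsilon>: "\<epsilon> > 0" for \<epsilon>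
  proof (rule ccontr)
    assume "\<not> v z \<le> v k0 + 8 * \<epsilon>"
    then have \<tau>: "\<epsilon> \<le> v z - v k0 - 7 * \<epsilon>" by simp
    obtain n0 :: nat where n0: "C1 / C2 / \<epsilon> < n0" using reals_Archimedean2 by blast
    have "\<forall>\<^sub>F n in \<GG>. n \<ge> n0"
      using filter_leD[OF \<GG>(2) eventually_ge_at_top] .
    with upper[OF \<epsilon>] lower[OF \<epsilon>] have "\<forall>\<^sub>F n in \<GG>. False"
    proof eventually_elim
      case (elim n)
      have "C2 * exp (real n * (v z - ln R - 2 * \<epsilon>)) \<le> C1 * exp (real n * (v k0 - ln R + 5 * \<epsilon>))"
        using elim(2) maxmod[OF elim(1)] by linarith
      then have "exp (real n * (v z - ln R - 2 * \<epsilon>)) / exp (real n * (v k0 - ln R + 5 * \<epsilon>)) \<le> C1 / C2"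
        using C by (simp add: field_simps)
      moreover have "exp (real n * (v z - ln R - 2 * \<epsilon>)) / exp (real n * (v k0 - ln R + 5 * \<epsilon>)) = exp (real n * (v z - v k0 - 7 * \<epsilon>))"
        by (simp add: exp_diff[symmetric] algebra_simps)
      moreover have "real n0 * \<epsilon> \<le> real n * (v z - v k0 - 7 * \<epsilon>)"
        using elim(3) \<tau> \<epsilon> by (intro mult_mono) auto
      moreover have "C1 / C2 < real n0 * \<epsilon>" using n0 unfolding pos_divide_less_eq[OF \<epsilon>] .
      ultimately show False
        using exp_ge_add_one_self[of "real n * (v z - v k0 - 7 * \<epsilon>)"] by linarith
    qed
    then show False using \<GG>(1) by (simp add: trivial_limit_def)
  qed
  have "v z \<le> v k0"
  proof (rule field_le_epsilon)
    fix e :: real assume "e > 0"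
    then show "v z \<le> v k0 + e" using approx[of "e / 8"] by simp
  qed
  moreover have "infdist k0 E = d" using k0(1) by (simp add: K_def)
  ultimately show ?thesis
    using KE[OF k0(1)] unfolding v_def by blast
qed

text \<open>The measure attached to n belongs to row n + m + 1 of the table, since that row
  determines the approximant of order (n, m).\<close>

theorem theorem1:
  fixes E :: "complex set" and \<mu> :: "complex measure" and \<beta> :: "nat \<Rightarrow> nat \<Rightarrow> complex"
    and m :: nat and f F :: "complex \<Rightarrow> complex" and R :: real and D :: "complex set"
    and Q :: "complex poly" and Pn Qn :: "nat \<Rightarrow> complex poly" and \<Lambda> :: "nat set"
  assumes "regular_compact E"
    and "\<mu> \<in> prob_measures_on (frontier E)"
    and "\<And>n k. 1 \<le> k \<Longrightarrow> k \<le> n \<Longrightarrow> \<beta> n k \<in> frontier E"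
    and "f analytic_on E"
    and "radius_meromorphy m E \<mu> f = ereal R"
    and "rho_max E \<mu> < R"
    and "D = level_set \<mu> R"
    and "connected D"
    and "F = continued m E f D"
    and "Q = pole_poly D F"
    and "\<And>n. pade_approximant E \<beta> f n m D (Pn n) (Qn n)"
    and "infinite \<Lambda>"
    and "\<And>K. compact K \<Longrightarrow> K \<noteq> {} \<Longrightarrow> K \<subseteq> D - E \<Longrightarrow>
           ((\<lambda>n. root n (sup_norm_on K (remove_sings
                   (\<lambda>z. poly Q z * F z * poly (Qn n) z - poly Q z * poly (Pn n) z))))
             \<longlongrightarrow> sup_norm_on K (exp_potential \<mu>) / R) (inf sequentially (principal \<Lambda>))"
  shows "weakly_converges E (\<lambda>n. zero_counting_measure (node_poly \<beta> (n + m + 1))) \<mu>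
           (inf sequentially (principal \<Lambda>))"
proof -
  define S where "S = frontier E"
  have cE: "compact E" and con: "connected (- E)"
    using assms(1) connected_Compl_if_connectedin_sphere by (auto simp: regular_compact_def)
  have S: "compact S" "S \<subseteq> E"
    using cE compact_frontier frontier_subset_closed compact_imp_closed by (auto simp: S_def)
  have \<mu>: "\<mu> \<in> prob_measures_on S" using assms(2) by (simp add: S_def)
  define J :: "(complex \<Rightarrow> real) \<Rightarrow> real" where "J = (\<lambda>\<phi>. LINT t:S|\<mu>. \<phi> t)"
  have J: "pos_mean S J" unfolding J_def by (rule pos_mean_set_integral[OF S(1) \<mu>])
  have En: "E \<noteq> {}" using pos_mean_nonempty[OF J] S(2) by auto
  define \<nu> where "\<nu> n = zero_counting_measure (node_poly \<beta> (n + m + 1))" for n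
  have node: "\<beta> n k \<in> S" if "1 \<le> k" "k \<le> n" for n k using assms(3)[OF that] by (simp add: S_def)
  have \<nu>: "\<nu> n \<in> prob_measures_on S" for n
    unfolding \<nu>_def by (intro zero_counting_measure_in_prob_measures_on[OF S(1)] node) auto
  define I :: "nat \<Rightarrow> (complex \<Rightarrow> real) \<Rightarrow> real" where "I n = (\<lambda>\<phi>. LINT t:S|\<nu> n. \<phi> t)" for n
  have I: "pos_mean S (I n)" for n unfolding I_def by (rule pos_mean_set_integral[OF S(1) \<nu>])
  have op: "open (level_set \<mu> r)" for r by (rule open_level_set[OF S(1) \<mu>])
  have bdd: "bdd_above (exp_potential \<mu> ` E)"
    by (rule exp_potential_bounded[OF S(1) \<mu> compact_imp_bounded[OF cE]])
  have epE: "exp_potential \<mu> w < R" if "w \<in> E" for w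
    using cSUP_upper[OF that bdd] assms(6) by (simp add: rho_max_def)
  have D: "open D" "E \<subseteq> D" using op epE by (auto simp: assms(7) level_set_def)
  obtain e0 where "e0 \<in> E" using En by blast
  then have R: "R > 0" using epE[of e0] exp_potential_nonneg[of \<mu> e0] by linarith
  \<comment> \<open>\<open>continued\<close> is a choice, and \<open>radius_meromorphy\<close> is a
    supremum that need not be attained; the glued continuation shows that the choice is meaningful
    at \<open>R\<close> itself.\<close>
  have "\<exists>F. meromorphic_continuation m E f D F"
    unfolding assms(7)
    using ex_meromorphic_continuation_level_set[OF cE En op bdd assms(6,5)] assms(7,8) by simp
  then have mc: "meromorphic_continuation m E f D F"
    unfolding assms(9) continued_def by (rule someI_ex)
  define H where "H n = remove_sings (\<lambda>z. poly Q z * F z * poly (Qn n) z - poly Q z * poly (Pn n) z)" for n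
  have H: "H n analytic_on D" for n
    unfolding H_def assms(10) by (rule meromorphic_continuation_error(1)[OF mc D assms(4)])
  have "\<exists>G c. G analytic_on D \<and>
      (\<forall>z\<in>D - S. G z * poly (node_poly \<beta> (n + m + 1)) z = c z * H n z) \<and>
      (\<forall>z \<delta>. 0 < \<delta> \<longrightarrow> \<delta> \<le> 1 \<longrightarrow> (\<forall>a\<in>S. \<delta> \<le> cmod (z - a)) \<longrightarrow> \<delta> ^ m \<le> cmod (c z)) \<and>
      (\<forall>z B. 1 \<le> B \<longrightarrow> (\<forall>a\<in>S. cmod (z - a) \<le> B) \<longrightarrow> cmod (c z) \<le> B ^ m)" for n
    unfolding H_def assms(10)
    by (rule pade_error_factor[OF mc D assms(4) assms(11) S(2) node])
  then obtain G c where G: "\<And>n. G n analytic_on D"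
    "\<And>n z. z \<in> D - S \<Longrightarrow> G n z * poly (node_poly \<beta> (n + m + 1)) z = c n z * H n z"
    "\<And>n z \<delta>. 0 < \<delta> \<Longrightarrow> \<delta> \<le> 1 \<Longrightarrow> (\<And>a. a \<in> S \<Longrightarrow> \<delta> \<le> cmod (z - a)) \<Longrightarrow> \<delta> ^ m \<le> cmod (c n z)"
    "\<And>n z B. 1 \<le> B \<Longrightarrow> (\<And>a. a \<in> S \<Longrightarrow> cmod (z - a) \<le> B) \<Longrightarrow> cmod (c n z) \<le> B ^ m"
    by metis
  \<comment> \<open>The closed d-neighbourhood of \<open>E\<close> has to lie in \<open>D\<close>
    for the maximum modulus principle, and d \<le> 1 matches the range in which \<open>c\<close> is
    bounded below.\<close>
  obtain d where d: "0 < d" "d \<le> 1" "\<And>w. infdist w E \<le> d \<Longrightarrow> w \<in> D"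
  proof -
    obtain e where e: "e > 0" "(\<Union>x\<in>E. ball x e) \<subseteq> D"
      using compact_subset_open_imp_ball_epsilon_subset[OF cE D] by metis
    have "w \<in> D" if "infdist w E \<le> min (e / 2) 1" for w
    proof -
      obtain x where "x \<in> E" "infdist w E = dist w x"
        using infdist_attains_inf[OF compact_imp_closed[OF cE] En, of w] by metis
      then have "w \<in> ball x e" using that e(1) by (simp add: dist_commute)
      then show ?thesis using e(2) \<open>x \<in> E\<close> by blast
    qed
    then show ?thesis using e(1) by (intro that[of "min (e / 2) 1"]) auto
  qed
  have "((\<lambda>n. I n g) \<longlongrightarrow> J g) (inf sequentially (principal \<Lambda>))" if g: "continuous_on S g" for g
  proof (rule pos_mean_tendsto_if_cluster_unique[OF S(1) I g])
    fix \<GG> and L :: "(complex \<Rightarrow> real) \<Rightarrow> real"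
    assume \<GG>: "\<GG> \<le> inf sequentially (principal \<Lambda>)" "\<GG> \<noteq> bot" and L: "pos_mean S L"
      and lim: "\<And>\<phi>. continuous_on S \<phi> \<Longrightarrow> ((\<lambda>n. I n \<phi>) \<longlongrightarrow> L \<phi>) \<GG>"
    have "pot L z = pot J z" if z: "z \<notin> E" for z
    proof (rule pot_eq_exterior[OF cE con S(2,1) L J d(1) _ z])
      fix z assume z: "z \<notin> E" "infdist z E \<le> d"
      show "\<exists>k. k \<notin> E \<and> infdist k E = d \<and> pot J z - pot L z \<le> pot J k - pot L k"
      proof (rule pot_diff_le_at_distance[where I = I and G = G and H = H and c = c and m = m and R = R and \<GG> = \<GG>
            and \<omega> = "\<lambda>n. poly (node_poly \<beta> (n + m + 1))", OF cE En S(2,1) D(1) d R I J L \<GG>(2) _ _ G(1) H G(2) _ G(3,4) _ z])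
        show "\<GG> \<le> sequentially" using \<GG>(1) by simp
        show "((\<lambda>n. pot (I n) w) \<longlongrightarrow> pot L w) \<GG>" if "w \<notin> S" for w
          unfolding pot_def by (intro lim continuous_on_ln_dist that)
        show "cmod (poly (node_poly \<beta> (n + m + 1)) w) = exp (real (n + m + 1) * pot (I n) w)" if "w \<notin> S" for n w
          unfolding I_def \<nu>_def by (rule pot_zero_counting_measure[OF S(1) node _ that, symmetric]) auto
        show "((\<lambda>n. root n (sup_norm_on K (H n))) \<longlongrightarrow> sup_norm_on K (\<lambda>w. exp (pot J w)) / R) \<GG>"
          if K: "compact K" "K \<noteq> {}" "K \<subseteq> D - E" for K
        proof -
          have "exp_potential \<mu> w = exp (pot J w)" if "w \<in> K" for w
            unfolding J_def using K(3) S(2) that by (intro exp_potential_eq_exp_pot[OF S(1) \<mu>]) auto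
          then have "sup_norm_on K (exp_potential \<mu>) = sup_norm_on K (\<lambda>w. exp (pot J w))"
            unfolding sup_norm_on_def by (intro SUP_cong) auto
          then show ?thesis
            using tendsto_mono[OF \<GG>(1) assms(13)[OF K]] by (simp add: H_def)
        qed
      qed
    qed
    then show "L g = J g"
      using pos_mean_eq_if_pot_eq_exterior[OF cE con] L J g unfolding S_def by blast
  qed
  note lim = this
  show ?thesis
    unfolding weakly_converges_def
  proof (intro allI impI)
    fix g :: "complex \<Rightarrow> real" assume g: "continuous_on E g"
    have "(LINT z:E|\<nu> n. g z) = I n g" for n
      unfolding I_def by (rule set_integral_subset_carrier[OF S cE \<nu> g])
    moreover have "(LINT z:E|\<mu>. g z) = J g"
      unfolding J_def by (rule set_integral_subset_carrier[OF S cE \<mu> g])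
    ultimately show "((\<lambda>n. LINT z:E|zero_counting_measure (node_poly \<beta> (n + m + 1)). g z) \<longlongrightarrow>
        (LINT z:E|\<mu>. g z)) (inf sequentially (principal \<Lambda>))"
      using lim[OF continuous_on_subset[OF g S(2)]] unfolding \<nu>_def by simp
  qed
qed

end
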